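(* Let $1\le k\le n$ and $d\ge1$. The degree $d$ curve neighborhood of the Schubert point $X(id)$ of $\mathrm{IG}(k,2n+1)$ is $$\Gamma_d(X(id))=X(O_Y(d))\cup X(O_Z(d)).$$ Here $X(O_Z(d))$ is contained in the closed orbit $Z$, while $X(O_Y(d))$ intersects the open orbit $X^\circ$.
   Context: **Geometry.** For $1\le i\le 2n+2$ put $\bar i=2n+3-i$. Let $\widetilde E=\mathbb{C}^{2n+2}$ with basis $e_1,\dots,e_{2n+2}$ and symplectic form with $\widetilde\omega(e_i,e_j)=\delta_{i,\bar j}$ for $i\le j$; $E=\langle e_1,\dots,e_{2n+1}\rangle$, $\omega=\widetilde\omega|_E$. $X=\mathrm{IG}(k,2n+1)$ is the variety of $k$-dimensional $\omega$-isotropic subspaces of $E$; $H_2(X,\mathbb{Z})\cong\mathbb{Z}$. $\mathrm{Sp}_{2n+1}\subset\mathrm{GL}(E)$ is the group preserving $\omega$, $B$ its subgroup of upper triangular matrices; $X^\circ=\{V\in X:e_1\notin V\}$ and $Z=\{V\in X:e_1\in V\}$ are the open and closed $\mathrm{Sp}_{2n+1}$-orbits. **Weyl group.** $W$ is the group of permutations $w$ of $\{1,\dots,2n+2\}$ with $w(\bar i)=\overline{w(i)}$, with simple reflections $s_i$ ($1\le i\le n$, exchanging $i,i+1$ and $\bar i,\overline{i+1}$) and $s_{n+1}$ (exchanging $n+1$ and $\overline{n+1}$), and length $\ell$. For $w\in W$ with $w(j)\ne\bar1$ for all $1\le j\le n+1$, $X(w)$ is the closure of the $B$-orbit of $\langle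 e_{w(1)},\dots,e_{w(k)}\rangle$. **Products.** Hecke product: $w\cdot s_i=ws_i$ if $\ell(ws_i)>\ell(w)$, else $w\cdot s_i=w$; $w\cdot v$ is obtained by multiplying successively by the letters of a reduced word of $v$. Modified Hecke product: $w\cdot_k s_i=ws_i$ if $\ell(ws_i)>\ell(w)$ or $i=k$, else $w\cdot_ks_i=w$. Let $O^\circ(1)=s_1\cdots s_{n+1}\cdots s_1$, $O_Y(1)=s_1s_2\cdots s_{k-1}s_{k+1}\cdots s_{n+1}\cdots s_2s_1$ (the ascending part omits $s_k$; the descending part $s_{n+1}s_n\cdots s_1$ is complete) and $O_Z(1)=s_2\cdots s_{n+1}\cdots s_2$. $w\cdot_kO^\circ(d)$ is obtained by applying $d$ times the successive $\cdot_k$-products by the letters of the word $O^\circ(1)$, left to right. For $d>1$, $O_Z(d)=O_Z(d-1)\cdot O_Z(1)$ and $O_Y(d)=O_Z(d_1)\cdot O_Y(1)\cdot_kO^\circ(d_2)$ where $d_1+d_2+1=d$, $d_1,d_2\ge0$ (index $0$ meaning that the factor is omitted); the coset $O_Y(d)W_P$, where $W_P=\langle s_j: j\neq k\rangle$, does not depend on the choice of $d_1,d_2$, and one may take $O_Y(d)=O_Y(1)\cdot_kO^\circ(d-1)$. **Curve neighborhoods.** For a closed $\Omega\subset X$, $\Gamma_d(\Omega)=\mathrm{ev}_2(\mathrm{ev}_1^{-1}(\Omega))$ with reduced structure, where $\mathrm{ev}_1,\mathrm{ev}_2:\overline{\mathcal M}_{0,2}(X,d)\to X$ are the evaluation maps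 on the moduli space of genus 0 degree $d$ two-pointed stable maps. *)

theory Defs
  imports
    "HOL-Library.Function_Algebras"
    "HOL-Combinatorics.Permutations"
    "HOL-Computational_Algebra.Polynomial"
    "Jordan_Normal_Form.Determinant"
begin

section \<open>The symplectic form and the odd symplectic Grassmannian\<close>

text \<open>Vectors are functions \<^typ>\<open>nat \<Rightarrow> complex\<close>. The coordinates are numbered from 1, and all
  vectors of interest are supported on \<open>{1..2*n+2}\<close>, so that \<open>E\<close> is literally a subspace of
  the even-dimensional space containing it.\<close>

type_synonym cvec = "nat \<Rightarrow> complex"

definition cscale :: "complex \<Rightarrow> cvec \<Rightarrow> cvec" where
  "cscale c v = (\<lambda>i. c * v i)"

global_interpretation cvs: vector_space cscale
  by unfold_locales (auto simp: cscale_def fun_eq_iff algebra_simps)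

definition bvec :: "nat \<Rightarrow> cvec" where
  "bvec i = (\<lambda>j. if j = i then 1 else 0)"

definition bar :: "nat \<Rightarrow> nat \<Rightarrow> nat" where
  "bar n i = 2 * n + 3 - i"

definition odd_space :: "nat \<Rightarrow> cvec set" where
  "odd_space n = cvs.span (bvec ` {1..2*n+1})"

text \<open>The form on the space with basis \<open>bvec 1, \<dots>, bvec (2*n+2)\<close>; \<open>\<omega>\<close> is its restriction
  to \<^term>\<open>odd_space n\<close>.\<close>

definition omega :: "nat \<Rightarrow> cvec \<Rightarrow> cvec \<Rightarrow> complex" where
  "omega n x y = (\<Sum>i=1..n+1. x i * y (bar n i) - x (bar n i) * y i)"

lemma omega_basis:
  assumes "1 \<le> i" "i \<le> j" "j \<le> 2*n+2"
  shows "omega n (bvec i) (bvec j) = (if i = bar n j then 1 else 0)"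
proof -
  have "omega n (bvec i) (bvec j) =
      (\<Sum>l=1..n+1. if l = i then (if i = bar n j then 1 else 0) else 0)"
    unfolding omega_def
  proof (rule sum.cong)
    fix l assume "l \<in> {1..n+1}"
    then show "bvec i l * bvec j (bar n l) - bvec i (bar n l) * bvec j l =
        (if l = i then (if i = bar n j then 1 else 0) else (0::complex))"
      using assms by (auto simp: bvec_def bar_def)
  qed simp
  also have "\<dots> = (if i \<in> {1..n+1} then (if i = bar n j then 1 else 0) else 0)"
    by (rule sum.delta) simp
  also have "\<dots> = (if i = bar n j then 1 else 0)"
    using assms by (auto simp: bar_def)
  finally show ?thesis .
qed

definition IG :: "nat \<Rightarrow> nat \<Rightarrow> cvec set set" where
  "IG n k = {V. cvs.subspace V \<and> V \<subseteq> odd_space n \<and> cvs.dim V = k \<and>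
                (\<forall>x\<in>V. \<forall>y\<in>V. omega n x y = 0)}"

definition open_orbit :: "nat \<Rightarrow> nat \<Rightarrow> cvec set set" where
  "open_orbit n k = {V \<in> IG n k. bvec 1 \<notin> V}"

definition closed_orbit :: "nat \<Rightarrow> nat \<Rightarrow> cvec set set" where
  "closed_orbit n k = {V \<in> IG n k. bvec 1 \<in> V}"

text \<open>An element of \<open>GL(E)\<close> is given by a linear map of the ambient function space that restricts
  to a bijection of \<open>E\<close>; its values outside \<open>E\<close> are never used.\<close>

definition Sp_odd :: "nat \<Rightarrow> (cvec \<Rightarrow> cvec) set" where
  "Sp_odd n = {g. Vector_Spaces.linear cscale cscale g \<and>
                  bij_betw g (odd_space n) (odd_space n) \<and>
                  (\<forall>x\<in>odd_space n. \<forall>y\<in>odd_space n. omega n (g x) (g y) = omega n x y)}"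

text \<open>Column \<open>j\<close> of the matrix of \<open>g\<close> is \<open>g (bvec j)\<close>.\<close>

definition borel :: "nat \<Rightarrow> (cvec \<Rightarrow> cvec) set" where
  "borel n = {g \<in> Sp_odd n. \<forall>i\<in>{1..2*n+1}. \<forall>j\<in>{1..2*n+1}. j < i \<longrightarrow> g (bvec j) i = 0}"


section \<open>Pluecker coordinates and the Zariski topology\<close>

definition is_frame :: "nat \<Rightarrow> cvec set \<Rightarrow> cvec list \<Rightarrow> bool" where
  "is_frame k V vs \<longleftrightarrow> length vs = k \<and> distinct vs \<and> cvs.independent (set vs) \<and>
                       cvs.span (set vs) = V"

text \<open>The maximal minors of the matrix with columns \<open>vs\<close>, indexed by the \<open>k\<close>-element sets of rows.\<close>

definition pluecker :: "nat \<Rightarrow> nat \<Rightarrow> cvec list \<Rightarrow> nat set \<Rightarrow> complex" where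
  "pluecker n k vs I =
     (if I \<subseteq> {1..2*n+1} \<and> card I = k
      then det (mat k k (\<lambda>(a, b). (vs ! b) (sorted_list_of_set I ! a))) else 0)"

text \<open>For \<open>k \<ge> 1\<close> and a \<open>k\<close>-dimensional \<open>V\<close> this is the set of all homogeneous coordinate vectors
  of the Pluecker point of \<open>V\<close>: rescaling a frame vector rescales the coordinate vector.\<close>

definition pluecker_coords :: "nat \<Rightarrow> nat \<Rightarrow> cvec set \<Rightarrow> (nat set \<Rightarrow> complex) set" where
  "pluecker_coords n k V = {pluecker n k vs | vs. is_frame k V vs}"

text \<open>Homogeneous polynomial functions of the given degree in the coordinates \<open>p I\<close>.\<close>

inductive form :: "nat \<Rightarrow> ((nat set \<Rightarrow> complex) \<Rightarrow> complex) \<Rightarrow> bool" where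
  const: "form 0 (\<lambda>p. c)"
| coord: "form 1 (\<lambda>p. p I)"
| add: "form m F \<Longrightarrow> form m G \<Longrightarrow> form m (\<lambda>p. F p + G p)"
| mult: "form l F \<Longrightarrow> form m G \<Longrightarrow> form (l + m) (\<lambda>p. F p * G p)"

definition zariski_closed :: "nat \<Rightarrow> nat \<Rightarrow> cvec set set \<Rightarrow> bool" where
  "zariski_closed n k A \<longleftrightarrow>
     (\<exists>S. (\<forall>F\<in>S. \<exists>m. form m F) \<and>
          A = {V \<in> IG n k. \<forall>F\<in>S. \<forall>p\<in>pluecker_coords n k V. F p = 0})"

definition zariski_closure :: "nat \<Rightarrow> nat \<Rightarrow> cvec set set \<Rightarrow> cvec set set" where
  "zariski_closure n k A = zariski_closed n k hull A"

text \<open>Used only for \<open>w\<close> in the Weyl group with \<open>w j \<noteq> bar n 1\<close> for \<open>1 \<le> j \<le> n+1\<close>.\<close>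

definition schubert :: "nat \<Rightarrow> nat \<Rightarrow> (nat \<Rightarrow> nat) \<Rightarrow> cvec set set" where
  "schubert n k w =
     zariski_closure n k {g ` cvs.span ((\<lambda>j. bvec (w j)) ` {1..k}) | g. g \<in> borel n}"


section \<open>The Weyl group and Hecke products\<close>

definition weyl :: "nat \<Rightarrow> (nat \<Rightarrow> nat) set" where
  "weyl n = {w. w permutes {1..2*n+2} \<and> (\<forall>i\<in>{1..2*n+2}. w (bar n i) = bar n (w i))}"

definition srefl :: "nat \<Rightarrow> nat \<Rightarrow> nat \<Rightarrow> nat" where
  "srefl n i = (if i = n + 1 then Transposition.transpose (n+1) (bar n (n+1))
     else Transposition.transpose i (i+1) \<circ>
          Transposition.transpose (bar n i) (bar n (i+1)))"

definition word_prod :: "nat \<Rightarrow> nat list \<Rightarrow> nat \<Rightarrow> nat" where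
  "word_prod n is = foldr (\<lambda>i w. srefl n i \<circ> w) is id"

lemma srefl_in_weyl:
  assumes i: "i \<in> {1..n+1}"
  shows "srefl n i \<in> weyl n"
proof -
  have perm: "srefl n i permutes {1..2*n+2}"
  proof (cases "i = n + 1")
    case True
    then show ?thesis
      by (simp add: srefl_def bar_def permutes_swap_id)
  next
    case False
    have "Transposition.transpose i (i+1) permutes {1..2*n+2}"
      using i False by (intro permutes_swap_id) auto
    moreover have "Transposition.transpose (bar n i) (bar n (i+1)) permutes {1..2*n+2}"
      using i False by (intro permutes_swap_id) (auto simp: bar_def)
    ultimately show ?thesis
      using False by (simp add: srefl_def permutes_compose)
  qed
  have sym: "srefl n i (bar n j) = bar n (srefl n i j)" if j: "j \<in> {1..2*n+2}" for j
  proof (cases "i = n + 1")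
    case True
    then show ?thesis
      using j by (auto simp: srefl_def bar_def Transposition.transpose_def)
  next
    case False
    then have le: "i \<le> n" "1 \<le> i" using i by auto
    consider "j = i" | "j = i + 1" | "j = bar n i" | "j = bar n (i+1)"
      | "j \<noteq> i" "j \<noteq> i + 1" "j \<noteq> bar n i" "j \<noteq> bar n (i+1)" by blast
    then show ?thesis
    proof cases
      case 5
      have "bar n j \<noteq> i" "bar n j \<noteq> i + 1" "bar n j \<noteq> bar n i" "bar n j \<noteq> bar n (i+1)"
        using 5 le j unfolding bar_def by auto
      then show ?thesis using 5 False by (simp add: srefl_def)
    qed (use le False in \<open>(simp_all add: srefl_def bar_def Transposition.transpose_def, linarith+)\<close>)
  qed
  show ?thesis using perm sym by (simp add: weyl_def)
qed

definition len :: "nat \<Rightarrow> (nat \<Rightarrow> nat) \<Rightarrow> nat" where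
  "len n w = (LEAST l. \<exists>is. set is \<subseteq> {1..n+1} \<and> length is = l \<and> word_prod n is = w)"

definition reduced_word :: "nat \<Rightarrow> (nat \<Rightarrow> nat) \<Rightarrow> nat list \<Rightarrow> bool" where
  "reduced_word n w is \<longleftrightarrow> set is \<subseteq> {1..n+1} \<and> word_prod n is = w \<and> length is = len n w"

definition hecke_refl :: "nat \<Rightarrow> (nat \<Rightarrow> nat) \<Rightarrow> nat \<Rightarrow> nat \<Rightarrow> nat" where
  "hecke_refl n w i = (if len n (w \<circ> srefl n i) > len n w then w \<circ> srefl n i else w)"

text \<open>The Hecke product does not depend on the chosen reduced word of \<open>v\<close>.\<close>

definition hecke :: "nat \<Rightarrow> (nat \<Rightarrow> nat) \<Rightarrow> (nat \<Rightarrow> nat) \<Rightarrow> nat \<Rightarrow> nat" where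
  "hecke n w v = foldl (hecke_refl n) w (SOME is. reduced_word n v is)"

definition mod_hecke_refl :: "nat \<Rightarrow> nat \<Rightarrow> (nat \<Rightarrow> nat) \<Rightarrow> nat \<Rightarrow> nat \<Rightarrow> nat" where
  "mod_hecke_refl n k w i =
     (if len n (w \<circ> srefl n i) > len n w \<or> i = k then w \<circ> srefl n i else w)"

definition O_open_word :: "nat \<Rightarrow> nat list" where
  "O_open_word n = [1..<n+1] @ [n+1] @ rev [1..<n+1]"

definition O_Y_word :: "nat \<Rightarrow> nat \<Rightarrow> nat list" where
  "O_Y_word n k = filter (\<lambda>i. i \<noteq> k) [1..<n+1] @ [n+1] @ rev [1..<n+1]"

definition O_Z_word :: "nat \<Rightarrow> nat list" where
  "O_Z_word n = [2..<n+1] @ [n+1] @ rev [2..<n+1]"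

definition mod_hecke_O_open :: "nat \<Rightarrow> nat \<Rightarrow> (nat \<Rightarrow> nat) \<Rightarrow> nat \<Rightarrow> nat \<Rightarrow> nat" where
  "mod_hecke_O_open n k w d = ((\<lambda>u. foldl (mod_hecke_refl n k) u (O_open_word n)) ^^ d) w"

fun O_Z :: "nat \<Rightarrow> nat \<Rightarrow> nat \<Rightarrow> nat" where
  "O_Z n 0 = id"
| "O_Z n (Suc 0) = word_prod n (O_Z_word n)"
| "O_Z n (Suc (Suc d)) = hecke n (O_Z n (Suc d)) (word_prod n (O_Z_word n))"

text \<open>The representative of \<open>O_Y (d1 + d2 + 1)\<close> belonging to the splitting \<open>(d1, d2)\<close>. The two
  outer factors are omitted when their index is 0.\<close>

definition O_Y :: "nat \<Rightarrow> nat \<Rightarrow> nat \<Rightarrow> nat \<Rightarrow> nat \<Rightarrow> nat" where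
  "O_Y n k d1 d2 =
     mod_hecke_O_open n k
       (if d1 = 0 then word_prod n (O_Y_word n k)
        else hecke n (O_Z n d1) (word_prod n (O_Y_word n k))) d2"


section \<open>Stable maps and curve neighborhoods\<close>

text \<open>The projective line: \<open>Some z\<close> is \<open>[z : 1]\<close> and \<open>None\<close> is \<open>[1 : 0]\<close>. A binary form of degree
  \<open>m\<close> is given by its dehomogenization, a polynomial of degree at most \<open>m\<close>;
  its value at \<open>[1 : 0]\<close> is the coefficient of index \<open>m\<close>.\<close>

type_synonym proj_line = "complex option"

definition form_eval :: "nat \<Rightarrow> complex poly \<Rightarrow> proj_line \<Rightarrow> complex" where
  "form_eval m p x = (case x of Some z \<Rightarrow> poly p z | None \<Rightarrow> coeff p m)"

text \<open>Morphisms of the projective line to \<open>IG n k\<close>. Since \<open>IG n k\<close> is a closed subvariety of the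
  Pluecker projective space, they are the morphisms to the latter with values in \<open>IG n k\<close>, that is,
  tuples of binary forms of equal degree \<open>m\<close> without common zero (automatic here, as the Pluecker
  coordinates of a subspace are not all 0). The hyperplane class generates the Picard group of
  \<open>IG n k\<close> for \<open>1 \<le> k \<le> n\<close>, so \<open>m\<close> is the degree of the map as an element of
  the second homology group of \<open>IG n k\<close>.\<close>

definition is_morphism :: "nat \<Rightarrow> nat \<Rightarrow> nat \<Rightarrow> (proj_line \<Rightarrow> cvec set) \<Rightarrow> bool" where
  "is_morphism n k m f \<longleftrightarrow>
     range f \<subseteq> IG n k \<and>
     (\<exists>F :: nat set \<Rightarrow> complex poly. (\<forall>I. degree (F I) \<le> m) \<and>
        (\<forall>x. (\<lambda>I. form_eval m (F I) x) \<in> pluecker_coords n k (f x)))"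

text \<open>A complete connected nodal curve has arithmetic genus 0 iff all its components are projective
  lines and its dual graph is a tree. In that case a component meets itself nowhere and another
  component in at most one node, so a node is the two-element set of the components through it. For
  \<open>{u, v} \<in> nodes C\<close>, \<open>branch C u v\<close> is the position of the node on component \<open>u\<close>. The
  \<open>i\<close>-th marked point, \<open>i \<in> {1, 2}\<close>, is the point \<open>mark_pt C i\<close> of component \<open>mark_comp C i\<close>.\<close>

record pointed_map =
  comps :: "nat set"
  nodes :: "nat set set"
  branch :: "nat \<Rightarrow> nat \<Rightarrow> proj_line"
  mark_comp :: "nat \<Rightarrow> nat"
  mark_pt :: "nat \<Rightarrow> proj_line"
  comp_map :: "nat \<Rightarrow> proj_line \<Rightarrow> cvec set"
  comp_deg :: "nat \<Rightarrow> nat"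

definition is_tree :: "'a set \<Rightarrow> 'a set set \<Rightarrow> bool" where
  "is_tree U N \<longleftrightarrow>
     finite U \<and> N \<subseteq> {{u, v} | u v. u \<in> U \<and> v \<in> U \<and> u \<noteq> v} \<and>
     (\<forall>u\<in>U. \<forall>v\<in>U. (u, v) \<in> {(a, b). {a, b} \<in> N}\<^sup>*) \<and> card U = card N + 1"

definition node_pts :: "pointed_map \<Rightarrow> nat \<Rightarrow> proj_line set" where
  "node_pts C u = {branch C u v | v. {u, v} \<in> nodes C}"

definition marked_pts :: "pointed_map \<Rightarrow> nat \<Rightarrow> proj_line set" where
  "marked_pts C u = {mark_pt C i | i. i \<in> {1, 2} \<and> mark_comp C i = u}"

text \<open>Two-pointed nodal curves of genus 0: the marked points are distinct and not nodes.\<close>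

definition is_pointed_curve :: "pointed_map \<Rightarrow> bool" where
  "is_pointed_curve C \<longleftrightarrow>
     is_tree (comps C) (nodes C) \<and>
     (\<forall>u\<in>comps C. inj_on (branch C u) {v. {u, v} \<in> nodes C}) \<and>
     mark_comp C ` {1, 2} \<subseteq> comps C \<and>
     inj_on (\<lambda>i. (mark_comp C i, mark_pt C i)) {1, 2} \<and>
     (\<forall>u\<in>comps C. node_pts C u \<inter> marked_pts C u = {})"

text \<open>The closed points of the moduli space are the isomorphism classes of the elements of this set,
  and evaluation is constant on isomorphism classes. A component contracted to a point has degree 0.\<close>

definition stable_maps :: "nat \<Rightarrow> nat \<Rightarrow> nat \<Rightarrow> pointed_map set" where
  "stable_maps n k d = {C. is_pointed_curve C \<and>
     (\<forall>u\<in>comps C. is_morphism n k (comp_deg C u) (comp_map C u)) \<and>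
     (\<forall>u v. {u, v} \<in> nodes C \<longrightarrow>
        comp_map C u (branch C u v) = comp_map C v (branch C v u)) \<and>
     (\<Sum>u\<in>comps C. comp_deg C u) = d \<and>
     (\<forall>u\<in>comps C. comp_deg C u = 0 \<longrightarrow> 3 \<le> card (node_pts C u \<union> marked_pts C u))}"

definition ev :: "nat \<Rightarrow> pointed_map \<Rightarrow> cvec set" where
  "ev i C = comp_map C (mark_comp C i) (mark_pt C i)"

definition curve_nbhd :: "nat \<Rightarrow> nat \<Rightarrow> nat \<Rightarrow> cvec set set \<Rightarrow> cvec set set" where
  "curve_nbhd n k d \<Omega> = ev 2 ` {C \<in> stable_maps n k d. ev 1 C \<in> \<Omega>}"

end

theory Submission
  imports Defs
begin

text \<open>Let \<open>V\<^sub>0\<close> be the Schubert point, spanned by the first \<open>k\<close> basis vectors. Both sides of the equation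
  are the locus of those \<open>V\<close> for which \<open>V \<inter> V\<^sub>0\<close> has dimension at least \<open>k - d\<close>.

  Two points of a rational curve of degree \<open>m\<close> intersect in dimension at least \<open>k - m\<close>: otherwise some
  minor vanishes at the first point to order exceeding \<open>m\<close>, hence identically, although it does not
  vanish at the second. The defects \<open>k - dim (U \<inter> V)\<close> satisfy the triangle inequality, so they add up
  along a chain of curves. Conversely, by the Bruhat decomposition \<open>V\<close> is the image of a coordinate
  subspace under an element of the Borel group, which fixes \<open>V\<^sub>0\<close>, and an explicit curve joins \<open>V\<^sub>0\<close>
  to a coordinate subspace, since the symplectic form pairs every basis vector with at most one other.

  The locus is closed and a union of Borel orbits of coordinate subspaces. Lines of frames
  degenerate one orbit to another, and repeated exchanges of indices lead from every orbit of the
  locus to the one of \<open>O_Z d\<close> if \<open>V\<close> contains the first basis vector, and of \<open>O_Y d\<close> otherwise.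
  These two orbits depend only on the images of \<open>{1..k}\<close>, which are computed on the windows
  of the Weyl group elements; that left and right 0-Hecke operators commute makes the
  computation independent of the reduced words.\<close>

section \<open>Coordinates\<close>

text \<open>In an even symplectic space the generic index set of the locus for \<open>d < k\<close>
  would be \<open>{d+1..k}\<close> together with the partners of \<open>1, ..., d\<close>. The
  partner of \<open>1\<close> is \<open>2*n+2\<close>, which is missing from the odd space. An index
  set therefore either keeps \<open>1\<close> and trades \<open>2, ..., d+1\<close> for their
  partners, or gives \<open>1\<close> up and uses \<open>bar n (k+1)\<close>, the largest index that
  is still compatible with the others. For \<open>d < k\<close> neither of these two sets dominates
  the other, whence two components; membership of \<open>1\<close> is frozen throughout the climb.
  The orbit of a subspace is read off from its pivots, the last nonzero positions of its vectors.
  Orbit closures are not compared in a Bruhat order: an arbitrary closed set containing the target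
  orbit is shown to contain all smaller ones. Although only the images of \<open>{1..k}\<close>
  matter in the end, the Hecke products move entries in and out of the first \<open>k\<close>
  places, so whole windows have to be followed.\<close>

global_interpretation cvp: vector_space_pair cscale cscale
  by unfold_locales

lemma sum_cvec_apply [simp]: "(sum f A :: cvec) i = (\<Sum>a\<in>A. f a i)"
  by (induction A rule: infinite_finite_induct) auto

lemma cscale_apply [simp]: "cscale c v i = c * v i"
  by (simp add: cscale_def)

lemma bvec_apply: "bvec i j = (if j = i then 1 else 0)"
  by (simp add: bvec_def)

lemma inj_bvec: "inj bvec"
  by (metis bvec_apply inj_onI zero_neq_one)

lemma cvec_expand:
  assumes "finite S" "\<And>i. i \<notin> S \<Longrightarrow> x i = 0"
  shows "x = (\<Sum>i\<in>S. cscale (x i) (bvec i))"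
proof
  fix j
  have "(\<Sum>i\<in>S. x i * bvec i j) = (\<Sum>i\<in>S. if i = j then x j else 0)"
    by (rule sum.cong) (auto simp: bvec_apply)
  then show "x j = (\<Sum>i\<in>S. cscale (x i) (bvec i)) j"
    using assms by (simp add: sum.delta')
qed

lemma span_bvec:
  assumes "finite S"
  shows "cvs.span (bvec ` S) = {x. \<forall>i. i \<notin> S \<longrightarrow> x i = 0}"
proof
  show "cvs.span (bvec ` S) \<subseteq> {x. \<forall>i. i \<notin> S \<longrightarrow> x i = 0}"
    by (rule cvs.span_minimal) (auto simp: bvec_apply cvs.subspace_def)
  show "{x. \<forall>i. i \<notin> S \<longrightarrow> x i = 0} \<subseteq> cvs.span (bvec ` S)"
  proof
    fix x :: cvec assume "x \<in> {x. \<forall>i. i \<notin> S \<longrightarrow> x i = 0}"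
    then have "x = (\<Sum>i\<in>S. cscale (x i) (bvec i))"
      using cvec_expand[OF assms] by auto
    also have "\<dots> \<in> cvs.span (bvec ` S)"
      by (intro cvs.span_sum cvs.span_scale cvs.span_base) auto
    finally show "x \<in> cvs.span (bvec ` S)" .
  qed
qed

lemma odd_space_iff: "x \<in> odd_space n \<longleftrightarrow> (\<forall>i. i \<notin> {1..2*n+1} \<longrightarrow> x i = 0)"
  unfolding odd_space_def by (subst span_bvec) auto

lemma subspace_odd_space: "cvs.subspace (odd_space n)"
  by (simp add: odd_space_def)

lemma span_family:
  assumes "finite I"
  shows "cvs.span (u ` I) = {(\<Sum>i\<in>I. cscale (c i) (u i)) | c. True}" (is "_ = ?R")
proof
  have "cvs.subspace ?R"
    unfolding cvs.subspace_def
  proof (intro conjI ballI allI)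
    show "0 \<in> ?R" by (rule CollectI, rule exI[of _ "\<lambda>_. 0"]) simp
    fix x assume "x \<in> ?R"
    then obtain c where c: "x = (\<Sum>i\<in>I. cscale (c i) (u i))" by auto
    show "cscale a x \<in> ?R" for a
      by (rule CollectI, rule exI[of _ "\<lambda>i. a * c i"]) (simp add: c cvs.scale_sum_right)
    fix y assume "y \<in> ?R"
    then obtain d where d: "y = (\<Sum>i\<in>I. cscale (d i) (u i))" by auto
    show "x + y \<in> ?R"
      by (rule CollectI, rule exI[of _ "\<lambda>i. c i + d i"])
        (simp add: c d cvs.scale_left_distrib sum.distrib)
  qed
  moreover have "u i \<in> ?R" if "i \<in> I" for i
  proof (rule CollectI, rule exI[of _ "\<lambda>j. if j = i then 1 else 0"])
    have "(\<Sum>j\<in>I. cscale (if j = i then 1 else 0) (u j)) = (\<Sum>j\<in>I. if j = i then u i else 0)"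
      by (rule sum.cong) auto
    then show "u i = (\<Sum>j\<in>I. cscale (if j = i then 1 else 0) (u j)) \<and> True"
      using assms that by (simp add: sum.delta')
  qed
  ultimately show "cvs.span (u ` I) \<subseteq> ?R"
    by (intro cvs.span_minimal) auto
  show "?R \<subseteq> cvs.span (u ` I)"
    using cvs.span_sum cvs.span_scale cvs.span_base by (auto intro!: cvs.span_sum cvs.span_scale intro: cvs.span_base imageI)
qed

lemma dual_family_independent:
  assumes "finite I" "\<And>i j. i \<in> I \<Longrightarrow> j \<in> I \<Longrightarrow> v i j = (if i = j then 1 else 0)"
  shows "inj_on v I" "cvs.independent (v ` I)"
proof -
  show inj: "inj_on v I"
    by (rule inj_onI) (metis assms(2) zero_neq_one)
  show "cvs.independent (v ` I)"
  proof (rule cvs.independent_if_scalars_zero)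
    show "finite (v ` I)" using assms by simp
    fix f x assume s: "(\<Sum>x\<in>v ` I. cscale (f x) x) = 0" and "x \<in> v ` I"
    then obtain i where i: "i \<in> I" "x = v i" by auto
    have "0 = (\<Sum>j\<in>I. cscale (f (v j)) (v j)) i"
      using s by (simp add: sum.reindex[OF inj])
    also have "\<dots> = (\<Sum>j\<in>I. if j = i then f (v i) else 0)"
      unfolding sum_cvec_apply by (rule sum.cong) (use assms i in auto)
    also have "\<dots> = f x" using assms i by simp
    finally show "f x = 0" by simp
  qed
qed

lemma dim_span_bvec:
  assumes "finite S"
  shows "cvs.dim (cvs.span (bvec ` S)) = card S" "cvs.independent (bvec ` S)"
proof -
  have *: "inj_on bvec S" "cvs.independent (bvec ` S)"
    using dual_family_independent[OF assms, of bvec] by (auto simp: bvec_apply)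
  then show "cvs.independent (bvec ` S)" by simp
  show "cvs.dim (cvs.span (bvec ` S)) = card S"
    using cvs.dim_span_eq_card_independent[OF *(2)] card_image[OF *(1)] by simp
qed

section \<open>The symplectic form\<close>

definition sg :: "nat \<Rightarrow> nat \<Rightarrow> complex" where
  "sg n i = (if i \<le> n + 1 then 1 else - 1)"

lemma bar_bar: "1 \<le> i \<Longrightarrow> i \<le> 2*n+2 \<Longrightarrow> bar n (bar n i) = i"
  by (auto simp: bar_def)

lemma bar_eq_iff: "i \<le> 2*n+2 \<Longrightarrow> j \<le> 2*n+2 \<Longrightarrow> bar n i = bar n j \<longleftrightarrow> i = j"
  unfolding bar_def by linarith

lemma bar_neq: "bar n i \<noteq> i"
  unfolding bar_def by presburger

lemma sg_bar: "1 \<le> i \<Longrightarrow> i \<le> 2*n+2 \<Longrightarrow> sg n (bar n i) = - sg n i"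
  by (auto simp: bar_def sg_def)

lemma sg_sq [simp]: "sg n i * sg n i = 1"
  by (simp add: sg_def)

lemma sg_nz [simp]: "sg n i \<noteq> 0"
  by (simp add: sg_def)

lemma omega_altdef: "omega n x y = (\<Sum>i\<in>{1..2*n+2}. sg n i * x i * y (bar n i))"
proof -
  have split: "{1..2*n+2} = {1..n+1} \<union> bar n ` {1..n+1}"
  proof
    show "{1..2*n+2} \<subseteq> {1..n+1} \<union> bar n ` {1..n+1}"
    proof
      fix i assume i: "i \<in> {1..2*n+2}"
      show "i \<in> {1..n+1} \<union> bar n ` {1..n+1}"
      proof (cases "i \<le> n + 1")
        case False
        then have "bar n i \<in> {1..n+1}" "i = bar n (bar n i)" using i by (auto simp: bar_def)
        then show ?thesis by blast
      qed (use i in auto)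
    qed
  qed (auto simp: bar_def)
  have inj: "inj_on (bar n) {1..n+1}" by (auto simp: inj_on_def bar_def)
  have "(\<Sum>i\<in>{1..2*n+2}. sg n i * x i * y (bar n i)) =
     (\<Sum>i\<in>{1..n+1}. sg n i * x i * y (bar n i)) + (\<Sum>i\<in>bar n ` {1..n+1}. sg n i * x i * y (bar n i))"
    unfolding split by (rule sum.union_disjoint) (auto simp: bar_def)
  also have "(\<Sum>i\<in>bar n ` {1..n+1}. sg n i * x i * y (bar n i)) =
      (\<Sum>i\<in>{1..n+1}. - (x (bar n i) * y i))"
    unfolding sum.reindex[OF inj] by (rule sum.cong) (auto simp: bar_bar sg_def, auto simp: bar_def)
  also have "(\<Sum>i\<in>{1..n+1}. sg n i * x i * y (bar n i)) = (\<Sum>i\<in>{1..n+1}. x i * y (bar n i))"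
    by (rule sum.cong) (auto simp: sg_def)
  finally show ?thesis
    by (simp add: omega_def sum_subtractf sum_negf)
qed

lemma omega_add_left: "omega n (x + x') y = omega n x y + omega n x' y"
  by (simp add: omega_altdef algebra_simps sum.distrib)

lemma omega_add_right: "omega n x (y + y') = omega n x y + omega n x y'"
  by (simp add: omega_altdef algebra_simps sum.distrib)

lemma omega_scale_left: "omega n (cscale c x) y = c * omega n x y"
  by (simp add: omega_altdef algebra_simps sum_distrib_left)

lemma omega_scale_right: "omega n x (cscale c y) = c * omega n x y"
  by (simp add: omega_altdef algebra_simps sum_distrib_left)

lemma omega_zero [simp]: "omega n 0 y = 0" "omega n x 0 = 0"
  by (simp_all add: omega_def)

lemma omega_sum_left: "omega n (sum f A) y = (\<Sum>a\<in>A. omega n (f a) y)"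
  by (induction A rule: infinite_finite_induct)
    (simp_all only: omega_add_left sum.insert sum.empty sum.infinite omega_zero not_False_eq_True)

lemma omega_sum_right: "omega n x (sum f A) = (\<Sum>a\<in>A. omega n x (f a))"
  by (induction A rule: infinite_finite_induct)
    (simp_all only: omega_add_right sum.insert sum.empty sum.infinite omega_zero not_False_eq_True)

lemma omega_sums:
  "omega n (\<Sum>i\<in>A. cscale (a i) (u i)) (\<Sum>j\<in>B. cscale (b j) (w j)) =
     (\<Sum>i\<in>A. \<Sum>j\<in>B. a i * (b j * omega n (u i) (w j)))"
  unfolding omega_sum_left omega_scale_left
  unfolding omega_sum_right omega_scale_right sum_distrib_left ..

lemma omega_swap: "omega n x y = - omega n y x"
  unfolding omega_def sum_negf[symmetric] by (rule sum.cong) (auto simp: algebra_simps)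

lemma omega_self [simp]: "omega n x x = 0"
  by (simp add: omega_def algebra_simps)

lemma omega_bvec_left:
  assumes "1 \<le> i" "i \<le> 2*n+2"
  shows "omega n (bvec i) y = sg n i * y (bar n i)"
proof -
  have "omega n (bvec i) y = (\<Sum>l\<in>{1..2*n+2}. if l = i then sg n i * y (bar n i) else 0)"
    unfolding omega_altdef by (rule sum.cong) (auto simp: bvec_apply)
  then show ?thesis using assms by simp
qed

lemma omega_bvec:
  assumes "1 \<le> i" "i \<le> 2*n+2"
  shows "omega n (bvec i) (bvec j) = (if j = bar n i then sg n i else 0)"
  using assms by (auto simp: omega_bvec_left bvec_apply)

lemma omega_isotropic_span:
  assumes "\<And>x y. x \<in> A \<Longrightarrow> y \<in> A \<Longrightarrow> omega n x y = 0" "x \<in> cvs.span A" "y \<in> cvs.span A"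
  shows "omega n x y = 0"
proof -
  have sub: "cvs.subspace {y. omega n x y = 0}" for x
    by (auto simp: cvs.subspace_def omega_add_right omega_scale_right)
  have sub': "cvs.subspace {x. omega n x y = 0}" for y
    by (auto simp: cvs.subspace_def omega_add_left omega_scale_left)
  have 1: "omega n x y = 0" if "x \<in> A" "y \<in> cvs.span A" for x y
    using cvs.span_minimal[OF _ sub[of x], of A] that assms(1) by auto
  show ?thesis
    using cvs.span_minimal[OF _ sub'[of y], of A] assms(2,3) 1 by auto
qed

section \<open>Echelon bases\<close>

text \<open>The pivot of a vector is its last nonzero position, since upper triangular maps preserve
  the spans of initial segments of the basis. \<open>I\<close> collects the pivots of all vectors of
  \<open>V\<close>. One vector per pivot, reduced at the other pivots, suffices: subtracting these
  from \<open>x\<close> leaves a vector that has no possible pivot.\<close>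

lemma echelon_basis:
  assumes V: "cvs.subspace V" and sup: "\<forall>x\<in>V. \<forall>i. i \<notin> {1..N} \<longrightarrow> x i = 0"
  obtains I v where "I \<subseteq> {1..N}" "\<And>i. i \<in> I \<Longrightarrow> v i \<in> V"
    "\<And>i j. i \<in> I \<Longrightarrow> j \<in> I \<Longrightarrow> v i j = (if i = j then 1 else 0)"
    "\<And>i j. i \<in> I \<Longrightarrow> i < j \<Longrightarrow> v i j = 0"
    "V = cvs.span (v ` I)" "cvs.dim V = card I"
proof -
  define I where "I = {i. \<exists>x\<in>V. x i \<noteq> 0 \<and> (\<forall>j>i. x j = 0)}"
  have IN: "I \<subseteq> {1..N}" using sup by (fastforce simp: I_def)
  have fin: "finite I" using IN finite_subset by blast
  \<comment> \<open>The pivot positions \<open>i - 1, ..., i - m\<close> are cleared from the top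
    down, so that no cleared entry is spoiled later; \<open>m = i\<close> clears everything below
    \<open>i\<close>.\<close>
  have step: "\<exists>x\<in>V. x i = 1 \<and> (\<forall>j>i. x j = 0) \<and> (\<forall>j\<in>I. i - m \<le> j \<longrightarrow> j < i \<longrightarrow> x j = 0)"
    if iI: "i \<in> I" for i m
  proof (induction m)
    case 0
    obtain x where x: "x \<in> V" "x i \<noteq> 0" "\<forall>j>i. x j = 0" using iI by (auto simp: I_def)
    show ?case
      by (rule bexI[of _ "cscale (1 / x i) x"]) (use x V in \<open>auto simp: cvs.subspace_scale\<close>)
  next
    case (Suc m)
    then obtain x where x: "x \<in> V" "x i = 1" "\<forall>j>i. x j = 0"
      "\<forall>j\<in>I. i - m \<le> j \<longrightarrow> j < i \<longrightarrow> x j = 0" by auto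
    show ?case
    proof (cases "i - Suc m \<in> I \<and> m < i")
      case False
      then show ?thesis using x
        by (intro bexI[of _ x]) (auto, metis Suc_diff_Suc Suc_leI diff_is_0_eq' le_neq_implies_less not_less zero_le)
    next
      case True
      define p where "p = i - Suc m"
      have pi: "p < i" using True by (auto simp: p_def)
      obtain y where y: "y \<in> V" "y p \<noteq> 0" "\<forall>j>p. y j = 0"
        using True by (auto simp: I_def p_def)
      define z where "z = x - cscale (x p / y p) y"
      have z: "z j = 0" if "j \<in> I" "p \<le> j" "j < i" for j
      proof (cases "j = p")
        case False
        then have "p < j" "i - m \<le> j" using that by (auto simp: p_def)
        then show ?thesis using x(4) y(3) that by (auto simp: z_def)
      qed (use y(2) in \<open>simp add: z_def\<close>)
      have "z \<in> V" using V x(1) y(1) by (auto simp: z_def cvs.subspace_diff cvs.subspace_scale)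
      moreover have "z i = 1" "\<forall>j>i. z j = 0" using x(2,3) y(3) pi by (auto simp: z_def)
      ultimately show ?thesis using z by (intro bexI[of _ z]) (auto simp: p_def)
    qed
  qed
  have "\<exists>x\<in>V. x i = 1 \<and> (\<forall>j>i. x j = 0) \<and> (\<forall>j\<in>I. j < i \<longrightarrow> x j = 0)" if "i \<in> I" for i
    using step[OF that, of i] by auto
  then obtain v where v: "\<And>i. i \<in> I \<Longrightarrow> v i \<in> V" "\<And>i. i \<in> I \<Longrightarrow> v i i = 1"
     "\<And>i j. i \<in> I \<Longrightarrow> j > i \<Longrightarrow> v i j = 0" "\<And>i j. i \<in> I \<Longrightarrow> j \<in> I \<Longrightarrow> j < i \<Longrightarrow> v i j = 0"
    by metis
  have dual: "v i j = (if i = j then 1 else 0)" if "i \<in> I" "j \<in> I" for i j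
    using v that by (cases i j rule: linorder_cases) auto
  have span: "V = cvs.span (v ` I)"
  proof
    show "cvs.span (v ` I) \<subseteq> V" using v V by (intro cvs.span_minimal) auto
    show "V \<subseteq> cvs.span (v ` I)"
    proof
      fix x assume x: "x \<in> V"
      define y where "y = x - (\<Sum>i\<in>I. cscale (x i) (v i))"
      have yV: "y \<in> V" unfolding y_def using x v V
        by (intro cvs.subspace_diff cvs.subspace_sum cvs.subspace_scale) auto
      have yI: "y j = 0" if "j \<in> I" for j
      proof -
        have "(\<Sum>i\<in>I. x i * v i j) = (\<Sum>i\<in>I. if i = j then x j else 0)"
          using that dual by (auto intro!: sum.cong)
        then show ?thesis using that fin by (simp add: y_def)
      qed
      have "y = 0"
      proof (rule ccontr)
        assume "y \<noteq> 0"
        define S where "S = {i. y i \<noteq> 0}"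
        have "S \<subseteq> {1..N}" using sup yV unfolding S_def by blast
        then have S: "finite S" "S \<noteq> {}" using \<open>y \<noteq> 0\<close> finite_subset by (auto simp: S_def fun_eq_iff)
        have "y (Max S) \<noteq> 0" using Max_in[OF S] by (simp add: S_def)
        moreover have "y j = 0" if "j > Max S" for j
          using that Max_ge[OF S(1), of j] by (fastforce simp: S_def)
        ultimately have "Max S \<in> I" using yV by (auto simp: I_def)
        with yI \<open>y (Max S) \<noteq> 0\<close> show False by blast
      qed
      then have "x = (\<Sum>i\<in>I. cscale (x i) (v i))" by (simp add: y_def)
      also have "\<dots> \<in> cvs.span (v ` I)"
        by (intro cvs.span_sum cvs.span_scale cvs.span_base) auto
      finally show "x \<in> cvs.span (v ` I)" .
    qed
  qed
  have "cvs.dim V = card I"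
    using dual_family_independent[OF fin dual] span
    by (metis card_image cvs.dim_span_eq_card_independent)
  then show thesis using that IN v dual span by blast
qed

section \<open>Bruhat decomposition\<close>

text \<open>The index sets of the isotropic coordinate subspaces.\<close>

definition adm :: "nat \<Rightarrow> nat \<Rightarrow> nat set \<Rightarrow> bool" where
  "adm n k I \<longleftrightarrow> I \<subseteq> {1..2*n+1} \<and> card I = k \<and> (\<forall>i\<in>I. bar n i \<notin> I)"

abbreviation coord_space :: "nat set \<Rightarrow> cvec set" where
  "coord_space I \<equiv> cvs.span (bvec ` I)"

text \<open>\<open>f\<close> lists the columns of a unitriangular matrix. The largest nonzero
  coordinate of \<open>x\<close> reappears unchanged in its image, which gives injectivity; back
  substitution from the top coordinate gives surjectivity.\<close>

lemma unitriangular_borel: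
  assumes sup: "\<And>i. i \<in> {1..2*n+1} \<Longrightarrow> f i \<in> odd_space n"
    and diag: "\<And>i. i \<in> {1..2*n+1} \<Longrightarrow> f i i = 1"
    and tri: "\<And>i j. i \<in> {1..2*n+1} \<Longrightarrow> i < j \<Longrightarrow> f i j = 0"
    and om: "\<And>i j. i \<in> {1..2*n+1} \<Longrightarrow> j \<in> {1..2*n+1} \<Longrightarrow>
      omega n (f i) (f j) = omega n (bvec i) (bvec j)"
  obtains g where "g \<in> borel n" "\<And>i. i \<in> {1..2*n+1} \<Longrightarrow> g (bvec i) = f i"
proof -
  define g where "g x = (\<Sum>i\<in>{1..2*n+1}. cscale (x i) (f i))" for x
  have gb: "g (bvec i) = f i" if "i \<in> {1..2*n+1}" for i
  proof -
    have "g (bvec i) = (\<Sum>j\<in>{1..2*n+1}. if j = i then f i else 0)"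
      unfolding g_def by (rule sum.cong) (auto simp: bvec_apply)
    then show ?thesis using that by simp
  qed
  have lin: "Vector_Spaces.linear cscale cscale g"
    unfolding Vector_Spaces.linear_iff
  proof (intro conjI allI cvs.vector_space_axioms)
    show "g (x + y) = g x + g y" for x y
      unfolding g_def sum.distrib[symmetric] by (rule sum.cong) (auto simp: cvs.scale_left_distrib)
    show "g (cscale c x) = cscale c (g x)" for c x
      unfolding g_def cvs.scale_sum_right by (rule sum.cong) auto
  qed
  have gE: "g x \<in> odd_space n" for x
    unfolding g_def using sup by (intro cvs.subspace_sum cvs.subspace_scale subspace_odd_space) auto
  have top: "g x m = x m" if "m \<in> {1..2*n+1}" "\<And>j. j > m \<Longrightarrow> x j = 0" for x m
  proof -
    have "g x m = (\<Sum>i\<in>{1..2*n+1}. if i = m then x m else 0)"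
      unfolding g_def sum_cvec_apply
    proof (rule sum.cong)
      fix i assume "i \<in> {1..2*n+1}"
      then show "cscale (x i) (f i) m = (if i = m then x m else 0)"
        using that diag tri by (cases i m rule: linorder_cases) auto
    qed simp
    then show ?thesis using that by simp
  qed
  have surj: "\<exists>x\<in>odd_space n. g x = y" if "\<And>i. i \<notin> {1..m} \<Longrightarrow> y i = 0" "m \<le> 2*n+1" for y m
    using that
  proof (induction m arbitrary: y)
    case 0
    then have "y = 0" by (auto simp: fun_eq_iff)
    then show ?case by (intro bexI[of _ 0]) (auto simp: g_def odd_space_iff)
  next
    case (Suc m)
    have sm: "Suc m \<in> {1..2*n+1}" using Suc.prems by auto
    define y' where "y' = y - cscale (y (Suc m)) (f (Suc m))"
    have "y' i = 0" if "i \<notin> {1..m}" for i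
    proof -
      have "f (Suc m) 0 = 0" using sup[OF sm] by (auto simp: odd_space_iff)
      moreover have "y 0 = 0" using Suc.prems(1)[of 0] by simp
      moreover have "i = Suc m \<or> i = 0 \<or> i > Suc m" using that by auto
      ultimately show ?thesis using diag[OF sm] tri[OF sm] Suc.prems(1)
        by (auto simp: y'_def)
    qed
    then obtain x where x: "x \<in> odd_space n" "g x = y'"
      using Suc.IH[of y'] Suc.prems(2) by auto
    have "g (x + cscale (y (Suc m)) (bvec (Suc m))) = y"
      using x gb[OF sm] cvp.linear_add[OF lin] cvp.linear_scale[OF lin] by (simp add: y'_def)
    moreover have "x + cscale (y (Suc m)) (bvec (Suc m)) \<in> odd_space n"
      using x sm by (auto simp: odd_space_iff bvec_apply)
    ultimately show ?case by blast
  qed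
  have inj: "inj_on g (odd_space n)"
    unfolding cvp.linear_inj_on_iff_eq_0[OF lin subspace_odd_space]
  proof (intro ballI impI)
    fix x assume x: "x \<in> odd_space n" "g x = 0"
    show "x = 0"
    proof (rule ccontr)
      assume "x \<noteq> 0"
      define S where "S = {i. x i \<noteq> 0}"
      have "S \<subseteq> {1..2*n+1}" using x by (auto simp: S_def odd_space_iff)
      then have S: "finite S" "S \<noteq> {}" using \<open>x \<noteq> 0\<close> finite_subset by (auto simp: S_def fun_eq_iff)
      have "x j = 0" if "j > Max S" for j
        using that Max_ge[OF S(1), of j] by (fastforce simp: S_def)
      then have "g x (Max S) = x (Max S)" using Max_in[OF S] \<open>S \<subseteq> _\<close> by (intro top) auto
      then show False using x Max_in[OF S] by (simp add: S_def)
    qed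
  qed
  have bij: "bij_betw g (odd_space n) (odd_space n)"
    unfolding bij_betw_def
  proof (intro conjI inj subset_antisym subsetI)
    fix y assume "y \<in> odd_space n"
    then show "y \<in> g ` odd_space n"
      using surj[of "2*n+1" y] unfolding odd_space_iff image_iff by (metis order_refl)
  qed (use gE in auto)
  have pres: "omega n (g x) (g y) = omega n x y" if "x \<in> odd_space n" "y \<in> odd_space n" for x y
  proof -
    have ex: "z = (\<Sum>i\<in>{1..2*n+1}. cscale (z i) (bvec i))" if "z \<in> odd_space n" for z
      using that by (intro cvec_expand) (auto simp: odd_space_iff)
    have "omega n (g x) (g y) =
        (\<Sum>i\<in>{1..2*n+1}. \<Sum>j\<in>{1..2*n+1}. x i * (y j * omega n (f i) (f j)))"
      unfolding g_def by (rule omega_sums)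
    also have "\<dots> = (\<Sum>i\<in>{1..2*n+1}. \<Sum>j\<in>{1..2*n+1}. x i * (y j * omega n (bvec i) (bvec j)))"
      using om by (intro sum.cong refl) auto
    also have "\<dots> = omega n (\<Sum>i\<in>{1..2*n+1}. cscale (x i) (bvec i)) (\<Sum>j\<in>{1..2*n+1}. cscale (y j) (bvec j))"
      by (rule omega_sums[symmetric])
    finally show ?thesis by (simp only: ex[OF that(1), symmetric] ex[OF that(2), symmetric])
  qed
  have "g \<in> borel n"
    using lin bij pres tri gb by (auto simp: borel_def Sp_odd_def)
  then show thesis using that gb by blast
qed

text \<open>An echelon basis \<open>v\<close> of \<open>V\<close> is completed to a family
  \<open>f\<close> with the same pairings as the standard basis: vectors at partners of pivots stay
  standard, the remaining ones are corrected to be orthogonal to \<open>v\<close>. The correction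
  only uses smaller indices, so \<open>f\<close> is unitriangular and comes from the Borel
  group.\<close>

lemma bruhat_decomposition:
  assumes "V \<in> IG n k"
  obtains I g where "adm n k I" "g \<in> borel n" "\<And>i. i \<in> {1..2*n+1} \<Longrightarrow> g (bvec i) i = 1"
    "V = g ` coord_space I"
proof -
  have V: "cvs.subspace V" "V \<subseteq> odd_space n" "cvs.dim V = k" "\<And>x y. x \<in> V \<Longrightarrow> y \<in> V \<Longrightarrow> omega n x y = 0"
    using assms by (auto simp: IG_def)
  have sup: "\<forall>x\<in>V. \<forall>i. i \<notin> {1..2*n+1} \<longrightarrow> x i = 0"
    using V(2) odd_space_iff by blast
  obtain I v where I: "I \<subseteq> {1..2*n+1}" and v: "\<And>i. i \<in> I \<Longrightarrow> v i \<in> V"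
    "\<And>i j. i \<in> I \<Longrightarrow> j \<in> I \<Longrightarrow> v i j = (if i = j then 1 else 0)"
    "\<And>i j. i \<in> I \<Longrightarrow> i < j \<Longrightarrow> v i j = 0"
    and VI: "V = cvs.span (v ` I)" "cvs.dim V = card I"
    by (rule echelon_basis[OF V(1) sup]) (rule that)
  have fin: "finite I" using I finite_subset by blast
  have nobar: "bar n i \<notin> I" if i: "i \<in> I" for i
  proof
    assume b: "bar n i \<in> I"
    have i1: "i \<in> {1..2*n+2}" using I i by auto
    have "0 = omega n (v i) (v (bar n i))" using V(4) v(1) i b by auto
    \<comment> \<open>Both vectors vanish beyond their pivots, so only the term at \<open>i\<close>
      survives in the pairing.\<close>
    also have "\<dots> = (\<Sum>l\<in>{1..2*n+2}. if l = i then sg n i else 0)"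
      unfolding omega_altdef
    proof (rule sum.cong)
      fix l assume l: "l \<in> {1..2*n+2}"
      show "sg n l * v i l * v (bar n i) (bar n l) = (if l = i then sg n i else 0)"
      proof (cases l i rule: linorder_cases)
        case less
        then have "bar n i < bar n l" using i1 by (auto simp: bar_def)
        then show ?thesis using v(3)[OF b] less by auto
      qed (use v i b in auto)
    qed simp
    also have "\<dots> = sg n i" using i1 by simp
    finally show False using sg_nz by metis
  qed
  have lb: "bar n l \<in> {1..2*n+2}" "bar n (bar n l) = l" "l \<le> 2*n+1" "1 \<le> l" if "l \<in> I" for l
  proof -
    have "l \<in> {1..2*n+1}" using that I by blast
    then show "bar n l \<in> {1..2*n+2}" "bar n (bar n l) = l" "l \<le> 2*n+1" "1 \<le> l" by (auto simp: bar_def)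
  qed
  have adm: "adm n k I" using I nobar V(3) VI by (auto simp: adm_def)
  \<comment> \<open>Pairing \<open>bvec (bar n l)\<close> with \<open>v l'\<close> gives
    \<open>- sg n l\<close> if \<open>l = l'\<close> and 0 otherwise; this coefficient cancels the
    pairing of \<open>bvec j\<close> with \<open>v l\<close>.\<close>
  define c where "c j l = sg n j * sg n l * v l (bar n j)" for j l
  define f where "f j = (if j \<in> I then v j else if bar n j \<in> I then bvec j
      else bvec j + (\<Sum>l\<in>I. cscale (c j l) (bvec (bar n l))))" for j
  have cz: "c j l = 0" if "j \<in> {1..2*n+1}" "l \<in> I" "bar n j \<notin> I" "j \<le> bar n l" for j l
  proof -
    have "l \<le> bar n j" using that lb[OF that(2)] by (auto simp: bar_def)
    moreover have "l \<noteq> bar n j" using that by auto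
    ultimately show ?thesis using v(3)[OF that(2), of "bar n j"] by (simp add: c_def)
  qed
  have zz: "(\<Sum>l\<in>I. c j l * bvec (bar n l) m) = 0" if "j \<in> {1..2*n+1}" "bar n j \<notin> I" "j \<le> m" for j m
    by (rule sum.neutral) (use that cz in \<open>auto simp: bvec_apply\<close>)
  have fE: "f j \<in> odd_space n" if "j \<in> {1..2*n+1}" for j
  proof -
    have "(\<Sum>l\<in>I. c j l * bvec (bar n l) m) = 0" if "bar n j \<notin> I" "m \<notin> {1..2*n+1}" for m
    proof (rule sum.neutral, intro ballI)
      fix l assume "l \<in> I"
      then have "l \<le> 2*n+1" using I by auto
      then have "1 \<le> bar n l" by (simp add: bar_def)
      then show "c j l * bvec (bar n l) m = 0"
        using cz[OF \<open>j \<in> _\<close> \<open>l \<in> I\<close>] that \<open>j \<in> _\<close> by (cases "m = bar n l") (auto simp: bvec_apply)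
    qed
    moreover have "v j \<in> odd_space n" if "j \<in> I" using v(1) V(2) that by blast
    ultimately show ?thesis using that by (auto simp: f_def odd_space_iff bvec_apply)
  qed
  have fd: "f j j = 1" if "j \<in> {1..2*n+1}" for j
    using zz[OF that] v(2) that by (auto simp: f_def bvec_apply)
  have ft: "f i j = 0" if "i \<in> {1..2*n+1}" "i < j" for i j
    using zz[OF that(1), of j] v(3) that by (auto simp: f_def bvec_apply)
  have ob: "omega n (bvec i) (v l) = sg n i * v l (bar n i)" if "i \<in> {1..2*n+2}" for i l
    using that by (intro omega_bvec_left) auto
  have oI: "omega n (bvec (bar n l)) (bvec (bar n l')) = 0" if "l \<in> I" "l' \<in> I" for l l'
  proof -
    have "bar n l \<in> {1..2*n+2}" "bar n (bar n l) = l" using that lb by auto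
    moreover have "bar n l' \<noteq> l" using nobar that by blast
    ultimately show ?thesis by (auto simp: omega_bvec)
  qed
  have oM: "omega n (bvec i) (bvec (bar n l)) = 0" if "i \<in> {1..2*n+1}" "i \<notin> I" "l \<in> I" for i l
  proof -
    have "bar n l \<noteq> bar n i" using that lb[OF that(3)] bar_eq_iff[of l n i] by auto
    then show ?thesis using that by (auto simp: omega_bvec)
  qed
  have JI: "omega n (bvec i) (v l) = omega n (bvec i) (bvec l)"
    if "i \<in> {1..2*n+1}" "bar n i \<in> I" "l \<in> I" for i l
    using that v(2) by (auto simp: ob omega_bvec)
  have MI: "omega n (f i) (v l) = 0"
    if i: "i \<in> {1..2*n+1}" "i \<notin> I" "bar n i \<notin> I" "l \<in> I" for i l
  proof -
    have "(\<Sum>m\<in>I. c i m * omega n (bvec (bar n m)) (v l)) = (\<Sum>m\<in>I. if m = l then - (sg n i * v l (bar n i)) else 0)"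
    proof (rule sum.cong)
      fix m assume m: "m \<in> I"
      then have "bar n m \<in> {1..2*n+2}" "bar n (bar n m) = m" "sg n (bar n m) = - sg n m"
        using lb[OF m] by (auto simp: sg_bar)
      then show "c i m * omega n (bvec (bar n m)) (v l) = (if m = l then - (sg n i * v l (bar n i)) else 0)"
        using v(2)[OF that(4) m] by (auto simp: ob c_def)
    qed simp
    then show ?thesis using i fin
      by (simp add: f_def omega_add_left omega_sum_left omega_scale_left ob)
  qed
  have om1: "omega n (f i) (f j) = omega n (bvec i) (bvec j)"
    if i: "i \<in> {1..2*n+1}" and j: "j \<in> {1..2*n+1}" and ij: "j \<in> I \<or> i \<notin> I"
    for i j
  proof (cases "j \<in> I")
    case jI: True
    have fj: "f j = v j" using jI by (simp add: f_def)
    consider "i \<in> I" | "i \<notin> I" "bar n i \<in> I" | "i \<notin> I" "bar n i \<notin> I" by blast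
    then show ?thesis
    proof cases
      case 1
      then have "j \<noteq> bar n i" using nobar jI by auto
      then show ?thesis using 1 jI V(4) v(1) i by (auto simp: f_def omega_bvec)
    next
      case 2
      then show ?thesis using JI[OF i 2(2) jI] by (simp add: f_def jI)
    next
      case 3
      then have "j \<noteq> bar n i" using jI by auto
      then show ?thesis using MI[OF i 3 jI] fj i by (simp add: omega_bvec)
    qed
  next
    case jI: False
    then have iI: "i \<notin> I" using ij by auto
    have s: "omega n (bvec (bar n l)) (bvec j) = 0" if "l \<in> I" for l
      using oM[OF j jI that] by (subst omega_swap) simp
    show ?thesis using iI jI oM[OF i iI] s oI
      by (simp add: f_def omega_add_left omega_sum_left omega_scale_left
            omega_add_right omega_sum_right omega_scale_right)
  qed
  have om: "omega n (f i) (f j) = omega n (bvec i) (bvec j)"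
    if i: "i \<in> {1..2*n+1}" and j: "j \<in> {1..2*n+1}" for i j
  proof (cases "j \<in> I \<or> i \<notin> I")
    case True
    then show ?thesis using om1[OF i j] by blast
  next
    case False
    then have "omega n (f j) (f i) = omega n (bvec j) (bvec i)" using om1[OF j i] by blast
    then show ?thesis by (subst (1 2) omega_swap) simp
  qed
  obtain g where g: "g \<in> borel n" "\<And>i. i \<in> {1..2*n+1} \<Longrightarrow> g (bvec i) = f i"
    using unitriangular_borel[of n f, OF fE fd ft om] by blast
  have lin: "Vector_Spaces.linear cscale cscale g" using g by (simp add: borel_def Sp_odd_def)
  have "g ` bvec ` I = v ` I" using g(2) I by (force simp: f_def image_image)
  then have "V = g ` coord_space I"
    using cvp.linear_span_image[OF lin, of "bvec ` I"] VI by simp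
  moreover have "g (bvec i) i = 1" if "i \<in> {1..2*n+1}" for i using g(2) fd that by simp
  ultimately show thesis using that adm g(1) by blast
qed

section \<open>Pluecker coordinates\<close>

lemma frame_of_dim:
  assumes "cvs.dim (cvs.span (u ` {..<k})) = k"
  shows "is_frame k (cvs.span (u ` {..<k})) (map u [0..<k])"
proof -
  let ?U = "u ` {..<k}"
  obtain B where B: "B \<subseteq> ?U" "cvs.independent B" "?U \<subseteq> cvs.span B"
    by (rule cvs.maximal_independent_subset)
  have "cvs.span B = cvs.span ?U"
    using B by (intro subset_antisym cvs.span_mono cvs.span_minimal) auto
  then have "card B = k" using cvs.dim_eq_card[of B ?U] B(2) assms by simp
  moreover have "card B \<le> card ?U" using B(1) by (intro card_mono) auto
  moreover have "card ?U \<le> k" using card_image_le[of "{..<k}" u] by simp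
  ultimately have c: "card ?U = k" and "card ?U \<le> card B" by auto
  then have "B = ?U" using B(1) by (intro card_seteq) auto
  moreover have "inj_on u {..<k}" using c by (intro eq_card_imp_inj_on) auto
  ultimately show ?thesis
    using B(2) by (simp add: is_frame_def distinct_map lessThan_atLeast0)
qed

lemma family_of_frame:
  assumes "is_frame k V vs"
  shows "V = cvs.span ((!) vs ` {..<k})" "map ((!) vs) [0..<k] = vs"
proof -
  have l: "length vs = k" "cvs.span (set vs) = V" using assms by (auto simp: is_frame_def)
  have "set vs = (!) vs ` {..<k}" using nth_image[of k vs] l(1) by (simp add: atLeast0LessThan)
  then show "V = cvs.span ((!) vs ` {..<k})" using l(2) by simp
  show "map ((!) vs) [0..<k] = vs" using l(1) map_nth by auto
qed

abbreviation minor :: "nat \<Rightarrow> (nat \<Rightarrow> cvec) \<Rightarrow> (nat \<Rightarrow> nat) \<Rightarrow> complex" where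
  "minor k u r \<equiv> det (mat k k (\<lambda>(a, b). u b (r a)))"

lemma pluecker_minor:
  assumes "J \<subseteq> {1..2*n+1}" "card J = k"
  shows "pluecker n k (map u [0..<k]) J = minor k u ((!) (sorted_list_of_set J))"
  unfolding pluecker_def using assms by (auto intro!: arg_cong[of _ _ det] eq_matI)

text \<open>Expressing \<open>ws\<close> through \<open>vs\<close> multiplies every matrix of
  selected rows on the right by the same \<open>k\<close> by \<open>k\<close> matrix, so all minors
  acquire the same factor.\<close>

lemma pluecker_span:
  assumes "set ws \<subseteq> cvs.span (set vs)" "length vs = k" "length ws = k"
  obtains c where "\<And>J. pluecker n k ws J = c * pluecker n k vs J"
proof -
  have "\<exists>t. ws ! b = (\<Sum>l\<in>{..<k}. cscale (t l) (vs ! l))" if "b < k" for b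
  proof -
    have "ws ! b \<in> cvs.span ((!) vs ` {..<k})"
      using assms that nth_mem[of b ws] nth_image[of k vs] by (auto simp: atLeast0LessThan)
    then show ?thesis by (auto simp: span_family)
  qed
  then obtain T where T: "\<And>b. b < k \<Longrightarrow> ws ! b = (\<Sum>l\<in>{..<k}. cscale (T b l) (vs ! l))" by metis
  define c where "c = det (mat k k (\<lambda>(l, b). T b l))"
  have "pluecker n k ws J = c * pluecker n k vs J" for J
  proof (cases "J \<subseteq> {1..2*n+1} \<and> card J = k")
    case True
    let ?s = "\<lambda>a. sorted_list_of_set J ! a"
    have "mat k k (\<lambda>(a, b). (ws ! b) (?s a)) = mat k k (\<lambda>(a, b). (vs ! b) (?s a)) * mat k k (\<lambda>(l, b). T b l)"
      by (rule eq_matI) (auto simp: T scalar_prod_def lessThan_atLeast0 mult.commute intro!: sum.cong)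
    then show ?thesis using True by (simp add: pluecker_def c_def det_mult[of _ k])
  qed (auto simp: pluecker_def)
  then show thesis using that by blast
qed

lemma pluecker_change_frame:
  assumes "is_frame k V vs" "is_frame k V ws"
  obtains c where "\<And>J. pluecker n k ws J = c * pluecker n k vs J"
  using pluecker_span[of ws vs k n] assms cvs.span_superset[of "set ws"] by (auto simp: is_frame_def)

lemma form_scale: "form m F \<Longrightarrow> F (\<lambda>J. c * p J) = c ^ m * F p"
  by (induction rule: form.induct) (auto simp: algebra_simps power_add)

lemma form_poly:
  assumes "form m F"
  shows "\<exists>q. \<forall>t. F (\<lambda>J. poly (P J) t) = poly q t"
  using assms
proof (induction rule: form.induct)
  case (const c)
  show ?case by (rule exI[of _ "[:c:]"]) simp
next
  case (coord I)
  show ?case by (rule exI[of _ "P I"]) simp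
next
  case (add m F G)
  then show ?case by (metis poly_add)
next
  case (mult l F m G)
  then show ?case by (metis poly_mult)
qed

lemma poly_det: "poly (det A) t = det (map_mat (\<lambda>p. poly p t) A)"
proof -
  interpret comm_ring_hom "\<lambda>p. poly p t" by unfold_locales auto
  show ?thesis by simp
qed

definition pluecker_poly ::
    "nat \<Rightarrow> nat \<Rightarrow> (nat \<Rightarrow> nat \<Rightarrow> complex poly) \<Rightarrow> nat set \<Rightarrow> complex poly" where
  "pluecker_poly n k c J = (if J \<subseteq> {1..2*n+1} \<and> card J = k
     then det (mat k k (\<lambda>(a, b). c b (sorted_list_of_set J ! a))) else 0)"

lemma poly_pluecker_poly:
  "poly (pluecker_poly n k c J) t = pluecker n k (map (\<lambda>b r. poly (c b r) t) [0..<k]) J"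
proof (cases "J \<subseteq> {1..2*n+1} \<and> card J = k")
  case True
  then show ?thesis
    by (auto simp: pluecker_poly_def pluecker_minor poly_det intro!: arg_cong[of _ _ det] eq_matI)
qed (auto simp: pluecker_poly_def pluecker_def)

lemma coeff_mult_top:
  fixes p q :: "complex poly"
  assumes "degree p \<le> a" "degree q \<le> b"
  shows "coeff (p * q) (a + b) = coeff p a * coeff q b"
proof -
  have "coeff (p * q) (a + b) = (\<Sum>i\<le>a + b. if i = a then coeff p a * coeff q b else 0)"
    unfolding coeff_mult
  proof (rule sum.cong)
    fix i
    show "coeff p i * coeff q (a + b - i) = (if i = a then coeff p a * coeff q b else 0)"
      using assms by (cases i a rule: linorder_cases) (auto simp: coeff_eq_0)
  qed simp
  then show ?thesis by simp
qed

lemma coeff_prod_top: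
  fixes f :: "'a \<Rightarrow> complex poly"
  assumes "finite A" "\<And>a. a \<in> A \<Longrightarrow> degree (f a) \<le> m a"
  shows "degree (prod f A) \<le> sum m A \<and> coeff (prod f A) (sum m A) = (\<Prod>a\<in>A. coeff (f a) (m a))"
  using assms
proof (induction A rule: finite_induct)
  case (insert x F)
  then have IH: "degree (prod f F) \<le> sum m F" "coeff (prod f F) (sum m F) = (\<Prod>a\<in>F. coeff (f a) (m a))"
    and x: "degree (f x) \<le> m x" by auto
  have "coeff (f x * prod f F) (m x + sum m F) = coeff (f x) (m x) * coeff (prod f F) (sum m F)"
    using x IH(1) by (rule coeff_mult_top)
  moreover have "degree (f x * prod f F) \<le> m x + sum m F"
    using degree_mult_le[of "f x" "prod f F"] x IH(1) by linarith
  ultimately show ?case using insert(1,2) IH(2) by simp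
qed simp

text \<open>Each Leibniz term takes one factor from every column, so the columnwise degree bounds
  add up. The coefficient at this bound is the value of the Pluecker tuple at \<open>None\<close>,
  where every column is replaced by its own top coefficients.\<close>

lemma pluecker_poly_top:
  assumes deg: "\<And>b r. b < k \<Longrightarrow> degree (c b r) \<le> m b"
  shows "degree (pluecker_poly n k c J) \<le> (\<Sum>b<k. m b)"
    "coeff (pluecker_poly n k c J) (\<Sum>b<k. m b) = pluecker n k (map (\<lambda>b r. coeff (c b r) (m b)) [0..<k]) J"
proof -
  have "degree (pluecker_poly n k c J) \<le> (\<Sum>b<k. m b) \<and>
    coeff (pluecker_poly n k c J) (\<Sum>b<k. m b) = pluecker n k (map (\<lambda>b r. coeff (c b r) (m b)) [0..<k]) J"
  proof (cases "J \<subseteq> {1..2*n+1} \<and> card J = k")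
    case True
    let ?s = "\<lambda>a. sorted_list_of_set J ! a"
    let ?M = "\<Sum>b<k. m b"
    let ?t = "\<lambda>p. \<Prod>i=0..<k. c (p i) (?s i)"
    have t: "degree (?t p) \<le> ?M \<and> coeff (?t p) ?M = (\<Prod>i=0..<k. coeff (c (p i) (?s i)) (m (p i)))"
      if p: "p permutes {0..<k}" for p
    proof -
      have "(\<Sum>i=0..<k. m (p i)) = ?M"
        using sum.permute[OF p, of m] by (simp add: o_def lessThan_atLeast0)
      moreover have "p i < k" if "i \<in> {0..<k}" for i using permutes_in_image[OF p, of i] that by auto
      ultimately show ?thesis
        using coeff_prod_top[of "{0..<k}" "\<lambda>i. c (p i) (?s i)" "\<lambda>i. m (p i)"] deg by auto
    qed
    have sg: "degree (signof p * x) \<le> degree x \<and> coeff (signof p * x) N = signof p * coeff x N"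
      for p :: "nat \<Rightarrow> nat" and x :: "complex poly" and N
      by (auto simp: sign_def)
    have P: "pluecker_poly n k c J = (\<Sum>p | p permutes {0..<k}. signof p * ?t p)"
    proof -
      have "pluecker_poly n k c J = (\<Sum>p | p permutes {0..<k}. signof p * (\<Prod>i=0..<k. mat k k (\<lambda>(a, b). c b (?s a)) $$ (i, p i)))"
        unfolding pluecker_poly_def if_P[OF True] by (subst det_def'[of _ k]) auto
      also have "\<dots> = (\<Sum>p | p permutes {0..<k}. signof p * ?t p)"
        by (intro sum.cong refl arg_cong2[of _ _ _ _ "(*)"] prod.cong) (auto dest: permutes_in_image)
      finally show ?thesis .
    qed
    have "degree (pluecker_poly n k c J) \<le> ?M"
      unfolding P by (rule degree_sum_le) (auto simp: finite_permutations intro: order_trans sg[THEN conjunct1] t[THEN conjunct1] dest: order_trans[OF sg[THEN conjunct1] t[THEN conjunct1]])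
    moreover have "coeff (pluecker_poly n k c J) ?M = pluecker n k (map (\<lambda>b r. coeff (c b r) (m b)) [0..<k]) J"
    proof -
      have "coeff (pluecker_poly n k c J) ?M =
          (\<Sum>p | p permutes {0..<k}. signof p * (\<Prod>i=0..<k. coeff (c (p i) (?s i)) (m (p i))))"
        unfolding P coeff_sum by (rule sum.cong) (auto simp: sg[THEN conjunct2] t[THEN conjunct2])
      also have "\<dots> = (\<Sum>p | p permutes {0..<k}. signof p * (\<Prod>i=0..<k. mat k k (\<lambda>(a, b). coeff (c b (?s a)) (m b)) $$ (i, p i)))"
        by (intro sum.cong refl arg_cong2[of _ _ _ _ "(*)"] prod.cong) (auto dest: permutes_in_image)
      also have "\<dots> = det (mat k k (\<lambda>(a, b). coeff (c b (?s a)) (m b)))"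
        by (subst det_def'[of _ k]) auto
      finally show ?thesis using True by (simp add: pluecker_minor)
    qed
    ultimately show ?thesis by blast
  qed (auto simp: pluecker_poly_def pluecker_def)
  then show "degree (pluecker_poly n k c J) \<le> (\<Sum>b<k. m b)"
    "coeff (pluecker_poly n k c J) (\<Sum>b<k. m b) = pluecker n k (map (\<lambda>b r. coeff (c b r) (m b)) [0..<k]) J"
    by auto
qed

text \<open>A limit along a line of frames: closed conditions pull back to polynomials in the parameter,
  which vanish identically once they vanish for all nonzero parameters.\<close>

lemma zariski_closed_limit:
  assumes A: "zariski_closed n k A"
    and t: "\<And>t. t \<noteq> 0 \<Longrightarrow> cvs.span ((\<lambda>b. p b + cscale t (q b)) ` {..<k}) \<in> A"
    and IG: "cvs.span (p ` {..<k}) \<in> IG n k"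
  shows "cvs.span (p ` {..<k}) \<in> A"
proof -
  obtain S where S: "\<And>F. F \<in> S \<Longrightarrow> \<exists>m. form m F"
      "A = {V \<in> IG n k. \<forall>F\<in>S. \<forall>x\<in>pluecker_coords n k V. F x = 0}"
    using A by (auto simp: zariski_closed_def)
  define P where "P = pluecker_poly n k (\<lambda>b r. [:p b r, q b r:])"
  have P: "poly (P J) t = pluecker n k (map (\<lambda>b. p b + cscale t (q b)) [0..<k]) J" for t J
    unfolding P_def poly_pluecker_poly
    by (rule arg_cong[of _ _ "\<lambda>vs. pluecker n k vs J"]) (auto simp: fun_eq_iff)
  have fr: "is_frame k (cvs.span ((\<lambda>b. p b + cscale t (q b)) ` {..<k})) (map (\<lambda>b. p b + cscale t (q b)) [0..<k])" if "t \<noteq> 0" for t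
    using t[OF that] S(2) by (intro frame_of_dim) (auto simp: IG_def)
  have "F x = 0" if F: "F \<in> S" and x: "x \<in> pluecker_coords n k (cvs.span (p ` {..<k}))" for F x
  proof -
    obtain m where m: "form m F" using S(1) F by blast
    obtain r where r: "\<And>t. F (\<lambda>J. poly (P J) t) = poly r t" using form_poly[OF m] by metis
    have r0: "poly r t = 0" if "t \<noteq> 0" for t
    proof -
      have "(\<lambda>J. poly (P J) t) \<in> pluecker_coords n k (cvs.span ((\<lambda>b. p b + cscale t (q b)) ` {..<k}))"
        using fr[OF that] P by (auto simp: pluecker_coords_def)
      then have "F (\<lambda>J. poly (P J) t) = 0" using t[OF that] S(2) F by blast
      then show ?thesis using r by simp
    qed
    have "r = 0"
    proof (rule ccontr)
      assume "r \<noteq> 0"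
      then have "finite {t. poly r t = 0}" by (rule poly_roots_finite)
      moreover have "- {0} \<subseteq> {t. poly r t = 0}" using r0 by auto
      ultimately have "finite (- {0 :: complex})" using finite_subset by blast
      then show False using infinite_UNIV_char_0[where 'a = complex] by (simp add: finite_compl)
    qed
    then have z: "F (\<lambda>J. poly (P J) 0) = 0" using r by simp
    have "is_frame k (cvs.span (p ` {..<k})) (map p [0..<k])"
      using IG by (intro frame_of_dim) (auto simp: IG_def)
    moreover obtain vs where "is_frame k (cvs.span (p ` {..<k})) vs" "x = pluecker n k vs"
      using x by (auto simp: pluecker_coords_def)
    ultimately obtain c where "\<And>J. x J = c * pluecker n k (map p [0..<k]) J"
      using pluecker_change_frame by metis
    then have "x = (\<lambda>J. c * poly (P J) 0)" by (simp add: P fun_eq_iff)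
    then show "F x = 0" using z form_scale[OF m, of c "\<lambda>J. poly (P J) 0"] by simp
  qed
  then show ?thesis using IG S(2) by blast
qed

section \<open>Rank conditions\<close>

text \<open>For a Borel image of \<open>coord_space I\<close> this amounts to at least
  \<open>c\<close> indices of \<open>I\<close> being at most \<open>m\<close>, or to the subspace
  meeting the span of the first \<open>m\<close> basis vectors in dimension at least
  \<open>c\<close>. The formulation by Pluecker coordinates makes closedness immediate.\<close>

definition rank_locus :: "nat \<Rightarrow> nat \<Rightarrow> nat \<Rightarrow> nat \<Rightarrow> cvec set set" where
  "rank_locus n k m c = {V \<in> IG n k. \<forall>J. card (J \<inter> {1..m}) < c \<longrightarrow>
     (\<forall>x\<in>pluecker_coords n k V. x J = 0)}"

lemma zariski_closed_rank_locus: "zariski_closed n k (rank_locus n k m c)"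
  unfolding zariski_closed_def rank_locus_def
  by (rule exI[of _ "{(\<lambda>x. x J) | J. card (J \<inter> {1..m}) < c}"]) (auto intro: form.coord)

lemma borelD:
  assumes "g \<in> borel n"
  shows "Vector_Spaces.linear cscale cscale g" "inj_on g (odd_space n)"
    "x \<in> odd_space n \<Longrightarrow> g x \<in> odd_space n"
    "x \<in> odd_space n \<Longrightarrow> y \<in> odd_space n \<Longrightarrow> omega n (g x) (g y) = omega n x y"
    "i \<in> {1..2*n+1} \<Longrightarrow> i < j \<Longrightarrow> g (bvec i) j = 0"
proof -
  show E: "x \<in> odd_space n \<Longrightarrow> g x \<in> odd_space n" for x
    using assms by (auto simp: borel_def Sp_odd_def bij_betw_def)
  show "g (bvec i) j = 0" if "i \<in> {1..2*n+1}" "i < j"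
  proof (cases "j \<le> 2*n+1")
    case True
    then show ?thesis using assms that by (auto simp: borel_def)
  next
    case False
    have "bvec i \<in> odd_space n" using that by (auto simp: odd_space_iff bvec_apply)
    then show ?thesis using E False by (auto simp: odd_space_iff)
  qed
qed (use assms in \<open>auto simp: borel_def Sp_odd_def bij_betw_def\<close>)

lemma id_borel: "id \<in> borel n"
  using cvs.linear_id by (auto simp: borel_def Sp_odd_def bvec_apply)

lemma coord_space_odd: "I \<subseteq> {1..2*n+1} \<Longrightarrow> coord_space I \<subseteq> odd_space n"
  unfolding odd_space_def by (intro cvs.span_mono image_mono)

lemma borel_image_coord:
  assumes g: "g \<in> borel n" and I: "I \<subseteq> {1..2*n+1}"
  shows "g ` coord_space I = cvs.span ((\<lambda>i. g (bvec i)) ` I)"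
    "cvs.dim (g ` coord_space I) = card I" "cvs.independent ((\<lambda>i. g (bvec i)) ` I)"
    "inj_on (\<lambda>i. g (bvec i)) I"
proof -
  have fin: "finite I" using I finite_subset by blast
  show 1: "g ` coord_space I = cvs.span ((\<lambda>i. g (bvec i)) ` I)"
    using cvp.linear_span_image[OF borelD(1)[OF g], of "bvec ` I"] by (simp add: image_image)
  have inj: "inj_on g (coord_space I)"
    using borelD(2)[OF g] coord_space_odd[OF I] inj_on_subset by blast
  have "cvs.independent (g ` bvec ` I)"
    using cvp.linear_independent_injective_image[OF borelD(1)[OF g] dim_span_bvec(2)[OF fin] inj] .
  then show 2: "cvs.independent ((\<lambda>i. g (bvec i)) ` I)" by (simp add: image_image)
  show 3: "inj_on (\<lambda>i. g (bvec i)) I"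
    using comp_inj_on[OF inj_on_subset[OF inj_bvec subset_UNIV] inj_on_subset[OF inj cvs.span_superset]]
    by (simp add: comp_def)
  show "cvs.dim (g ` coord_space I) = card I"
    unfolding 1 using cvs.dim_span_eq_card_independent[OF 2] card_image[OF 3] by simp
qed

lemma borel_image_IG:
  assumes g: "g \<in> borel n" and I: "adm n k I"
  shows "g ` coord_space I \<in> IG n k"
proof -
  have I': "I \<subseteq> {1..2*n+1}" "card I = k" "\<And>i. i \<in> I \<Longrightarrow> bar n i \<notin> I" using I by (auto simp: adm_def)
  have "omega n x y = 0" if "x \<in> bvec ` I" "y \<in> bvec ` I" for x y
  proof -
    obtain i j where ij: "i \<in> I" "j \<in> I" "x = bvec i" "y = bvec j" using \<open>x \<in> _\<close> \<open>y \<in> _\<close> by auto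
    then have "j \<noteq> bar n i" using I'(3) by auto
    then show ?thesis using ij I'(1) by (auto simp: omega_bvec)
  qed
  then have "omega n x y = 0" if "x \<in> coord_space I" "y \<in> coord_space I" for x y
    using omega_isotropic_span[of "bvec ` I" n x y] that by blast
  moreover have "cvs.subspace (g ` coord_space I)" using borel_image_coord(1)[OF g I'(1)] by simp
  ultimately show ?thesis
    using borelD(3,4)[OF g] coord_space_odd[OF I'(1)] borel_image_coord(2)[OF g I'(1)] I'(2)
    by (auto simp: IG_def subset_iff)
qed

lemma sorted_nth_bij:
  assumes "finite I" "card I = k"
  shows "bij_betw ((!) (sorted_list_of_set I)) {..<k} I"
  using bij_betw_nth[of "sorted_list_of_set I" "{..<k}" I] assms by auto

lemma map_sorted_frame:
  assumes g: "g \<in> borel n" and I: "I \<subseteq> {1..2*n+1}" "card I = k"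
  shows "is_frame k (g ` coord_space I) (map (\<lambda>b. g (bvec (sorted_list_of_set I ! b))) [0..<k])"
proof -
  have fin: "finite I" using I finite_subset by blast
  have im: "(!) (sorted_list_of_set I) ` {..<k} = I"
    using sorted_nth_bij[OF fin I(2)] by (simp add: bij_betw_def)
  then have "(\<lambda>b. g (bvec (sorted_list_of_set I ! b))) ` {..<k} = (\<lambda>i. g (bvec i)) ` I"
    by (metis image_image)
  then have e: "g ` coord_space I = cvs.span ((\<lambda>b. g (bvec (sorted_list_of_set I ! b))) ` {..<k})"
    using borel_image_coord(1)[OF g I(1)] by simp
  then show ?thesis using frame_of_dim borel_image_coord(2)[OF g I(1)] I(2) by metis
qed

lemma card_sorted_nth:
  fixes I :: "nat set"
  assumes "finite I" "card I = k" "0 \<notin> I"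
  shows "card {b. b < k \<and> sorted_list_of_set I ! b \<le> m} = card (I \<inter> {1..m})"
proof (rule bij_betw_same_card)
  have "(!) (sorted_list_of_set I) ` {b. b < k \<and> sorted_list_of_set I ! b \<le> m} =
      {i \<in> (!) (sorted_list_of_set I) ` {..<k}. i \<le> m}" by auto
  also have "\<dots> = {i \<in> I. i \<le> m}" using sorted_nth_bij[OF assms(1,2)] by (simp add: bij_betw_def)
  also have "\<dots> = I \<inter> {1..m}"
  proof -
    have "1 \<le> i" if "i \<in> I" for i using assms(3) that by (cases i) auto
    then show ?thesis by auto
  qed
  finally have "(!) (sorted_list_of_set I) ` {b. b < k \<and> sorted_list_of_set I ! b \<le> m} = I \<inter> {1..m}" .
  then show "bij_betw ((!) (sorted_list_of_set I)) {b. b < k \<and> sorted_list_of_set I ! b \<le> m} (I \<inter> {1..m})"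
    using sorted_nth_bij[OF assms(1,2)] by (auto simp: bij_betw_def intro: inj_on_subset)
qed

text \<open>A nonzero Leibniz term for the rows \<open>J\<close> matches every index of
  \<open>J\<close> with a column whose pivot is at least as large, because columns vanish beyond
  their pivots. Pivots up to \<open>m\<close> thus force as many indices of \<open>J\<close> up to
  \<open>m\<close>.\<close>

lemma borel_image_rank_locus:
  assumes g: "g \<in> borel n" and I: "adm n k I" and c: "c \<le> card (I \<inter> {1..m})"
  shows "g ` coord_space I \<in> rank_locus n k m c"
proof -
  have I': "I \<subseteq> {1..2*n+1}" "card I = k" "finite I" "0 \<notin> I"
    using I finite_subset by (auto simp: adm_def)
  let ?vs = "map (\<lambda>b. g (bvec (sorted_list_of_set I ! b))) [0..<k]"
  let ?i = "\<lambda>b. sorted_list_of_set I ! b"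
  have z: "pluecker n k ?vs J = 0" if J: "card (J \<inter> {1..m}) < c" for J
  proof (cases "J \<subseteq> {1..2*n+1} \<and> card J = k")
    case True
    let ?j = "\<lambda>a. sorted_list_of_set J ! a"
    have J': "finite J" "card J = k" "0 \<notin> J" using True finite_subset by auto
    let ?M = "mat k k (\<lambda>(a, b). g (bvec (?i b)) (?j a))"
    have "(\<Prod>a=0..<k. ?M $$ (a, p a)) = 0" if p: "p permutes {0..<k}" for p
    proof -
      have "\<exists>a<k. ?i (p a) < ?j a"
      proof (rule ccontr)
        assume "\<not> (\<exists>a<k. ?i (p a) < ?j a)"
        then have le: "?j a \<le> ?i (p a)" if "a < k" for a using that by (meson not_le)
        have "{b. b < k \<and> ?i b \<le> m} \<subseteq> p ` {a. a < k \<and> ?j a \<le> m}"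
        proof
          fix b assume b: "b \<in> {b. b < k \<and> ?i b \<le> m}"
          then obtain a where a: "a < k" "b = p a"
            using permutes_image[OF p] by (auto simp: image_iff set_eq_iff) (metis lessThan_iff atLeastLessThan_iff zero_le)
          then show "b \<in> p ` {a. a < k \<and> ?j a \<le> m}" using le b by fastforce
        qed
        then have "card {b. b < k \<and> ?i b \<le> m} \<le> card (p ` {a. a < k \<and> ?j a \<le> m})"
          by (intro card_mono) auto
        also have "\<dots> \<le> card {a. a < k \<and> ?j a \<le> m}" by (rule card_image_le) simp
        finally have "card (I \<inter> {1..m}) \<le> card (J \<inter> {1..m})"
          using card_sorted_nth[OF I'(3,2,4)] card_sorted_nth[OF J'] by simp
        then show False using c J by simp
      qed
      then obtain a where a: "a < k" "?i (p a) < ?j a" by blast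
      have pa: "p a < k" using permutes_in_image[OF p, of a] a by simp
      then have "?i (p a) \<in> I" using sorted_nth_bij[OF I'(3,2)] by (auto simp: bij_betw_def)
      then have "?i (p a) \<in> {1..2*n+1}" using I'(1) by blast
      then have "?M $$ (a, p a) = 0" using a pa borelD(5)[OF g] by auto
      then show ?thesis using a by (intro prod_zero) auto
    qed
    then have "det ?M = 0" by (subst det_def'[of _ k]) (auto intro!: sum.neutral)
    then show ?thesis using True by (simp add: pluecker_minor)
  qed (auto simp: pluecker_def)
  have "x J = 0" if J: "card (J \<inter> {1..m}) < c" and x: "x \<in> pluecker_coords n k (g ` coord_space I)" for x J
  proof -
    obtain ws where ws: "is_frame k (g ` coord_space I) ws" "x = pluecker n k ws"
      using x by (auto simp: pluecker_coords_def)
    obtain c where "\<And>J. pluecker n k ws J = c * pluecker n k ?vs J"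
      using pluecker_change_frame[OF map_sorted_frame[OF g I'(1,2)] ws(1)] by blast
    then show ?thesis using z[OF J] ws by simp
  qed
  then show ?thesis using borel_image_IG[OF g I] by (auto simp: rank_locus_def)
qed

text \<open>With rows taken at the pivots the matrix is upper triangular with unit diagonal.\<close>

lemma pluecker_pivots:
  assumes g: "g \<in> borel n" and I: "I \<subseteq> {1..2*n+1}" "card I = k"
    and one: "\<And>i. i \<in> {1..2*n+1} \<Longrightarrow> g (bvec i) i = 1"
  shows "pluecker n k (map (\<lambda>b. g (bvec (sorted_list_of_set I ! b))) [0..<k]) I = 1"
proof -
  let ?i = "\<lambda>b. sorted_list_of_set I ! b"
  let ?M = "mat k k (\<lambda>(a, b). g (bvec (?i b)) (?i a))"
  have fin: "finite I" using I finite_subset by blast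
  have iI: "?i b \<in> I" if "b < k" for b
    using sorted_nth_bij[OF fin I(2)] that by (auto simp: bij_betw_def)
  have "upper_triangular ?M"
  proof (rule upper_triangularI)
    fix a b assume "b < a" "a < dim_row ?M"
    then have ab: "b < a" "a < k" by auto
    then have "?i b < ?i a"
      using strict_sorted_list_of_set[of I] I(2) by (simp add: sorted_wrt_iff_nth_less)
    moreover have "?i b \<in> {1..2*n+1}" using iI[of b] ab I(1) by (meson less_trans subsetD)
    ultimately show "?M $$ (a, b) = 0" using ab borelD(5)[OF g, of "?i b" "?i a"] by simp
  qed
  then have "det ?M = prod_list (diag_mat ?M)" by (rule det_upper_triangular[of _ k]) simp
  also have "diag_mat ?M = map (\<lambda>_. 1) [0..<k]"
    using one iI I(1) by (auto simp: diag_mat_def subset_iff intro!: map_cong)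
  finally have "det ?M = 1" by (simp add: map_replicate_const)
  then show ?thesis using I by (simp add: pluecker_minor)
qed

text \<open>The coordinate indexed by the pivot set itself is nonzero for a suitable frame, so it
  cannot be among those required to vanish.\<close>

lemma rank_locus_card:
  assumes g: "g \<in> borel n" and I: "adm n k I"
    and one: "\<And>i. i \<in> {1..2*n+1} \<Longrightarrow> g (bvec i) i = 1"
    and V: "g ` coord_space I \<in> rank_locus n k m c"
  shows "c \<le> card (I \<inter> {1..m})"
proof (rule ccontr)
  assume "\<not> c \<le> card (I \<inter> {1..m})"
  moreover have I': "I \<subseteq> {1..2*n+1}" "card I = k" using I by (auto simp: adm_def)
  ultimately have "pluecker n k (map (\<lambda>b. g (bvec (sorted_list_of_set I ! b))) [0..<k]) I = 0"
    using V map_sorted_frame[OF g I'] unfolding rank_locus_def pluecker_coords_def by force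
  then show False using pluecker_pivots[OF g I' one] by simp
qed

section \<open>Degenerations between cells\<close>

text \<open>The set of pivots of an echelon basis.\<close>

definition lead :: "cvec set \<Rightarrow> nat set" where
  "lead W = {i. \<exists>x\<in>W. x i \<noteq> 0 \<and> (\<forall>j>i. x j = 0)}"

text \<open>In a linear combination the largest index with a nonzero coefficient is also the last
  nonzero position, since the vectors of smaller index end earlier.\<close>

lemma triangular_family:
  assumes fin: "finite J" and diag: "\<And>j. j \<in> J \<Longrightarrow> u j j \<noteq> 0"
    and tri: "\<And>j l. j \<in> J \<Longrightarrow> j < l \<Longrightarrow> u j l = 0"
  shows "lead (cvs.span (u ` J)) = J" "cvs.dim (cvs.span (u ` J)) = card J"
proof -
  have top: "\<exists>j\<in>J. c j \<noteq> 0 \<and> (\<Sum>i\<in>J. cscale (c i) (u i)) j = c j * u j j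
      \<and> (\<forall>l>j. (\<Sum>i\<in>J. cscale (c i) (u i)) l = 0)" if c: "\<exists>j\<in>J. c j \<noteq> 0" for c
  proof -
    define S where "S = {j \<in> J. c j \<noteq> 0}"
    have S: "finite S" "S \<noteq> {}" using fin c by (auto simp: S_def)
    define m where "m = Max S"
    have m: "m \<in> J" "c m \<noteq> 0" using Max_in[OF S] by (auto simp: m_def S_def)
    have big: "c j = 0" if "j \<in> J" "m < j" for j
      using Max_ge[OF S(1), of j] that by (force simp: m_def S_def)
    have z: "c i * u i l = 0" if "i \<in> J" "l \<ge> m" "i \<noteq> m \<or> l \<noteq> m" for i l
      using that big[of i] tri[of i l] by (cases "m < i") auto
    have "(\<Sum>i\<in>J. c i * u i m) = (\<Sum>i\<in>J. if i = m then c m * u m m else 0)"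
      by (rule sum.cong) (use z in auto)
    then have "(\<Sum>i\<in>J. c i * u i m) = c m * u m m" using fin m by simp
    moreover have "(\<Sum>i\<in>J. c i * u i l) = 0" if "m < l" for l
      by (rule sum.neutral) (use z that in auto)
    ultimately show ?thesis using m by auto
  qed
  show "lead (cvs.span (u ` J)) = J"
  proof
    show "J \<subseteq> lead (cvs.span (u ` J))"
      using diag tri by (auto simp: lead_def intro!: bexI[of _ "u _"] cvs.span_base)
    show "lead (cvs.span (u ` J)) \<subseteq> J"
    proof
      fix i assume "i \<in> lead (cvs.span (u ` J))"
      then obtain c where c: "(\<Sum>j\<in>J. cscale (c j) (u j)) i \<noteq> 0"
          "\<forall>l>i. (\<Sum>j\<in>J. cscale (c j) (u j)) l = 0"
        by (auto simp: lead_def span_family[OF fin])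
      then have "\<exists>j\<in>J. c j \<noteq> 0" by (auto intro: ccontr)
      then obtain j where j: "j \<in> J" "c j \<noteq> 0" "(\<Sum>i\<in>J. cscale (c i) (u i)) j = c j * u j j"
        "\<forall>l>j. (\<Sum>i\<in>J. cscale (c i) (u i)) l = 0" using top by blast
      then have "(\<Sum>i\<in>J. cscale (c i) (u i)) j \<noteq> 0" using diag by simp
      then have "i = j" using c j(4) by (cases i j rule: linorder_cases) blast+
      then show "i \<in> J" using j by simp
    qed
  qed
  have inj: "inj_on u J"
  proof (rule inj_onI)
    fix i j assume "i \<in> J" "j \<in> J" "u i = u j"
    then show "i = j" using diag tri by (metis linorder_neqE_nat)
  qed
  have "cvs.independent (u ` J)"
  proof (rule cvs.independent_if_scalars_zero)
    show "finite (u ` J)" using fin by simp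
    fix f x assume s: "(\<Sum>x\<in>u ` J. cscale (f x) x) = 0" and x: "x \<in> u ` J"
    show "f x = 0"
    proof (rule ccontr)
      assume "f x \<noteq> 0"
      then have "\<exists>j\<in>J. f (u j) \<noteq> 0" using x by auto
      then obtain j where "j \<in> J" "f (u j) \<noteq> 0" "(\<Sum>i\<in>J. cscale (f (u i)) (u i)) j = f (u j) * u j j"
        using top[of "\<lambda>j. f (u j)"] by blast
      moreover have "(\<Sum>i\<in>J. cscale (f (u i)) (u i)) = 0" using s by (simp add: sum.reindex[OF inj] comp_def)
      ultimately show False using diag by (metis mult_eq_0_iff zero_fun_apply)
    qed
  qed
  then show "cvs.dim (cvs.span (u ` J)) = card J"
    using cvs.dim_span_eq_card_independent card_image[OF inj] by metis
qed

lemma borel_comp: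
  assumes g: "g \<in> borel n" and h: "h \<in> borel n"
  shows "g \<circ> h \<in> borel n"
proof -
  have lin: "Vector_Spaces.linear cscale cscale (g \<circ> h)"
    using borelD(1)[OF g] borelD(1)[OF h] by (simp add: Vector_Spaces.linear_iff)
  have "bij_betw (g \<circ> h) (odd_space n) (odd_space n)"
    using g h by (auto simp: borel_def Sp_odd_def intro: bij_betw_trans)
  moreover have "(g \<circ> h) (bvec j) i = 0" if j: "j \<in> {1..2*n+1}" "j < i" for i j
  proof -
    let ?D = "{1..2*n+1}"
    have "h (bvec j) \<in> odd_space n" using j by (intro borelD(3)[OF h]) (auto simp: odd_space_iff bvec_apply)
    then have "h (bvec j) = (\<Sum>l\<in>?D. cscale (h (bvec j) l) (bvec l))"
      by (intro cvec_expand) (auto simp: odd_space_iff)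
    then have "g (h (bvec j)) = (\<Sum>l\<in>?D. cscale (h (bvec j) l) (g (bvec l)))"
      by (metis (no_types, lifting) cvp.linear_sum[OF borelD(1)[OF g]] cvp.linear_scale[OF borelD(1)[OF g]] sum.cong)
    moreover have "(\<Sum>l\<in>?D. cscale (h (bvec j) l) (g (bvec l))) i = 0"
      unfolding sum_cvec_apply
    proof (rule sum.neutral, intro ballI)
      fix l assume l: "l \<in> ?D"
      show "cscale (h (bvec j) l) (g (bvec l)) i = 0"
        using borelD(5)[OF h j(1), of l] borelD(5)[OF g l, of i] j(2) by (cases "j < l") auto
    qed
    ultimately show ?thesis by simp
  qed
  ultimately show ?thesis
    using lin borelD(3,4)[OF g] borelD(3,4)[OF h] by (auto simp: borel_def Sp_odd_def)
qed

text \<open>The climb transports this property from a cell to a smaller one inside an arbitrary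
  closed \<open>A\<close>, which replaces any comparison of orbit closures.\<close>

definition cell_in :: "nat \<Rightarrow> cvec set set \<Rightarrow> nat set \<Rightarrow> bool" where
  "cell_in n A I \<longleftrightarrow> (\<forall>g\<in>borel n. g ` coord_space I \<in> A)"

text \<open>For \<open>t \<noteq> 0\<close> the deformed vectors span an isotropic subspace with
  pivot set \<open>J\<close>. The pivot set determines the Borel orbit, so this subspace and its
  translate by \<open>g\<close> lie in the orbit of \<open>coord_space J\<close>, hence in
  \<open>A\<close>. The limit at \<open>t = 0\<close> is the translate of
  \<open>coord_space I\<close>.\<close>

lemma cell_degeneration:
  assumes A: "zariski_closed n k A" and J: "cell_in n A J" and I: "adm n k I"
    and f: "bij_betw f I J" and v: "\<And>i. i \<in> I \<Longrightarrow> v i \<in> odd_space n"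
    and lead: "\<And>i t. i \<in> I \<Longrightarrow> t \<noteq> 0 \<Longrightarrow> (bvec i + cscale t (v i)) (f i) \<noteq> 0"
    and tri: "\<And>i t l. i \<in> I \<Longrightarrow> f i < l \<Longrightarrow> (bvec i + cscale t (v i)) l = 0"
    and iso: "\<And>i j t. i \<in> I \<Longrightarrow> j \<in> I \<Longrightarrow>
      omega n (bvec i + cscale t (v i)) (bvec j + cscale t (v j)) = 0"
  shows "cell_in n A I"
  unfolding cell_in_def
proof
  fix g assume g: "g \<in> borel n"
  note lin = borelD(1)[OF g]
  have I': "I \<subseteq> {1..2*n+1}" "card I = k" "finite I"
    using I finite_subset by (auto simp: adm_def)
  have finJ: "finite J" "card J = k" using f I'(2,3) bij_betw_finite bij_betw_same_card by metis+
  let ?s = "\<lambda>b. sorted_list_of_set I ! b"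
  have s: "?s ` {..<k} = I" using sorted_nth_bij[OF I'(3,2)] by (simp add: bij_betw_def)
  let ?w = "\<lambda>t i. bvec i + cscale t (v i)"
  have gw: "g ` cvs.span (?w t ` I) \<in> A" if t: "t \<noteq> 0" for t
  proof -
    define f' where "f' = inv_into I f"
    have f': "f' j \<in> I" "f (f' j) = j" if "j \<in> J" for j
      using f that by (auto simp: f'_def bij_betw_def inv_into_into f_inv_into_f)
    have im: "f' ` J = I" using bij_betw_inv_into[OF f] by (simp add: f'_def bij_betw_def)
    define u where "u j = ?w t (f' j)" for j
    have uJ: "u ` J = ?w t ` I" using im by (auto simp: u_def image_image[symmetric])
    have u: "lead (cvs.span (u ` J)) = J" "cvs.dim (cvs.span (u ` J)) = card J"
      using triangular_family[of J u] finJ lead[OF _ t] tri f' by (metis u_def)+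
    have "?w t ` I \<subseteq> odd_space n"
      using v I'(1) by (auto simp: odd_space_iff bvec_apply)
    then have "cvs.span (?w t ` I) \<subseteq> odd_space n"
      using cvs.span_minimal subspace_odd_space by blast
    moreover have "omega n x y = 0" if "x \<in> cvs.span (?w t ` I)" "y \<in> cvs.span (?w t ` I)" for x y
      by (rule omega_isotropic_span[OF _ that]) (use iso in auto)
    ultimately have W: "cvs.span (?w t ` I) \<in> IG n k" using u(2) uJ finJ by (auto simp: IG_def)
    obtain I2 h where I2: "adm n k I2" and h: "h \<in> borel n" "\<And>i. i \<in> {1..2*n+1} \<Longrightarrow> h (bvec i) i = 1"
      "cvs.span (?w t ` I) = h ` coord_space I2"
      by (rule bruhat_decomposition[OF W]) (rule that)
    have I2': "I2 \<subseteq> {1..2*n+1}" "finite I2" using I2 finite_subset by (auto simp: adm_def)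
    have "lead (h ` coord_space I2) = I2"
      unfolding borel_image_coord(1)[OF h(1) I2'(1)]
    proof (rule triangular_family(1)[OF I2'(2)])
      show "h (bvec j) j \<noteq> 0" if "j \<in> I2" for j using h(2)[of j] I2'(1) that by auto
      show "h (bvec j) l = 0" if "j \<in> I2" "j < l" for j l using borelD(5)[OF h(1)] I2'(1) that by blast
    qed
    then have "I2 = J" using u(1) uJ h(3) by simp
    then have "g ` cvs.span (?w t ` I) = (g \<circ> h) ` coord_space J" by (simp add: h(3) image_comp)
    then show ?thesis using J borel_comp[OF g h(1)] unfolding cell_in_def by metis
  qed
  have e: "cvs.span ((\<lambda>b. g (bvec (?s b)) + cscale t (g (v (?s b)))) ` {..<k}) = g ` cvs.span (?w t ` I)" for t
  proof -
    have "(\<lambda>b. g (bvec (?s b)) + cscale t (g (v (?s b)))) ` {..<k} = (\<lambda>i. g (?w t i)) ` ?s ` {..<k}"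
      by (simp add: image_image cvp.linear_add[OF lin] cvp.linear_scale[OF lin])
    also have "\<dots> = g ` ?w t ` I" unfolding s by (simp add: image_image)
    finally show ?thesis using cvp.linear_span_image[OF lin] by simp
  qed
  have e0: "cvs.span ((\<lambda>b. g (bvec (?s b))) ` {..<k}) = g ` coord_space I"
    using e[of 0] by simp
  have "cvs.span ((\<lambda>b. g (bvec (?s b))) ` {..<k}) \<in> A"
    using A
  proof (rule zariski_closed_limit)
    show "cvs.span ((\<lambda>b. g (bvec (?s b)) + cscale t (g (v (?s b)))) ` {..<k}) \<in> A" if "t \<noteq> 0" for t
      unfolding e using gw[OF that] .
    show "cvs.span ((\<lambda>b. g (bvec (?s b))) ` {..<k}) \<in> IG n k"
      unfolding e0 using borel_image_IG[OF g I] .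
  qed
  then show "g ` coord_space I \<in> A" using e0 by simp
qed

text \<open>The vector \<open>bvec i\<close> moves towards \<open>bvec j\<close>. Only a partner of
  \<open>j\<close> different from \<open>i\<close> can obstruct isotropy; \<open>j = bar n i\<close>
  is allowed because the form is alternating.\<close>

lemma cell_move_single:
  assumes A: "zariski_closed n k A" and I: "adm n k I" and i: "i \<in> I" "i < j" "j \<le> 2*n+1" "j \<notin> I"
    and bar: "bar n j \<notin> I - {i}" and J: "cell_in n A (insert j (I - {i}))"
  shows "cell_in n A I"
proof (rule cell_degeneration[OF A J I, where f = "\<lambda>l. if l = i then j else l"
      and v = "\<lambda>l. if l = i then bvec j else 0"])
  have I': "I \<subseteq> {1..2*n+1}" "\<And>i. i \<in> I \<Longrightarrow> bar n i \<notin> I" using I by (auto simp: adm_def)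
  show "bij_betw (\<lambda>l. if l = i then j else l) I (insert j (I - {i}))"
    using i by (auto simp: bij_betw_def inj_on_def)
  have z: "omega n (bvec a) (bvec b) = 0" if "a \<in> insert j I" "b \<in> I" "a = j \<longrightarrow> b \<noteq> i" for a b
  proof -
    have "1 \<le> a" "a \<le> 2*n+2" using that I' i by auto
    moreover have "b \<noteq> bar n a" using that I'(2)[of a] bar by auto
    ultimately show ?thesis by (simp add: omega_bvec)
  qed
  have z': "omega n (bvec b) (bvec j) = 0" if "b \<in> I" "b \<noteq> i" for b
    using z[of j b] that by (subst omega_swap) auto
  have ij: "omega n (bvec i) (bvec j) = - omega n (bvec j) (bvec i)" by (rule omega_swap)
  show "omega n (bvec a + cscale t (if a = i then bvec j else 0))
      (bvec b + cscale t (if b = i then bvec j else 0)) = 0" if "a \<in> I" "b \<in> I" for a b t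
    using that z z' i by (auto simp: omega_add_left omega_add_right omega_scale_left omega_scale_right ij)
qed (use i in \<open>auto simp: odd_space_iff bvec_apply\<close>)

lemma omega_minus: "omega n (- x) y = - omega n x y" "omega n x (- y) = - omega n x y"
  using omega_scale_left[of n "- 1" x y] omega_scale_right[of n x "- 1" y] by simp_all

text \<open>Moving \<open>i\<close> to \<open>j\<close> alone would destroy isotropy against
  \<open>bar n j\<close>, so \<open>bar n j\<close> moves to \<open>bar n i\<close> at the same
  time, with sign \<open>-1\<close>. The pairings of \<open>bvec j\<close> with
  \<open>bvec (bar n j)\<close> and of \<open>bvec i\<close> with \<open>bvec (bar n i)\<close> are
  both 1 and enter with opposite signs.\<close>

lemma cell_move_pair:
  assumes A: "zariski_closed n k A" and I: "adm n k I"
    and i: "i \<in> I" "bar n j \<in> I" "i < j" "2 \<le> i" "j \<le> n" "j \<notin> I"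
    and J: "cell_in n A (I - {i, bar n j} \<union> {j, bar n i})"
  shows "cell_in n A I"
proof -
  have I': "I \<subseteq> {1..2*n+1}" "\<And>i. i \<in> I \<Longrightarrow> bar n i \<notin> I" using I by (auto simp: adm_def)
  have b: "bar n j < bar n i" "n + 2 < bar n j" "bar n i \<le> 2*n+1" "bar n (bar n i) = i" "bar n (bar n j) = j"
    using i by (auto simp: bar_def)
  have ne: "i \<noteq> bar n j" "i \<noteq> bar n i" "j \<noteq> bar n j" "bar n i \<notin> I" "j \<noteq> bar n i" using b i I'(2) by auto
  let ?f = "\<lambda>l. if l = i then j else if l = bar n j then bar n i else l"
  let ?v = "\<lambda>l. if l = i then bvec j else if l = bar n j then cscale (- 1) (bvec (bar n i)) else 0"
  show ?thesis
  proof (rule cell_degeneration[OF A J I, where f = ?f and v = ?v])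
    show "bij_betw ?f I (I - {i, bar n j} \<union> {j, bar n i})"
      using i ne b by (auto simp: bij_betw_def inj_on_def)
    have z: "omega n (bvec x) (bvec y) = 0" if "1 \<le> x" "x \<le> 2*n+2" "y \<noteq> bar n x" for x y
      using that by (simp add: omega_bvec)
    have r: "1 \<le> x" "x \<le> 2*n+2" if "x \<in> I" for x using that I' by auto
    have zI: "omega n (bvec x) (bvec y) = 0" if "x \<in> I" "y \<in> I" for x y
      using z r I'(2) that by metis
    have zj: "omega n (bvec j) (bvec y) = 0" if "y \<in> I" "y \<noteq> bar n j" for y
      using z[of j y] that i by auto
    have zi: "omega n (bvec (bar n i)) (bvec y) = 0" if "y \<noteq> i" for y
      using z[of "bar n i" y] that b by auto
    have zj': "omega n (bvec y) (bvec j) = 0" if "y \<in> I" "y \<noteq> bar n j" for y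
      using zj[OF that] by (subst omega_swap) simp
    have zi': "omega n (bvec y) (bvec (bar n i)) = 0" if "y \<noteq> i" for y
      using zi[OF that] by (subst omega_swap) simp
    have o: "omega n (bvec i) (bvec (bar n i)) = 1" "omega n (bvec j) (bvec (bar n j)) = 1"
      "omega n (bvec (bar n i)) (bvec i) = -1" "omega n (bvec (bar n j)) (bvec j) = -1"
      using i b by (auto simp: omega_bvec sg_def)
    have "i \<noteq> j" using i by simp
    then show "omega n (bvec x + cscale t (?v x)) (bvec y + cscale t (?v y)) = 0" if "x \<in> I" "y \<in> I" for x y t
      using that zI zj zi zj' zi' o ne
      by (auto simp: omega_add_left omega_add_right omega_scale_left omega_scale_right omega_minus)
  qed (use i b ne in \<open>auto simp: odd_space_iff bvec_apply\<close>)
qed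

text \<open>Index sums are bounded by \<open>k * (2*n+1)\<close>, so moves that increase the sum end
  at \<open>T\<close>. Membership travels in the opposite direction, from the larger cell to the
  smaller one.\<close>

lemma cell_climb:
  assumes step: "\<And>I. P I \<Longrightarrow> I \<noteq> T \<Longrightarrow> \<exists>I'. P I' \<and> \<Sum>I < \<Sum>I' \<and> (cell_in n A I' \<longrightarrow> cell_in n A I)"
    and adm: "\<And>I. P I \<Longrightarrow> adm n k I" and T: "cell_in n A T" and I: "P I"
  shows "cell_in n A I"
  using I
proof (induction "k * (2*n+1) - \<Sum>I" arbitrary: I rule: less_induct)
  case less
  show ?case
  proof (cases "I = T")
    case False
    then obtain I' where I': "P I'" "\<Sum>I < \<Sum>I'" "cell_in n A I' \<longrightarrow> cell_in n A I"
      using step less.prems by blast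
    have "i \<le> 2*n+1" if "i \<in> I'" for i using adm[OF I'(1)] that by (auto simp: adm_def)
    from sum_bounded_above[of I' "\<lambda>i. i", OF this] have "\<Sum>I' \<le> card I' * (2*n+1)" by simp
    then have "\<Sum>I' \<le> k * (2*n+1)" using adm[OF I'(1)] by (simp add: adm_def)
    then have "k * (2*n+1) - \<Sum>I' < k * (2*n+1) - \<Sum>I" using I'(2) by linarith
    then show ?thesis using less.hyps I' by blast
  qed (use T in simp)
qed

lemma upper_interval:
  assumes "S \<subseteq> {a..k}" "\<And>i. i \<in> S \<Longrightarrow> i < k \<Longrightarrow> Suc i \<in> S" "card S = c"
  shows "S = {k + 1 - c..k}"
proof (cases "S = {}")
  case False
  have fin: "finite S" using assms(1) finite_subset by blast
  define m where "m = Min S"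
  have m: "m \<in> S" "\<And>i. i \<in> S \<Longrightarrow> m \<le> i" using False fin by (auto simp: m_def)
  have "m + i \<in> S" if "m + i \<le> k" for i
    using that by (induction i) (use m assms(2) in auto)
  then have "{m..k} \<subseteq> S" by (metis atLeastAtMost_iff le_Suc_ex subsetI)
  then have S: "S = {m..k}" using m(2) assms(1) by auto
  then have "c = k + 1 - m" "m \<le> k" using assms(3) m(1) by auto
  then show ?thesis using S by auto
qed (use assms(3) in auto)

lemma card_exchange: "finite I \<Longrightarrow> i \<in> I \<Longrightarrow> j \<notin> I \<Longrightarrow> card (insert j (I - {i})) = card I"
  by (simp add: card_Suc_Diff1 del: card_Diff_insert)

lemma adm_move_single:
  assumes "adm n k I" "i \<in> I" "i < j" "j \<le> 2*n+1" "j \<notin> I" "bar n j \<notin> I - {i}"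
  shows "adm n k (insert j (I - {i}))" "\<Sum>I < \<Sum>(insert j (I - {i}))"
proof -
  have I: "I \<subseteq> {1..2*n+1}" "card I = k" "\<And>i. i \<in> I \<Longrightarrow> bar n i \<notin> I" "finite I"
    using assms(1) finite_subset by (auto simp: adm_def)
  have "bar n l \<noteq> j" if "l \<in> I" "l \<noteq> i" for l
  proof
    assume "bar n l = j"
    moreover have "l \<in> {1..2*n+1}" using that I(1) by blast
    ultimately have "bar n j = l" by (auto simp: bar_def)
    then show False using assms(6) that by auto
  qed
  moreover have "card (insert j (I - {i})) = k"
    using card_exchange[OF I(4) assms(2,5)] I(2) by (simp only:)
  ultimately show "adm n k (insert j (I - {i}))"
    using I assms bar_neq[of n j] by (auto simp: adm_def)
  have "\<Sum>I = i + \<Sum>(I - {i})" using I(4) assms(2) by (simp add: sum.remove)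
  moreover have "\<Sum>(insert j (I - {i})) = j + \<Sum>(I - {i})" using I(4) assms(5) by simp
  ultimately show "\<Sum>I < \<Sum>(insert j (I - {i}))" using assms(3) by linarith
qed

lemma adm_move_pair:
  assumes "adm n k I" and i: "i \<in> I" "bar n j \<in> I" "i < j" "2 \<le> i" "j \<le> n" "j \<notin> I"
  shows "adm n k (I - {i, bar n j} \<union> {j, bar n i})" "\<Sum>I < \<Sum>(I - {i, bar n j} \<union> {j, bar n i})"
proof -
  have I: "I \<subseteq> {1..2*n+1}" "card I = k" "\<And>i. i \<in> I \<Longrightarrow> bar n i \<notin> I" "finite I"
    using assms(1) finite_subset by (auto simp: adm_def)
  have b: "bar n j < bar n i" "n + 2 < bar n j" "bar n i \<le> 2*n+1" "bar n (bar n i) = i" "bar n (bar n j) = j"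
    using i by (auto simp: bar_def)
  have ne: "i \<noteq> bar n j" "j \<noteq> bar n i" "bar n i \<notin> I" using b i I(3) by auto
  let ?K = "I - {i, bar n j}"
  have IK: "I = ?K \<union> {i, bar n j}" using i by auto
  have fK: "finite ?K" using I(4) by simp
  have "card I = card ?K + 2" by (subst IK, subst card_Un_disjoint) (use fK ne in auto)
  moreover have "card (?K \<union> {j, bar n i}) = card ?K + 2"
    by (subst card_Un_disjoint) (use fK ne i in auto)
  moreover have "bar n l \<notin> ?K \<union> {j, bar n i}" if "l \<in> ?K \<union> {j, bar n i}" for l
  proof -
    have l: "l \<in> {1..2*n+1}" using that I(1) b i by auto
    then have "bar n l = j \<longleftrightarrow> l = bar n j" "bar n l = bar n i \<longleftrightarrow> l = i"
      using b i by (auto simp: bar_def)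
    then show ?thesis using that I(3) ne b bar_neq[of n j] bar_neq[of n i] by auto
  qed
  ultimately show "adm n k (?K \<union> {j, bar n i})"
    using I(1,2) b i by (auto simp: adm_def)
  have "\<Sum>I = \<Sum>?K + (i + bar n j)" by (subst IK, subst sum.union_disjoint) (use fK ne in auto)
  moreover have "\<Sum>(?K \<union> {j, bar n i}) = \<Sum>?K + (j + bar n i)"
    by (subst sum.union_disjoint) (use fK ne i in auto)
  ultimately show "\<Sum>I < \<Sum>(?K \<union> {j, bar n i})" using i b by linarith
qed

text \<open>An index \<open>x\<close> outside \<open>T\<close> is exchanged for an index
  \<open>j\<close> of \<open>T\<close>. The partner of \<open>x\<close> lies neither in
  \<open>C\<close> nor in \<open>U\<close>, hence is at least \<open>k + 1\<close>, whereas
  \<open>j\<close> is the partner of some \<open>u \<le> k + 1\<close>; since \<open>bar n\<close>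
  reverses the order, \<open>x < j\<close>.\<close>

lemma final_move_exists:
  assumes I: "adm n k I" and kn: "k \<le> n" and C: "I \<inter> {1..k} = C"
    and T: "T = C \<union> bar n ` U" "card T = k" and U: "U \<subseteq> {2..k+1}" "{2..k} \<subseteq> C \<union> U" "C \<inter> U = {}"
    and ne: "I \<noteq> T"
  obtains x j where "x \<in> I" "j \<notin> I" "k < x" "x < j" "j \<le> 2*n+1" "bar n j \<notin> I - {x}"
proof -
  have I': "I \<subseteq> {1..2*n+1}" "card I = k" "\<And>i. i \<in> I \<Longrightarrow> bar n i \<notin> I" "finite I"
    using I finite_subset by (auto simp: adm_def)
  have fT: "finite T" unfolding T(1) C[symmetric] using I'(4) finite_subset[OF U(1)] by auto
  have "\<not> I \<subseteq> T" using card_subset_eq[OF fT] T(2) I'(2) ne by auto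
  then obtain x0 where x0: "x0 \<in> I" "x0 \<notin> T" by blast
  \<comment> \<open>The partner of \<open>j\<close> can meet \<open>I\<close> only at
    \<open>k + 1\<close>. If \<open>k + 1\<close> is in \<open>I\<close>, it is itself chosen to
    leave, so the exchange stays isotropic.\<close>
  define x where "x = (if k + 1 \<in> I then k + 1 else x0)"
  have barU: "k + 2 \<le> bar n u" "bar n u \<le> 2*n+1" "bar n (bar n u) = u" if "u \<in> U" for u
  proof -
    have "u \<in> {2..k+1}" using that U(1) by blast
    then show "k + 2 \<le> bar n u" "bar n u \<le> 2*n+1" "bar n (bar n u) = u" using kn by (auto simp: bar_def)
  qed
  have "k + 1 \<notin> C" using C by auto
  then have "k + 1 \<notin> T" using barU by (force simp: T(1))
  then have x: "x \<in> I" "x \<notin> T" using x0 by (auto simp: x_def)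
  have x1: "1 \<le> x" "x \<le> 2*n+1" using x(1) I'(1) by auto
  have "x \<notin> C" using x(2) T(1) by auto
  then have kx: "k < x" using C x(1) x1 by auto
  have bx: "bar n (bar n x) = x" "2 \<le> bar n x" using x1 by (auto simp: bar_def)
  have "bar n x \<notin> U" using x(2) T(1) bx(1) by (metis UnCI image_eqI)
  moreover have "bar n x \<notin> C" using I'(3)[OF x(1)] C by auto
  ultimately have "\<not> bar n x \<le> k" using U(2) bx(2) by auto
  then have bk: "k + 1 \<le> bar n x" by simp
  have "\<not> T \<subseteq> I" using card_subset_eq[OF I'(4)] T(2) I'(2) ne by auto
  then obtain j where j: "j \<in> T" "j \<notin> I" by blast
  then have "j \<notin> C" using C by auto
  then obtain u where u: "u \<in> U" "j = bar n u" using j T(1) by auto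
  have u2: "2 \<le> u" "u \<le> k + 1" using u(1) U(1) by auto
  have "x \<le> j"
    using bk u2 bx(1) x1 unfolding u(2) by (auto simp: bar_def)
  then have "x < j" using x(1) j(2) by (metis le_neq_implies_less)
  moreover have "bar n j \<notin> I - {x}"
  proof -
    have "bar n j = u" using barU u by simp
    moreover have "u \<notin> I - {x}"
    proof (cases "u \<le> k")
      case True
      then have "u \<notin> I" using C u2 U(3) u(1) by auto
      then show ?thesis by simp
    next
      case False
      then have "u = k + 1" using u2 by simp
      then show ?thesis by (auto simp: x_def)
    qed
    ultimately show ?thesis by simp
  qed
  ultimately show thesis using that x(1) j(2) kx barU u by blast
qed

text \<open>A cell climbs to the target \<open>T\<close> by moves that increase the sum of the indices: first surplus
  indices leave \<open>{1..k}\<close>, then the indices remaining there move up to \<open>C\<close>, and finally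
  the others move into \<open>bar n ` U\<close>.\<close>

lemma cells_in_closed:
  fixes one :: bool
  assumes A: "zariski_closed n k A" and kn: "1 \<le> k" "k \<le> n" and c: "one \<longrightarrow> 1 \<le> c"
    and C: "C = {i. i = 1 \<and> one} \<union> {k + 1 - (if one then c - 1 else c)..k}"
    and T: "T = C \<union> bar n ` U" "card T = k" and U: "U \<subseteq> {2..k+1}" "{2..k} \<subseteq> C \<union> U" "C \<inter> U = {}"
    and TA: "cell_in n A T"
    and I: "adm n k I" "1 \<in> I \<longleftrightarrow> one" "c \<le> card (I \<inter> {1..k})"
  shows "cell_in n A I"
proof -
  define P where "P I \<longleftrightarrow> adm n k I \<and> (1 \<in> I \<longleftrightarrow> one) \<and> c \<le> card (I \<inter> {1..k})" for I
  show ?thesis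
  proof (rule cell_climb[where P = P and T = T])
    show "adm n k I" if "P I" for I using that by (simp add: P_def)
    show "P I" using I by (simp add: P_def)
    fix I assume PI: "P I" and ne: "I \<noteq> T"
    then have adm: "adm n k I" and one: "1 \<in> I \<longleftrightarrow> one" and card: "c \<le> card (I \<inter> {1..k})"
      by (auto simp: P_def)
    have I': "I \<subseteq> {1..2*n+1}" "card I = k" "\<And>i. i \<in> I \<Longrightarrow> bar n i \<notin> I" "finite I"
      using adm finite_subset by (auto simp: adm_def)
    let ?S = "I \<inter> {2..k}"
    have S: "card (I \<inter> {1..k}) = card ?S + (if one then 1 else 0)"
    proof -
      have "{1..k} = insert 1 {2..k}" using kn by auto
      then have "I \<inter> {1..k} = (if one then insert 1 ?S else ?S)" using one by auto
      then show ?thesis using I'(4) by auto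
    qed
    consider (big) "c < card (I \<inter> {1..k})"
      | (up) i where "card (I \<inter> {1..k}) = c" "i \<in> ?S" "i < k" "Suc i \<notin> I"
      | (final) "card (I \<inter> {1..k}) = c" "\<And>i. i \<in> ?S \<Longrightarrow> i < k \<Longrightarrow> Suc i \<in> ?S"
      using card by (fastforce simp: le_less)
    then show "\<exists>I'. P I' \<and> \<Sum>I < \<Sum>I' \<and> (cell_in n A I' \<longrightarrow> cell_in n A I)"
    proof cases
      case big
      \<comment> \<open>Index \<open>1\<close> is kept, so the surplus contains some
        \<open>i \<ge> 2\<close>; its partner lies inside the odd space and beyond
        \<open>k\<close>.\<close>
      then have "0 < card ?S" using S c by (auto split: if_splits)
      then obtain i where i: "i \<in> I" "2 \<le> i" "i \<le> k" using I'(4) by (auto simp: card_gt_0_iff)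
      have b: "i < bar n i" "bar n i \<le> 2*n+1" "bar n i \<notin> I" "bar n (bar n i) \<notin> I - {i}" "k < bar n i"
        using i kn I'(3) by (auto simp: bar_def)
      have "insert (bar n i) (I - {i}) \<inter> {1..k} = (I \<inter> {1..k}) - {i}" using b(5) by auto
      then have "c \<le> card (insert (bar n i) (I - {i}) \<inter> {1..k})" using big i I'(4) by (simp add: card_Diff_singleton)
      then have "P (insert (bar n i) (I - {i}))"
        using adm_move_single(1)[OF adm i(1) b(1-4)] one i b by (auto simp: P_def)
      then show ?thesis
        using adm_move_single(2)[OF adm i(1) b(1-4)] cell_move_single[OF A adm i(1) b(1-4)] by blast
    next
      case (up i)
      then have i: "i \<in> I" "2 \<le> i" "i < Suc i" "Suc i \<le> n" "Suc i \<le> 2*n+1" "Suc i \<le> k" using kn by auto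
      show ?thesis
      proof (cases "bar n (Suc i) \<in> I")
        case False
        then have b: "bar n (Suc i) \<notin> I - {i}" by simp
        have "insert (Suc i) (I - {i}) \<inter> {1..k} = insert (Suc i) (I \<inter> {1..k} - {i})" using i by auto
        also have "card \<dots> = card (I \<inter> {1..k})"
          using i up(4) I'(4) by (intro card_exchange) auto
        finally have "P (insert (Suc i) (I - {i}))"
          using adm_move_single(1)[OF adm i(1,3,5) up(4) b] one i up(1) by (auto simp: P_def)
        then show ?thesis
          using adm_move_single(2)[OF adm i(1,3,5) up(4) b] cell_move_single[OF A adm i(1,3,5) up(4) b] by blast
      next
        \<comment> \<open>The partner of the destination is occupied, so both indices move together;
          the partners lie beyond \<open>k\<close>, and the count in \<open>{1..k}\<close> does not
          change.\<close>
        case True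
        let ?J = "I - {i, bar n (Suc i)} \<union> {Suc i, bar n i}"
        have bk: "k < bar n i" "k < bar n (Suc i)" "bar n i \<noteq> 1" using i kn by (auto simp: bar_def)
        have "?J \<inter> {1..k} = insert (Suc i) (I \<inter> {1..k} - {i})" using i bk by auto
        also have "card \<dots> = card (I \<inter> {1..k})"
          using i up(4) I'(4) by (intro card_exchange) auto
        finally have "P ?J"
          using adm_move_pair(1)[OF adm i(1) True i(3,2,4) up(4)] one i bk up(1) by (auto simp: P_def)
        then show ?thesis
          using adm_move_pair(2)[OF adm i(1) True i(3,2,4) up(4)]
            cell_move_pair[OF A adm i(1) True i(3,2,4) up(4)] by blast
      qed
    next
      case final
      \<comment> \<open>Index \<open>1\<close>, if present, counts towards \<open>c\<close>. No
        upward step being possible, the other indices fill the top of \<open>{1..k}\<close>.\<close>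
      have cS: "card ?S = (if one then c - 1 else c)" using final(1) S by auto
      have "?S = {k + 1 - (if one then c - 1 else c)..k}"
        by (rule upper_interval[where a = 2]) (use final(2) cS in auto)
      moreover have "{1..k} = insert 1 {2..k}" using kn by auto
      then have "I \<inter> {1..k} = {i. i = 1 \<and> one} \<union> ?S" using one by auto
      ultimately have IC: "I \<inter> {1..k} = C" unfolding C by simp
      obtain x j where x: "x \<in> I" "j \<notin> I" "k < x" "x < j" "j \<le> 2*n+1" "bar n j \<notin> I - {x}"
        by (rule final_move_exists[OF adm kn(2) IC T U ne])
      have "insert j (I - {x}) \<inter> {1..k} = I \<inter> {1..k}" using x(3,4) by auto
      then have "P (insert j (I - {x}))"
        using adm_move_single(1)[OF adm x(1,4,5,2,6)] PI x kn by (auto simp: P_def)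
      then show ?thesis
        using adm_move_single(2)[OF adm x(1,4,5,2,6)] cell_move_single[OF A adm x(1,4,5,2,6)] by blast
    qed
  qed (rule TA)
qed

section \<open>Intersections of subspaces\<close>

text \<open>A relation between \<open>A1\<close> and elements of \<open>A2 - B\<close> equates a
  vector of \<open>S\<close> with one of \<open>T\<close>. This vector lies in
  \<open>cvs.span B\<close>, so the relation already takes place inside \<open>A2\<close>.\<close>

lemma independent_glue:
  assumes S: "cvs.subspace S" and T: "cvs.subspace T"
    and A1: "B \<subseteq> A1" "A1 \<subseteq> S" "cvs.independent A1"
    and A2: "B \<subseteq> A2" "A2 \<subseteq> T" "cvs.independent A2" "finite A2"
    and B: "S \<inter> T \<subseteq> cvs.span B"
  shows "A1 \<inter> A2 = B" "cvs.independent (A1 \<union> A2)"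
proof -
  show "A1 \<inter> A2 = B"
  proof (rule ccontr)
    assume "A1 \<inter> A2 \<noteq> B"
    then obtain x where x: "x \<in> A1" "x \<in> A2" "x \<notin> B" using A1(1) A2(1) by blast
    then have "x \<in> cvs.span B" using A1(2) A2(2) B by blast
    moreover have "cvs.span B \<subseteq> cvs.span (A1 - {x})" using x A1(1) by (intro cvs.span_mono) auto
    ultimately show False using A1(3) x(1) by (auto simp: cvs.dependent_def)
  qed
  have "cvs.independent (A1 \<union> C)" if "finite C" "C \<subseteq> A2 - B" for C
    using that
  proof (induction C rule: finite_induct)
    case (insert c C)
    have "c \<notin> cvs.span (A1 \<union> C)"
    proof
      assume "c \<in> cvs.span (A1 \<union> C)"
      then obtain u v where uv: "c = u + v" "u \<in> cvs.span A1" "v \<in> cvs.span C"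
        by (auto simp: cvs.span_Un)
      have "u \<in> S" using uv(2) cvs.span_minimal[OF A1(2) S] by blast
      have "C \<subseteq> T" using insert.prems A2(2) by blast
      then have "v \<in> T" using uv(3) cvs.span_minimal[OF _ T] by blast
      moreover have "c \<in> T" using insert.prems A2(2) by blast
      ultimately have "c - v \<in> T" using T by (simp add: cvs.subspace_diff)
      then have "u \<in> T" using uv(1) by simp
      then have "u \<in> cvs.span B" using \<open>u \<in> S\<close> B by blast
      then have "c \<in> cvs.span (B \<union> C)" using uv by (auto simp: cvs.span_Un)
      moreover have "cvs.span (B \<union> C) \<subseteq> cvs.span (A2 - {c})"
        using insert.prems insert.hyps A2(1) by (intro cvs.span_mono) auto
      ultimately show False using A2(3) insert.prems by (auto simp: cvs.dependent_def)
    qed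
    moreover have "cvs.independent (A1 \<union> C)" using insert by blast
    ultimately show ?case unfolding Un_insert_right by (rule cvs.independent_insertI)
  qed (use A1(3) in simp)
  from this[of "A2 - B"] have "cvs.independent (A1 \<union> (A2 - B))" using A2(4) by simp
  moreover have "A1 \<union> (A2 - B) = A1 \<union> A2" using A1(1) by blast
  ultimately show "cvs.independent (A1 \<union> A2)" by simp
qed

lemma independent_odd_finite:
  assumes "cvs.independent A" "A \<subseteq> odd_space n"
  shows "finite A"
  using cvs.independent_span_bound[of "bvec ` {1..2*n+1}" A] assms by (auto simp: odd_space_def)

text \<open>Bases adapted to the pair: as \<open>A1 \<union> A2\<close> is independent, counting
  elements replaces the dimension formula for sums and intersections.\<close>

lemma basis_pair:
  assumes S: "cvs.subspace S" "S \<subseteq> odd_space n" and T: "cvs.subspace T" "T \<subseteq> odd_space n"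
  obtains A1 A2 where "finite A1" "finite A2" "A1 \<subseteq> S" "A2 \<subseteq> T" "S = cvs.span A1" "T = cvs.span A2"
    "card A1 = cvs.dim S" "card A2 = cvs.dim T" "A1 \<inter> A2 \<subseteq> S \<inter> T" "cvs.independent (A1 \<union> A2)"
proof -
  obtain B where B: "B \<subseteq> S \<inter> T" "cvs.independent B" "S \<inter> T \<subseteq> cvs.span B"
    by (rule cvs.maximal_independent_subset)
  obtain A1 where A1: "B \<subseteq> A1" "A1 \<subseteq> S" "cvs.independent A1" "S \<subseteq> cvs.span A1"
    using cvs.maximal_independent_subset_extend[of B S] B by auto
  obtain A2 where A2: "B \<subseteq> A2" "A2 \<subseteq> T" "cvs.independent A2" "T \<subseteq> cvs.span A2"
    using cvs.maximal_independent_subset_extend[of B T] B by auto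
  have fin: "finite A1" "finite A2" using independent_odd_finite A1(2,3) A2(2,3) S(2) T(2) by blast+
  have "S = cvs.span A1" "T = cvs.span A2"
    using A1 A2 cvs.span_minimal[OF _ S(1)] cvs.span_minimal[OF _ T(1)] by blast+
  moreover have "card A1 = cvs.dim S" "card A2 = cvs.dim T"
    using cvs.basis_card_eq_dim A1 A2 by blast+
  moreover have "A1 \<inter> A2 = B" "cvs.independent (A1 \<union> A2)"
    using independent_glue[OF S(1) T(1) A1(1-3) A2(1-3) fin(2) B(3)] by auto
  ultimately show thesis using that fin A1(2) A2(2) B(1) by blast
qed

text \<open>The bound on the defect is expressed by a witness and an addition: truncated subtraction
  is avoided, and only a lower bound for the intersection has to be exhibited.\<close>

definition near :: "nat \<Rightarrow> nat \<Rightarrow> cvec set \<Rightarrow> cvec set \<Rightarrow> bool" where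
  "near k m U V \<longleftrightarrow> (\<exists>B. finite B \<and> cvs.independent B \<and> B \<subseteq> U \<inter> V \<and> k \<le> card B + m)"

lemma near_sym: "near k m U V \<Longrightarrow> near k m V U"
  by (simp add: near_def Int_commute)

lemma near_mono: "near k m U V \<Longrightarrow> m \<le> m' \<Longrightarrow> near k m' U V"
  by (fastforce simp: near_def)

lemma near_refl:
  assumes "U \<in> IG n k"
  shows "near k 0 U U"
proof -
  obtain B where B: "B \<subseteq> U" "cvs.independent B" "U \<subseteq> cvs.span B" "card B = cvs.dim U"
    by (rule cvs.basis_exists)
  then have "finite B" using independent_odd_finite[of B n] assms by (auto simp: IG_def)
  then show ?thesis using B assms by (auto simp: near_def IG_def)
qed

text \<open>Inside the \<open>k\<close>-dimensional \<open>V\<close>, subspaces of dimensions at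
  least \<open>k - a\<close> and \<open>k - b\<close> meet in dimension at least
  \<open>k - (a + b)\<close>.\<close>

lemma near_trans:
  assumes "near k a U V" "near k b V W"
    and U: "U \<in> IG n k" and V: "V \<in> IG n k" and W: "W \<in> IG n k"
  shows "near k (a + b) U W"
proof -
  obtain B1 where B1: "finite B1" "cvs.independent B1" "B1 \<subseteq> U \<inter> V" "k \<le> card B1 + a"
    using assms by (auto simp: near_def)
  obtain B2 where B2: "finite B2" "cvs.independent B2" "B2 \<subseteq> V \<inter> W" "k \<le> card B2 + b"
    using assms by (auto simp: near_def)
  have VV: "cvs.subspace V" "V \<subseteq> odd_space n" "cvs.dim V = k" using V by (auto simp: IG_def)
  have s: "cvs.span B1 \<subseteq> V" "cvs.span B2 \<subseteq> V"
    using cvs.span_minimal[OF _ VV(1), of B1] cvs.span_minimal[OF _ VV(1), of B2] B1(3) B2(3) by blast+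
  have "cvs.subspace U" "cvs.subspace W" using U W by (auto simp: IG_def)
  then have sub: "cvs.span B1 \<subseteq> U" "cvs.span B2 \<subseteq> W"
    using cvs.span_minimal[of B1 U] cvs.span_minimal[of B2 W] B1(3) B2(3) by blast+
  have o: "cvs.span B1 \<subseteq> odd_space n" "cvs.span B2 \<subseteq> odd_space n" using s VV(2) by blast+
  obtain A1 A2 where A: "finite A1" "finite A2" "A1 \<subseteq> cvs.span B1" "A2 \<subseteq> cvs.span B2"
    "card A1 = cvs.dim (cvs.span B1)" "card A2 = cvs.dim (cvs.span B2)"
    "A1 \<inter> A2 \<subseteq> cvs.span B1 \<inter> cvs.span B2" "cvs.independent (A1 \<union> A2)"
    by (rule basis_pair[OF cvs.subspace_span o(1) cvs.subspace_span o(2)]) (rule that)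
  have c: "card A1 = card B1" "card A2 = card B2"
    using A(5,6) B1(2) B2(2) by (simp_all add: cvs.dim_eq_card_independent)
  obtain B where Bv: "B \<subseteq> V" "cvs.independent B" "V \<subseteq> cvs.span B" "card B = cvs.dim V"
    by (rule cvs.basis_exists)
  have fB: "finite B" using independent_odd_finite[of B n] Bv VV by auto
  have "A1 \<union> A2 \<subseteq> cvs.span B" using A(3,4) s Bv(3) by blast
  then have "card (A1 \<union> A2) \<le> k"
    using cvs.independent_span_bound[OF fB A(8)] Bv(4) VV(3) by simp
  then have "card A1 + card A2 \<le> k + card (A1 \<inter> A2)" using card_Un_Int[OF A(1,2)] by linarith
  then have "k \<le> card (A1 \<inter> A2) + (a + b)" using c B1(4) B2(4) by linarith
  moreover have "cvs.independent (A1 \<inter> A2)" using A(8) by (rule cvs.independent_mono) auto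
  moreover have "A1 \<inter> A2 \<subseteq> U \<inter> W" using A(7) sub by blast
  ultimately show ?thesis unfolding near_def using A(1) by (intro exI[of _ "A1 \<inter> A2"]) auto
qed

section \<open>Degrees of rational curves\<close>

text \<open>The rows may come unsorted or repeated: sorting costs a sign, and a repetition makes the
  minor 0.\<close>

lemma minor_rows:
  assumes f: "f \<in> {0..<k} \<rightarrow> {1..2*n+1}"
  shows "\<exists>c. \<forall>u. minor k u f = c * pluecker n k (map u [0..<k]) (f ` {0..<k})"
proof (cases "inj_on f {0..<k}")
  case True
  define J where "J = f ` {0..<k}"
  have J: "J \<subseteq> {1..2*n+1}" "finite J" "card J = k" using f True by (auto simp: J_def card_image)
  let ?s = "(!) (sorted_list_of_set J)"
  have s: "bij_betw ?s {0..<k} J" using sorted_nth_bij[OF J(2,3)] by (simp add: atLeast0LessThan)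
  define p where "p a = (if a \<in> {0..<k} then inv_into {0..<k} ?s (f a) else a)" for a
  have "bij_betw f {0..<k} J" using True by (simp add: bij_betw_def J_def)
  then have "bij_betw (inv_into {0..<k} ?s \<circ> f) {0..<k} {0..<k}"
    using bij_betw_inv_into[OF s] by (rule bij_betw_trans)
  then have "bij_betw p {0..<k} {0..<k}"
    by (rule bij_betw_cong[THEN iffD1, rotated]) (simp add: p_def)
  then have p: "p permutes {0..<k}" by (rule bij_imp_permutes) (simp add: p_def)
  have fp: "f a = ?s (p a)" if "a < k" for a
    using bij_betw_inv_into_right[OF s, of "f a"] that by (simp add: p_def J_def)
  have pk: "p a < k" if "a < k" for a using permutes_in_image[OF p, of a] that by simp
  have "minor k u f = signof p * pluecker n k (map u [0..<k]) J" for u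
  proof -
    have "mat k k (\<lambda>(a, b). u b (f a)) = mat k k (\<lambda>(a, b). mat k k (\<lambda>(a, b). u b (?s a)) $$ (p a, b))"
      by (rule eq_matI) (auto simp: fp pk)
    then show ?thesis using det_permute_rows[OF _ p, of "mat k k (\<lambda>(a, b). u b (?s a))"]
      by (simp add: pluecker_minor[OF J(1,3)])
  qed
  then show ?thesis unfolding J_def by blast
next
  case False
  then obtain i j where ij: "i < k" "j < k" "i \<noteq> j" "f i = f j" by (auto simp: inj_on_def)
  have "minor k u f = 0" for u
    by (rule det_identical_rows[of _ k i j]) (use ij in \<open>auto intro!: eq_vecI\<close>)
  then show ?thesis by (intro exI[of _ 0]) simp
qed

text \<open>Multilinearity in the rows turns a determinant of arbitrary functionals into a fixed
  combination of Pluecker coordinates. Along a curve of degree \<open>m\<close> such determinants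
  are therefore again binary forms of degree \<open>m\<close>.\<close>

lemma functional_minor:
  obtains F c where "finite F"
    "\<And>u. det (mat k k (\<lambda>(a, b). \<Sum>j\<in>{1..2*n+1}. r a j * u b j)) =
       (\<Sum>f\<in>F. c f * pluecker n k (map u [0..<k]) (f ` {0..<k}))"
proof -
  let ?D = "{1..2*n+1}"
  define F where "F = {0..<k} \<rightarrow>\<^sub>E ?D"
  have fin: "finite F" unfolding F_def by (rule finite_PiE) auto
  have "\<forall>f\<in>F. \<exists>c. \<forall>u. minor k u f = c * pluecker n k (map u [0..<k]) (f ` {0..<k})"
    using minor_rows by (auto simp: F_def PiE_def)
  then obtain c where c: "\<And>f u. f \<in> F \<Longrightarrow> minor k u f = c f * pluecker n k (map u [0..<k]) (f ` {0..<k})"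
    by metis
  have "det (mat k k (\<lambda>(a, b). \<Sum>j\<in>?D. r a j * u b j)) =
      (\<Sum>f\<in>F. ((\<Prod>i=0..<k. r i (f i)) * c f) * pluecker n k (map u [0..<k]) (f ` {0..<k}))" for u
  proof -
    let ?P = "{p. p permutes {0..<k}}"
    have "det (mat k k (\<lambda>(a, b). \<Sum>j\<in>?D. r a j * u b j)) =
        (\<Sum>p\<in>?P. signof p * (\<Prod>i=0..<k. \<Sum>j\<in>?D. r i j * u (p i) j))"
      by (subst det_def'[of _ k]) (auto intro!: sum.cong prod.cong dest: permutes_in_image)
    also have "\<dots> = (\<Sum>p\<in>?P. signof p * (\<Sum>f\<in>F. \<Prod>i=0..<k. r i (f i) * u (p i) (f i)))"
      unfolding F_def by (subst prod_sum_PiE) auto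
    also have "\<dots> = (\<Sum>f\<in>F. \<Sum>p\<in>?P. (\<Prod>i=0..<k. r i (f i)) * (signof p * (\<Prod>i=0..<k. u (p i) (f i))))"
      by (subst sum.swap) (simp add: sum_distrib_left prod.distrib mult.left_commute)
    also have "\<dots> = (\<Sum>f\<in>F. (\<Prod>i=0..<k. r i (f i)) * minor k u f)"
    proof (rule sum.cong)
      fix f assume "f \<in> F"
      have "minor k u f = (\<Sum>p\<in>?P. signof p * (\<Prod>i=0..<k. u (p i) (f i)))"
        by (subst det_def'[of _ k]) (auto intro!: sum.cong prod.cong dest: permutes_in_image)
      then show "(\<Sum>p\<in>?P. (\<Prod>i=0..<k. r i (f i)) * (signof p * (\<Prod>i=0..<k. u (p i) (f i)))) =
          (\<Prod>i=0..<k. r i (f i)) * minor k u f" by (simp add: sum_distrib_left)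
    qed simp
    also have "\<dots> = (\<Sum>f\<in>F. ((\<Prod>i=0..<k. r i (f i)) * c f) * pluecker n k (map u [0..<k]) (f ` {0..<k}))"
      by (rule sum.cong) (auto simp: c mult.assoc)
    finally show ?thesis .
  qed
  then show thesis by (rule that[OF fin])
qed

text \<open>Laplace expansion along the replaced row: Cramer's rule in adjugate form.\<close>

lemma row_replaced_minor:
  fixes A B :: "complex mat"
  assumes A: "A \<in> carrier_mat k k" and B: "B \<in> carrier_mat k k" and ij: "i < k" "j < k"
  shows "(B * adj_mat A) $$ (j, i) = det (mat k k (\<lambda>(a, b). if a = i then B $$ (j, b) else A $$ (a, b)))"
proof -
  let ?C = "mat k k (\<lambda>(a, b). if a = i then B $$ (j, b) else A $$ (a, b))"
  have "(B * adj_mat A) $$ (j, i) = (\<Sum>b<k. B $$ (j, b) * cofactor A i b)"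
    using A B ij by (auto simp: adj_mat_def scalar_prod_def lessThan_atLeast0 intro!: sum.cong)
  also have "\<dots> = (\<Sum>b<k. ?C $$ (i, b) * cofactor ?C i b)"
  proof (rule sum.cong)
    fix b assume "b \<in> {..<k}"
    moreover have "mat_delete ?C i b = mat_delete A i b"
      using A ij by (intro eq_matI) (auto simp: mat_delete_def)
    ultimately show "B $$ (j, b) * cofactor A i b = ?C $$ (i, b) * cofactor ?C i b"
      using ij by (simp add: cofactor_def)
  qed simp
  also have "\<dots> = det ?C" by (rule laplace_expansion_row[symmetric]) (use ij in auto)
  finally show ?thesis .
qed

text \<open>The matrix of all replacements of a single row is \<open>B * adj_mat A\<close>. The
  additional factor \<open>det A\<close> avoids the exponent \<open>k - 1\<close> in the determinant
  of the adjugate.\<close>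

lemma det_row_replacements:
  fixes A B :: "complex mat"
  assumes A: "A \<in> carrier_mat k k" and B: "B \<in> carrier_mat k k"
  shows "det (mat k k (\<lambda>(j, i). det (mat k k (\<lambda>(a, b). if a = i then B $$ (j, b) else A $$ (a, b))))) * det A
    = det B * det A ^ k"
proof -
  have "mat k k (\<lambda>(j, i). det (mat k k (\<lambda>(a, b). if a = i then B $$ (j, b) else A $$ (a, b)))) = B * adj_mat A"
    using A B adj_mat(1)[OF A] row_replaced_minor[OF A B] by (intro eq_matI) auto
  moreover have "det (adj_mat A) * det A = det A ^ k"
  proof -
    have "det (adj_mat A) * det A = det (adj_mat A * A)" using det_mult[OF adj_mat(1)[OF A] A] by simp
    also have "\<dots> = det A ^ k" unfolding adj_mat(3)[OF A] by simp
    finally show ?thesis .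
  qed
  ultimately show ?thesis using det_mult[OF B adj_mat(1)[OF A]] by simp
qed

lemma power_dvd_det:
  fixes N :: "complex poly mat"
  assumes N: "N \<in> carrier_mat k k" and S: "S \<subseteq> {0..<k}"
    and q: "\<And>i j. j \<in> S \<Longrightarrow> i < k \<Longrightarrow> q dvd N $$ (j, i)"
  shows "q ^ card S dvd det N"
  unfolding det_def'[OF N]
proof (rule dvd_sum)
  fix p assume "p \<in> {p. p permutes {0..<k}}"
  then have p: "p permutes {0..<k}" by simp
  have "(\<Prod>j\<in>S. q) dvd (\<Prod>j\<in>S. N $$ (j, p j))"
    using S permutes_in_image[OF p] by (intro prod_dvd_prod q) auto
  also have "(\<Prod>j\<in>S. N $$ (j, p j)) dvd (\<Prod>j=0..<k. N $$ (j, p j))"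
    using S by (intro prod_dvd_prod_subset) auto
  finally have "q ^ card S dvd (\<Prod>j=0..<k. N $$ (j, p j))" by simp
  then show "q ^ card S dvd signof p * (\<Prod>j=0..<k. N $$ (j, p j))" by (rule dvd_mult)
qed

lemma dual_functionals:
  assumes "cvs.independent A"
  obtains \<phi> :: "cvec \<Rightarrow> cvec \<Rightarrow> complex" where "\<And>z. Vector_Spaces.linear cscale (*) (\<phi> z)"
    "\<And>z x. x \<in> A \<Longrightarrow> \<phi> z x = (if x = z then 1 else 0)"
proof -
  interpret vector_space_pair cscale "(*) :: complex \<Rightarrow> complex \<Rightarrow> complex"
    by unfold_locales (auto simp: algebra_simps)
  have "\<exists>g. Vector_Spaces.linear cscale (*) g \<and> (\<forall>x\<in>A. g x = (if x = z then 1 else 0))" for z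
    using linear_independent_extend[OF assms] .
  then show thesis using that by metis
qed

lemma functional_expand:
  assumes lin: "Vector_Spaces.linear cscale (*) g" and x: "x \<in> odd_space n"
  shows "g x = (\<Sum>j\<in>{1..2*n+1}. g (bvec j) * x j)"
proof -
  interpret vector_space_pair cscale "(*) :: complex \<Rightarrow> complex \<Rightarrow> complex"
    by unfold_locales (auto simp: algebra_simps)
  have "x = (\<Sum>j\<in>{1..2*n+1}. cscale (x j) (bvec j))"
    using x by (intro cvec_expand) (auto simp: odd_space_iff)
  then have "g x = g (\<Sum>j\<in>{1..2*n+1}. cscale (x j) (bvec j))" by (rule arg_cong)
  also have "\<dots> = (\<Sum>j\<in>{1..2*n+1}. x j * g (bvec j))"
    by (simp only: linear_sum[OF lin] linear_scale[OF lin])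
  finally show ?thesis by (simp only: mult.commute)
qed

text \<open>With adapted bases \<open>A1\<close>, \<open>A2\<close> of the two points, enumerated by
  \<open>a\<close> and \<open>c\<close>, let \<open>Q \<rho>\<close> be the determinant along the
  curve of the functionals dual to \<open>\<rho>\<close>. Then \<open>Q a\<close> is nonzero at
  \<open>t0\<close> and \<open>Q c\<close> at \<open>y\<close>. Replacing one functional of
  \<open>a\<close> by one dual to an element of \<open>A2 - A1\<close> gives a determinant vanishing
  at \<open>t0\<close>. By the replacement identity \<open>Q c * Q a ^ k\<close> is divisible by the
  determinant of all replacements, in which \<open>card (A2 - A1)\<close> rows vanish at
  \<open>t0\<close>. So \<open>Q c\<close> vanishes there to at least that order, and its degree
  bounds the order by \<open>m\<close>.\<close>

lemma morphism_near_finite: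
  assumes f: "is_morphism n k m f"
  shows "near k m (f (Some t0)) (f y)"
proof -
  have IG: "f x \<in> IG n k" for x using f by (auto simp: is_morphism_def)
  obtain F where F: "\<And>I. degree (F I) \<le> m"
    "\<And>x. (\<lambda>I. form_eval m (F I) x) \<in> pluecker_coords n k (f x)"
    using f by (auto simp: is_morphism_def)
  have "\<exists>vs. is_frame k (f x) vs \<and> (\<forall>I. form_eval m (F I) x = pluecker n k vs I)" for x
    using F(2)[of x] by (auto simp: pluecker_coords_def) metis
  then obtain vs where vs: "\<And>x. is_frame k (f x) (vs x)" "\<And>x I. form_eval m (F I) x = pluecker n k (vs x) I"
    by metis
  have s: "cvs.subspace (f x)" "f x \<subseteq> odd_space n" "cvs.dim (f x) = k" for x
    using IG[of x] by (auto simp: IG_def)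
  obtain A1 A2 where A: "finite A1" "finite A2" "A1 \<subseteq> f (Some t0)" "A2 \<subseteq> f y"
    "f (Some t0) = cvs.span A1" "f y = cvs.span A2"
    "card A1 = cvs.dim (f (Some t0))" "card A2 = cvs.dim (f y)"
    "A1 \<inter> A2 \<subseteq> f (Some t0) \<inter> f y" "cvs.independent (A1 \<union> A2)"
    by (rule basis_pair[OF s(1,2)[of "Some t0"] s(1,2)[of y]]) (rule that)
  note A = A[unfolded s(3)]
  let ?B = "A1 \<inter> A2"
  have indB: "cvs.independent ?B" using A(10) by (rule cvs.independent_mono) auto
  have "k \<le> card ?B + m"
  proof (rule ccontr)
    assume small: "\<not> k \<le> card ?B + m"
    obtain \<phi> where lin: "\<And>z. Vector_Spaces.linear cscale (*) (\<phi> z)"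
      and dual: "\<And>z x. x \<in> A1 \<union> A2 \<Longrightarrow> \<phi> z x = (if x = z then 1 else 0)"
      using dual_functionals[OF A(10)] by blast
    obtain a where a: "bij_betw a {0..<k} A1" using ex_bij_betw_nat_finite[OF A(1)] A(7) by auto
    have cd: "card (A1 - A2) = card (A2 - A1)"
      using card_Diff_subset_Int[of A1 A2] card_Diff_subset_Int[of A2 A1] A(1,2,7,8) by (simp add: Int_commute)
    then obtain h0 where h0: "bij_betw h0 (A1 - A2) (A2 - A1)"
      using finite_same_card_bij[of "A1 - A2" "A2 - A1"] A(1,2) by auto
    define h where "h x = (if x \<in> A2 then x else h0 x)" for x
    have "bij_betw h (?B \<union> (A1 - A2)) (?B \<union> (A2 - A1))"
    proof (rule bij_betw_combine)
      show "bij_betw h ?B ?B" by (rule bij_betw_cong[THEN iffD1, OF _ bij_betw_id]) (auto simp: h_def)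
      show "bij_betw h (A1 - A2) (A2 - A1)" by (rule bij_betw_cong[THEN iffD1, OF _ h0]) (auto simp: h_def)
    qed auto
    moreover have "?B \<union> (A1 - A2) = A1" "?B \<union> (A2 - A1) = A2" by blast+
    ultimately have "bij_betw h A1 A2" by simp
    then have c: "bij_betw (h \<circ> a) {0..<k} A2" using a bij_betw_trans by blast
    define c where "c = h \<circ> a"
    note cb = c[folded c_def]
    define M where "M \<rho> u = mat k k (\<lambda>(i, b). \<phi> (\<rho> i) (u b))" for \<rho> :: "nat \<Rightarrow> cvec" and u :: "nat \<Rightarrow> cvec"
    have frame_mem: "vs x ! b \<in> f x" if "b < k" for x b
    proof -
      have "vs x ! b \<in> set (vs x)" using vs(1)[of x] that by (auto simp: is_frame_def)
      then show ?thesis using vs(1)[of x] cvs.span_superset by (auto simp: is_frame_def)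
    qed
    then have frame_odd: "vs x ! b \<in> odd_space n" if "b < k" for x b
      using IG[of x] that by (auto simp: IG_def)
    have M_eq: "M \<rho> u = mat k k (\<lambda>(i, b). \<Sum>j\<in>{1..2*n+1}. \<phi> (\<rho> i) (bvec j) * u b j)"
      if "\<forall>b<k. u b \<in> odd_space n" for u \<rho>
      unfolding M_def using that functional_expand[OF lin] by (intro eq_matI) auto
    have M_scale: "det (M \<rho> u) = c * det (M \<rho> v)"
      if u: "\<And>b. b < k \<Longrightarrow> u b \<in> odd_space n" and v: "\<And>b. b < k \<Longrightarrow> v b \<in> odd_space n"
        and c: "\<And>J. pluecker n k (map u [0..<k]) J = c * pluecker n k (map v [0..<k]) J" for \<rho> u v c
    proof -
      obtain Fs cs where Fs: "finite Fs"
        "\<And>u. det (mat k k (\<lambda>(i, b). \<Sum>j\<in>{1..2*n+1}. \<phi> (\<rho> i) (bvec j) * u b j)) =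
           (\<Sum>f\<in>Fs. cs f * pluecker n k (map u [0..<k]) (f ` {0..<k}))"
        by (rule functional_minor[where k = k and n = n and r = "\<lambda>i j. \<phi> (\<rho> i) (bvec j)"]) (rule that)
      have "det (M \<rho> w) = (\<Sum>f\<in>Fs. cs f * pluecker n k (map w [0..<k]) (f ` {0..<k}))"
        if "\<forall>b<k. w b \<in> odd_space n" for w
        unfolding M_eq[OF that] by (rule Fs(2))
      then show ?thesis using u v by (simp add: c sum_distrib_left mult.left_commute)
    qed
    \<comment> \<open>The frames \<open>vs x\<close> are chosen pointwise, but a fixed combination
      of their Pluecker coordinates is a binary form in \<open>x\<close>.\<close>
    have "\<exists>Q. degree Q \<le> m \<and> (\<forall>x. form_eval m Q x = det (M \<rho> ((!) (vs x))))" for \<rho>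
    proof -
      obtain Fs cs where Fs: "finite Fs"
        "\<And>u. det (mat k k (\<lambda>(i, b). \<Sum>j\<in>{1..2*n+1}. \<phi> (\<rho> i) (bvec j) * u b j)) =
           (\<Sum>f\<in>Fs. cs f * pluecker n k (map u [0..<k]) (f ` {0..<k}))"
        by (rule functional_minor[where k = k and n = n and r = "\<lambda>i j. \<phi> (\<rho> i) (bvec j)"]) (rule that)
      have detM: "det (M \<rho> w) = (\<Sum>f\<in>Fs. cs f * pluecker n k (map w [0..<k]) (f ` {0..<k}))"
        if "\<forall>b<k. w b \<in> odd_space n" for w
        unfolding M_eq[OF that] by (rule Fs(2))
      define Q where "Q = (\<Sum>f\<in>Fs. smult (cs f) (F (f ` {0..<k})))"
      have "degree Q \<le> m"
        unfolding Q_def using Fs(1) F(1) by (intro degree_sum_le) (auto intro: order_trans[OF degree_smult_le])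
      moreover have "form_eval m Q x = det (M \<rho> ((!) (vs x)))" for x
      proof -
        have "form_eval m Q x = (\<Sum>f\<in>Fs. cs f * form_eval m (F (f ` {0..<k})) x)"
          by (cases x) (auto simp: form_eval_def Q_def poly_sum coeff_sum)
        also have "\<dots> = det (M \<rho> ((!) (vs x)))"
          using detM[of "(!) (vs x)"] frame_odd by (simp add: family_of_frame(2)[OF vs(1)] vs(2))
        finally show ?thesis .
      qed
      ultimately show ?thesis by blast
    qed
    then obtain Q where degQ: "\<And>\<rho>. degree (Q \<rho>) \<le> m"
      and evQ: "\<And>\<rho> x. form_eval m (Q \<rho>) x = det (M \<rho> ((!) (vs x)))" by metis
    have nz: "form_eval m (Q \<rho>) x \<noteq> 0"
      if \<rho>: "bij_betw \<rho> {0..<k} A'" "A' \<subseteq> A1 \<union> A2" "f x = cvs.span A'" for \<rho> x A'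
    proof -
      have im: "\<rho> ` {..<k} = A'" using \<rho>(1) by (simp add: bij_betw_def atLeast0LessThan)
      have fr: "is_frame k (f x) (map \<rho> [0..<k])"
        using frame_of_dim[of \<rho> k] IG[of x] by (simp add: im \<rho>(3) IG_def)
      have odd: "\<forall>b<k. \<rho> b \<in> odd_space n"
        using im IG[of x] cvs.span_superset[of A'] by (auto simp: IG_def \<rho>(3))
      obtain c where cc: "\<And>J. pluecker n k (map \<rho> [0..<k]) J = c * pluecker n k (vs x) J"
        using pluecker_change_frame[OF vs(1) fr] by blast
      have "\<phi> (\<rho> i) (\<rho> b) = (if i = b then 1 else 0)" if "i < k" "b < k" for i b
        using dual[of "\<rho> b" "\<rho> i"] \<rho>(2) im that inj_on_eq_iff[of \<rho> "{0..<k}" b i] \<rho>(1)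
        by (auto simp: bij_betw_def)
      \<comment> \<open>The functionals are dual to the frame \<open>\<rho>\<close>; any other frame
        of the same space only rescales the determinant, so it cannot vanish.\<close>
      then have "M \<rho> \<rho> = 1\<^sub>m k" unfolding M_def by (intro eq_matI) auto
      moreover have "det (M \<rho> \<rho>) = c * det (M \<rho> ((!) (vs x)))"
      proof (rule M_scale)
        show "pluecker n k (map \<rho> [0..<k]) J = c * pluecker n k (map ((!) (vs x)) [0..<k]) J" for J
          unfolding family_of_frame(2)[OF vs(1)] by (rule cc)
      qed (use odd frame_odd in blast)+
      ultimately have "1 = c * form_eval m (Q \<rho>) x" using evQ by simp
      then show ?thesis by auto
    qed
    have Qa: "poly (Q a) t0 \<noteq> 0" using nz[OF a _ A(5)] by (auto simp: form_eval_def)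
    have Qc: "form_eval m (Q c) y \<noteq> 0" using nz[OF cb _ A(6)] by auto
    then have Qc0: "Q c \<noteq> 0" by (auto simp: form_eval_def split: option.splits)
    define N where "N = mat k k (\<lambda>(j, i). Q (a(i := c j)))"
    have N: "N \<in> carrier_mat k k" by (simp add: N_def)
    have id: "det N * Q a = Q c * Q a ^ k"
    proof (rule poly_eq_poly_eq_iff[THEN iffD1], rule ext)
      fix t
      let ?u = "(!) (vs (Some t))"
      have ev: "poly (Q \<rho>) t = det (M \<rho> ?u)" for \<rho> using evQ[of \<rho> "Some t"] by (simp add: form_eval_def)
      have rep: "M (a(i := c j)) ?u = mat k k (\<lambda>(l, b). if l = i then M c ?u $$ (j, b) else M a ?u $$ (l, b))"
        if "i < k" "j < k" for i j using that by (intro eq_matI) (auto simp: M_def)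
      have "map_mat (\<lambda>p. poly p t) N = mat k k (\<lambda>(j, i). det (mat k k (\<lambda>(l, b). if l = i then M c ?u $$ (j, b) else M a ?u $$ (l, b))))"
        by (rule eq_matI) (simp_all add: N_def ev rep)
      then have "poly (det N) t * det (M a ?u) = det (M c ?u) * det (M a ?u) ^ k"
        using det_row_replacements[of "M a ?u" k "M c ?u"] by (simp add: poly_det M_def)
      then show "poly (det N * Q a) t = poly (Q c * Q a ^ k) t" by (simp add: ev)
    qed
    define S where "S = {j \<in> {0..<k}. c j \<notin> A1}"
    have cardS: "card S = card (A2 - A1)"
    proof (rule bij_betw_same_card)
      have im: "c ` {0..<k} = A2" and inj: "inj_on c {0..<k}" using cb by (simp_all add: bij_betw_def)
      have "c ` S = {x \<in> c ` {0..<k}. x \<notin> A1}" by (auto simp: S_def)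
      then have "c ` S = A2 - A1" unfolding im by blast
      moreover have "S \<subseteq> {0..<k}" by (auto simp: S_def)
      then have "inj_on c S" by (rule inj_on_subset[OF inj])
      ultimately show "bij_betw c S (A2 - A1)" by (simp add: bij_betw_def)
    qed
    have "[:- t0, 1:] ^ card S dvd det N"
    proof (rule power_dvd_det[OF N])
      fix i j assume j: "j \<in> S" and i: "i < k"
      have cj: "c j \<in> A2" "c j \<notin> A1" "j < k" using j cb by (auto simp: S_def bij_betw_def)
      let ?u = "(!) (vs (Some t0))"
      \<comment> \<open>\<open>f (Some t0)\<close> is spanned by \<open>A1\<close>, which is
        annihilated by the functional dual to an element of \<open>A2 - A1\<close>.\<close>
      have zero: "\<phi> (c j) (?u b) = 0" if "b < k" for b
      proof -
        interpret vector_space_pair cscale "(*) :: complex \<Rightarrow> complex \<Rightarrow> complex"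
          by unfold_locales (auto simp: algebra_simps)
        have "?u b \<in> cvs.span A1"
          using frame_mem[OF that, of "Some t0"] A(5) by simp
        moreover have "\<phi> (c j) x = 0" if "x \<in> A1" for x using dual[of x "c j"] cj that by auto
        ultimately show ?thesis using linear_eq_0_on_span[OF lin] by blast
      qed
      have "det (M (a(i := c j)) ?u) = 0"
      proof (subst det_def'[of _ k])
        show "(\<Sum>p | p permutes {0..<k}. signof p * (\<Prod>l=0..<k. M (a(i := c j)) ?u $$ (l, p l))) = 0"
        proof (rule sum.neutral, intro ballI)
          fix p assume "p \<in> {p. p permutes {0..<k}}"
          then have "p i < k" using permutes_in_image[of p "{0..<k}" i] i by simp
          then have "M (a(i := c j)) ?u $$ (i, p i) = 0" using zero i by (simp add: M_def)
          then have "(\<Prod>l=0..<k. M (a(i := c j)) ?u $$ (l, p l)) = 0" using i by (intro prod_zero) auto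
          then show "signof p * (\<Prod>l=0..<k. M (a(i := c j)) ?u $$ (l, p l)) = 0" by simp
        qed
      qed (simp add: M_def)
      then have "poly (Q (a(i := c j))) t0 = 0"
        using evQ[of "a(i := c j)" "Some t0"] by (simp add: form_eval_def)
      then show "[:- t0, 1:] dvd N $$ (j, i)" using cj i by (simp add: N_def poly_eq_0_iff_dvd)
    qed (auto simp: S_def)
    then have "[:- t0, 1:] ^ card S dvd Q c * Q a ^ k" using id by (metis dvd_mult2)
    moreover have nz2: "Q c * Q a ^ k \<noteq> 0" using Qc0 Qa by auto
    ultimately have "card S \<le> order t0 (Q c * Q a ^ k)"
      using order_divides[of t0 "card S" "Q c * Q a ^ k"] by blast
    also have "\<dots> = order t0 (Q c) + order t0 (Q a ^ k)" by (rule order_mult[OF nz2])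
    also have "order t0 (Q a ^ k) = 0" using Qa by (intro order_0I) simp
    also have "order t0 (Q c) + 0 \<le> degree (Q c)" using order_degree[OF Qc0] by simp
    also have "\<dots> \<le> m" by (rule degQ)
    finally have "card (A2 - A1) \<le> m" using cardS by simp
    moreover have "card (A2 - A1) = k - card ?B"
      using card_Diff_subset_Int[of A2 A1] A(1,2,8) by (simp add: Int_commute)
    ultimately show False using small by linarith
  qed
  then show ?thesis unfolding near_def using A(1,9) indB by (intro exI[of _ ?B]) auto
qed

text \<open>Orders of vanishing are measured at a finite parameter; symmetry covers one infinite
  parameter, and for two infinite ones the points coincide.\<close>

lemma morphism_near:
  assumes f: "is_morphism n k m f"
  shows "near k m (f x) (f y)"
proof (cases x)
  case (Some t)
  then show ?thesis using morphism_near_finite[OF f] by simp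
next
  case None
  show ?thesis
  proof (cases y)
    case (Some t)
    then show ?thesis using near_sym[OF morphism_near_finite[OF f]] by simp
  next
    case None
    have "f y \<in> IG n k" using f by (auto simp: is_morphism_def)
    then show ?thesis using near_mono[OF near_refl, of "f y" n k m] None \<open>x = None\<close> by simp
  qed
qed

section \<open>Chains of rational curves\<close>

text \<open>The path is cut at an earlier visit whenever it would return to a vertex; without
  repetitions every component contributes its degree at most once.\<close>

lemma simple_path:
  assumes "(u, v) \<in> {(a, b). {a, b} \<in> N}\<^sup>*" "u \<in> U" "N \<subseteq> {{u, v} | u v. u \<in> U \<and> v \<in> U \<and> u \<noteq> v}"
  shows "\<exists>ws. ws \<noteq> [] \<and> hd ws = u \<and> last ws = v \<and> distinct ws \<and> set ws \<subseteq> U \<and>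
    (\<forall>i. Suc i < length ws \<longrightarrow> {ws ! i, ws ! Suc i} \<in> N)"
  using assms(1)
proof (induction rule: rtrancl_induct)
  case base
  show ?case by (rule exI[of _ "[u]"]) (use assms(2) in simp)
next
  case (step v w)
  then obtain ws where ws: "ws \<noteq> []" "hd ws = u" "last ws = v" "distinct ws" "set ws \<subseteq> U"
    "\<And>i. Suc i < length ws \<Longrightarrow> {ws ! i, ws ! Suc i} \<in> N" by blast
  have vw: "{v, w} \<in> N" using step.hyps by simp
  then obtain a b where "{v, w} = {a, b}" "a \<in> U" "b \<in> U" using assms(3) by blast
  then have wU: "w \<in> U" by (auto simp: doubleton_eq_iff)
  show ?case
  proof (cases "w \<in> set ws")
    case True
    then obtain i where i: "i < length ws" "ws ! i = w" by (auto simp: in_set_conv_nth)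
    let ?t = "take (Suc i) ws"
    have "last ?t = w" using i by (simp add: take_Suc_conv_app_nth)
    moreover have "hd ?t = u" "?t \<noteq> []" using ws(1,2) by (auto simp: hd_take)
    moreover have "set ?t \<subseteq> U" using ws(5) set_take_subset by fast
    ultimately show ?thesis using ws(4,6) by (intro exI[of _ ?t]) auto
  next
    case False
    have "{(ws @ [w]) ! j, (ws @ [w]) ! Suc j} \<in> N" if "Suc j < length (ws @ [w])" for j
    proof (cases "Suc j < length ws")
      case True
      then show ?thesis using ws(6) by (simp add: nth_append)
    next
      case False
      then have "j = length ws - 1" "Suc j = length ws" using that by auto
      then have "(ws @ [w]) ! j = v" "(ws @ [w]) ! Suc j = w" using ws(1,3) by (auto simp: nth_append last_conv_nth)
      then show ?thesis using vw by simp
    qed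
    then show ?thesis using ws False wU by (intro exI[of _ "ws @ [w]"]) auto
  qed
qed

lemma stable_map_near:
  assumes C: "C \<in> stable_maps n k d"
  shows "near k d (ev 1 C) (ev 2 C)"
proof -
  have tree: "is_tree (comps C) (nodes C)" and mk: "mark_comp C 1 \<in> comps C" "mark_comp C 2 \<in> comps C"
    and mor: "\<And>u. u \<in> comps C \<Longrightarrow> is_morphism n k (comp_deg C u) (comp_map C u)"
    and node: "\<And>u v. {u, v} \<in> nodes C \<Longrightarrow> comp_map C u (branch C u v) = comp_map C v (branch C v u)"
    and deg: "(\<Sum>u\<in>comps C. comp_deg C u) = d"
    using C unfolding stable_maps_def is_pointed_curve_def mem_Collect_eq by (blast | simp)+
  have IG: "comp_map C u x \<in> IG n k" if "u \<in> comps C" for u x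
    using mor[OF that] by (auto simp: is_morphism_def)
  have fin: "finite (comps C)" using tree by (simp add: is_tree_def)
  obtain ws where ws: "ws \<noteq> []" "hd ws = mark_comp C 1" "last ws = mark_comp C 2" "distinct ws"
    "set ws \<subseteq> comps C" "\<And>i. Suc i < length ws \<Longrightarrow> {ws ! i, ws ! Suc i} \<in> nodes C"
    using simple_path[of "mark_comp C 1" "mark_comp C 2" "nodes C" "comps C"] tree mk
    by (auto simp: is_tree_def)
  have path: "near k (\<Sum>j\<le>i. comp_deg C (ws ! j)) (ev 1 C) (comp_map C (ws ! i) x)" if "i < length ws" for i x
    using that
  proof (induction i arbitrary: x)
    case 0
    then have "ws ! 0 = mark_comp C 1" using ws(1,2) by (simp add: hd_conv_nth)
    then show ?case using morphism_near[OF mor[OF mk(1)]] by (simp add: ev_def)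
  next
    case (Suc i)
    have c: "ws ! i \<in> comps C" "ws ! Suc i \<in> comps C" using Suc.prems ws(5) nth_mem by (auto simp: subset_iff)
    \<comment> \<open>The entry point of a component is the node shared with its predecessor, where
      both maps agree.\<close>
    let ?y = "branch C (ws ! Suc i) (ws ! i)"
    have 1: "near k (\<Sum>j\<le>i. comp_deg C (ws ! j)) (ev 1 C) (comp_map C (ws ! Suc i) ?y)"
      using Suc.IH[of "branch C (ws ! i) (ws ! Suc i)"] Suc.prems node[OF ws(6)[OF Suc.prems]] by simp
    have 2: "near k (comp_deg C (ws ! Suc i)) (comp_map C (ws ! Suc i) ?y) (comp_map C (ws ! Suc i) x)"
      by (rule morphism_near[OF mor[OF c(2)]])
    have "ev 1 C \<in> IG n k" unfolding ev_def by (rule IG[OF mk(1)])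
    from near_trans[OF 1 2 this IG[OF c(2)] IG[OF c(2)]] show ?case by simp
  qed
  define l where "l = length ws - 1"
  have l: "l < length ws" "ws ! l = mark_comp C 2" using ws(1,3) by (auto simp: l_def last_conv_nth)
  have "length ws = Suc l" using ws(1) by (cases ws) (auto simp: l_def)
  then have "(\<Sum>j\<le>l. comp_deg C (ws ! j)) = (\<Sum>j<length ws. comp_deg C (ws ! j))"
    by (simp add: lessThan_Suc_atMost)
  also have "\<dots> = (\<Sum>u\<in>set ws. comp_deg C u)"
    using sum.reindex_bij_betw[OF bij_betw_nth[OF ws(4) refl refl], of "comp_deg C"] by simp
  also have "\<dots> \<le> d" unfolding deg[symmetric] using ws(5) fin by (intro sum_mono2) auto
  finally show ?thesis
    using path[OF l(1), of "mark_pt C 2"] near_mono l(2) by (simp add: ev_def)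
qed

section \<open>Construction of rational curves\<close>

text \<open>At infinity a column of positive degree contributes its leading vector
  \<open>q b\<close>, a column of degree 0 its constant \<open>p b\<close>; the condition on
  \<open>q\<close> keeps columns of the second kind constant.\<close>

lemma morphism_of_frames:
  fixes p q :: "nat \<Rightarrow> cvec" and m :: "nat \<Rightarrow> nat"
  assumes q0: "\<And>b. b < k \<Longrightarrow> m b = 0 \<Longrightarrow> q b = 0"
    and fin: "\<And>t. cvs.span ((\<lambda>b. p b + cscale (t ^ m b) (q b)) ` {..<k}) \<in> IG n k"
    and inf: "cvs.span ((\<lambda>b. if m b = 0 then p b else q b) ` {..<k}) \<in> IG n k"
  shows "is_morphism n k (\<Sum>b<k. m b)
    (\<lambda>x. case x of Some t \<Rightarrow> cvs.span ((\<lambda>b. p b + cscale (t ^ m b) (q b)) ` {..<k})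
       | None \<Rightarrow> cvs.span ((\<lambda>b. if m b = 0 then p b else q b) ` {..<k}))"
proof -
  define c where "c b r = [:p b r:] + monom (q b r) (m b)" for b r
  define F where "F = pluecker_poly n k c"
  have deg: "degree (c b r) \<le> m b" for b r
    unfolding c_def by (intro degree_add_le) (auto simp: degree_monom_le)
  have top: "coeff (c b r) (m b) = (if m b = 0 then p b r else q b r)" if "b < k" for b r
    using q0[OF that] by (auto simp: c_def coeff_pCons split: nat.splits)
  have "poly (F J) t = pluecker n k (map (\<lambda>b. p b + cscale (t ^ m b) (q b)) [0..<k]) J" for t J
    unfolding F_def poly_pluecker_poly
    by (rule arg_cong[of _ _ "\<lambda>vs. pluecker n k vs J"])
      (auto simp: fun_eq_iff c_def poly_monom mult.commute)
  moreover have "coeff (F J) (\<Sum>b<k. m b) = pluecker n k (map (\<lambda>b. if m b = 0 then p b else q b) [0..<k]) J" for J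
    unfolding F_def pluecker_poly_top(2)[OF deg]
    by (rule arg_cong[of _ _ "\<lambda>vs. pluecker n k vs J"]) (auto simp: fun_eq_iff top)
  moreover have coords: "h \<in> pluecker_coords n k (cvs.span (u ` {..<k}))"
    if "\<And>J. h J = pluecker n k (map u [0..<k]) J" "cvs.span (u ` {..<k}) \<in> IG n k" for u h
  proof -
    have "is_frame k (cvs.span (u ` {..<k})) (map u [0..<k])"
      using that(2) by (intro frame_of_dim) (auto simp: IG_def)
    moreover have "h = pluecker n k (map u [0..<k])" using that(1) by (simp add: fun_eq_iff)
    ultimately show ?thesis unfolding pluecker_coords_def by blast
  qed
  ultimately have "(\<lambda>I. form_eval (\<Sum>b<k. m b) (F I) x) \<in> pluecker_coords n k
      (case x of Some t \<Rightarrow> cvs.span ((\<lambda>b. p b + cscale (t ^ m b) (q b)) ` {..<k})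
       | None \<Rightarrow> cvs.span ((\<lambda>b. if m b = 0 then p b else q b) ` {..<k}))" for x
    unfolding form_eval_def
    by (cases x) (simp_all only: option.case, (rule coords; use fin inf in blast)+)
  moreover have "degree (F I) \<le> (\<Sum>b<k. m b)" for I
    unfolding F_def by (rule pluecker_poly_top(1)[OF deg])
  ultimately show ?thesis unfolding is_morphism_def
    using fin inf by (intro conjI exI[of _ F]) (auto split: option.splits)
qed

lemma IG_of_family:
  fixes u :: "nat \<Rightarrow> cvec"
  assumes g: "g \<in> borel n" and c: "card I = k"
    and u: "\<And>i. i \<in> I \<Longrightarrow> u i \<in> odd_space n"
    and f: "inj_on f I" and diag: "\<And>i. i \<in> I \<Longrightarrow> u i (f i) \<noteq> 0"
    and tri: "\<And>i l. i \<in> I \<Longrightarrow> f i < l \<Longrightarrow> u i l = 0"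
    and iso: "\<And>i j. i \<in> I \<Longrightarrow> j \<in> I \<Longrightarrow> omega n (u i) (u j) = 0" and fin: "finite I"
  shows "cvs.span ((\<lambda>i. g (u i)) ` I) \<in> IG n k"
proof -
  note lin = borelD(1)[OF g]
  define w where "w j = u (inv_into I f j)" for j
  have w: "w ` f ` I = u ` I" using f by (force simp: w_def image_image)
  have dim: "cvs.dim (cvs.span (u ` I)) = k"
  proof -
    have "cvs.dim (cvs.span (w ` f ` I)) = card (f ` I)"
      by (rule triangular_family(2)) (use fin diag tri f in \<open>auto simp: w_def\<close>)
    then show ?thesis using w c card_image[OF f] by simp
  qed
  have sub: "cvs.span (u ` I) \<subseteq> odd_space n"
    using u by (intro cvs.span_minimal subspace_odd_space) auto
  have e: "cvs.span ((\<lambda>i. g (u i)) ` I) = g ` cvs.span (u ` I)"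
    using cvp.linear_span_image[OF lin, of "u ` I"] by (simp add: image_image)
  obtain B where B: "B \<subseteq> cvs.span (u ` I)" "cvs.independent B" "cvs.span (u ` I) \<subseteq> cvs.span B" "card B = k"
    using cvs.basis_exists[of "cvs.span (u ` I)"] dim by metis
  have sB: "cvs.span B = cvs.span (u ` I)" using B(1,3) cvs.span_minimal[OF B(1)] by auto
  have inj: "inj_on g (cvs.span B)" using sub sB borelD(2)[OF g] inj_on_subset by metis
  have "cvs.dim (g ` cvs.span B) = card (g ` B)"
    using cvp.linear_span_image[OF lin, of B] cvp.linear_independent_injective_image[OF lin B(2) inj]
      cvs.dim_span_eq_card_independent by metis
  also have "\<dots> = k" using card_image[OF inj_on_subset[OF inj cvs.span_superset]] B(4) by simp
  finally have "cvs.dim (g ` cvs.span (u ` I)) = k" using sB by simp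
  moreover have "omega n x y = 0" if "x \<in> cvs.span (u ` I)" "y \<in> cvs.span (u ` I)" for x y
    by (rule omega_isotropic_span[OF _ that]) (use iso in auto)
  moreover have "cvs.subspace (g ` cvs.span (u ` I))" unfolding e[symmetric] by simp
  ultimately show ?thesis unfolding e using sub borelD(3,4)[OF g] by (auto simp: IG_def subset_iff)
qed

lemma subspace_eqI:
  assumes "cvs.subspace S" "cvs.subspace T" "S \<subseteq> T" "T \<subseteq> odd_space n" "cvs.dim S = cvs.dim T"
  shows "S = T"
proof -
  obtain B where B: "B \<subseteq> S" "cvs.independent B" "S \<subseteq> cvs.span B" "card B = cvs.dim S"
    by (rule cvs.basis_exists)
  obtain D where D: "D \<subseteq> T" "cvs.independent D" "T \<subseteq> cvs.span D" "card D = cvs.dim T"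
    by (rule cvs.basis_exists)
  have fin: "finite B" "finite D" using independent_odd_finite[of _ n] B(1,2) D(1,2) assms(3,4) by blast+
  have "T \<subseteq> cvs.span B"
  proof (rule ccontr)
    assume "\<not> T \<subseteq> cvs.span B"
    then obtain x where x: "x \<in> T" "x \<notin> cvs.span B" by blast
    then have "cvs.independent (insert x B)" using B(2) by (intro cvs.independent_insertI)
    moreover have "insert x B \<subseteq> cvs.span D" using x(1) B(1) assms(3) D(3) by blast
    ultimately have "card (insert x B) \<le> card D" using cvs.independent_span_bound[OF fin(2)] by blast
    moreover have "x \<notin> B" using x(2) cvs.span_base by blast
    ultimately show False using fin(1) B(4) D(4) assms(5) by simp
  qed
  moreover have "cvs.span B \<subseteq> S" using B(1) assms(1) by (rule cvs.span_minimal)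
  ultimately show ?thesis using assms(3) by blast
qed

lemma borel_flag:
  assumes g: "g \<in> borel n" and m: "m \<le> 2*n+1"
  shows "g ` coord_space {1..m} = coord_space {1..m}"
proof (rule subspace_eqI)
  have I: "{1..m} \<subseteq> {1..2*n+1}" using m by auto
  show "cvs.subspace (g ` coord_space {1..m})" unfolding borel_image_coord(1)[OF g I] by simp
  have "g (bvec i) \<in> coord_space {1..m}" if i: "i \<in> {1..m}" for i
  proof -
    have iD: "i \<in> {1..2*n+1}" using i I by blast
    have "g (bvec i) 0 = 0"
      using borelD(3)[OF g, of "bvec i"] iD by (auto simp: odd_space_iff bvec_apply)
    moreover have "g (bvec i) j = 0" if "m < j" for j using borelD(5)[OF g iD, of j] i that by simp
    ultimately show ?thesis by (auto simp: span_bvec not_le)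
  qed
  then show "g ` coord_space {1..m} \<subseteq> coord_space {1..m}"
    unfolding borel_image_coord(1)[OF g I] by (intro cvs.span_minimal) auto
  show "coord_space {1..m} \<subseteq> odd_space n" by (rule coord_space_odd[OF I])
  show "cvs.dim (g ` coord_space {1..m}) = cvs.dim (coord_space {1..m})"
    using borel_image_coord(2)[OF g I] dim_span_bvec(1)[of "{1..m}"] by simp
qed simp

text \<open>The curve maps \<open>t\<close> to the image under \<open>g\<close> of the span of the vectors \<open>bvec i\<close> for \<open>i \<notin> D\<close> and
  \<open>bvec i + t ^ m i * bvec (\<sigma> i)\<close> for \<open>i \<in> D\<close>.\<close>

lemma coordinate_curve:
  assumes g: "g \<in> borel n" and kn: "1 \<le> k" "k \<le> n" and D: "D \<subseteq> {1..k}"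
    and s: "inj_on \<sigma> D" "\<And>i. i \<in> D \<Longrightarrow> k < \<sigma> i \<and> \<sigma> i \<le> 2*n+1"
    and T: "T = ({1..k} - D) \<union> \<sigma> ` D" "\<And>i. i \<in> T \<Longrightarrow> bar n i \<notin> T"
    and cross: "\<And>i j. i \<in> D \<Longrightarrow> j \<in> D \<Longrightarrow> i \<noteq> j \<Longrightarrow> \<sigma> j \<noteq> bar n i"
    and m: "\<And>i. i \<in> {1..k} \<Longrightarrow> m i = 0 \<longleftrightarrow> i \<notin> D"
  obtains f where "is_morphism n k (\<Sum>i\<in>{1..k}. m i) f" "f (Some 0) = coord_space {1..k}"
    "f None = g ` coord_space T"
proof -
  note lin = borelD(1)[OF g]
  let ?K = "{1..k}"
  define v where "v i = (if i \<in> D then bvec (\<sigma> i) else 0)" for i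
  define p where "p b = g (bvec (b + 1))" for b
  define q where "q b = g (v (b + 1))" for b
  let ?m = "\<lambda>b. m (b + 1)"
  have im: "(\<lambda>b. F (b + 1)) ` {..<k} = F ` ?K" for F :: "nat \<Rightarrow> cvec"
  proof -
    have "(\<lambda>b. b + 1) ` {..<k} = ?K" by (simp add: image_Suc_lessThan)
    then show ?thesis by (metis image_image)
  qed
  have "\<sigma> i \<in> {1..2*n+1}" if "i \<in> D" for i using s(2)[OF that] by simp
  then have TD: "T \<subseteq> {1..2*n+1}" unfolding T(1) using kn by auto
  have cardT: "card T = k"
  proof -
    have fD: "finite D" using D finite_subset by blast
    have "({1..k} - D) \<inter> \<sigma> ` D = {}" using s(2) by fastforce
    then have "card T = card ({1..k} - D) + card (\<sigma> ` D)" unfolding T(1) using fD by (intro card_Un_disjoint) auto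
    also have "\<dots> = card ?K - card D + card D" using card_Diff_subset[OF fD D] card_image[OF s(1)] by simp
    finally show ?thesis using card_mono[OF _ D] by simp
  qed
  have admT: "adm n k T" using TD cardT T(2) by (auto simp: adm_def)
  have family: "cvs.span ((\<lambda>b. p b + cscale (t ^ ?m b) (q b)) ` {..<k}) \<in> IG n k" for t
  proof -
    let ?u = "\<lambda>i. bvec i + cscale (t ^ m i) (v i)"
    have e: "(\<lambda>b. p b + cscale (t ^ ?m b) (q b)) ` {..<k} = (\<lambda>i. g (?u i)) ` ?K"
      using im[of "\<lambda>i. g (bvec i) + cscale (t ^ m i) (g (v i))"]
      by (simp add: p_def q_def cvp.linear_add[OF lin] cvp.linear_scale[OF lin])
    have vi: "v i = bvec (\<sigma> i)" "k < \<sigma> i" "\<sigma> i \<le> 2*n+1" "\<sigma> i \<in> T" "m i \<noteq> 0" if "i \<in> D" for i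
    proof -
      have "i \<in> ?K" using that D by blast
      then show "m i \<noteq> 0" using m that by blast
    qed (use that s(2) T(1) in \<open>auto simp: v_def\<close>)
    \<comment> \<open>The pivot jumps: for \<open>t \<noteq> 0\<close> a moving vector ends at
      \<open>\<sigma> i\<close>, for \<open>t = 0\<close> at \<open>i\<close>.\<close>
    define f where "f i = (if i \<in> D \<and> t \<noteq> 0 then \<sigma> i else i)" for i
    have zo: "omega n (bvec i) (bvec j) = 0" if "i \<in> ?K" "j \<noteq> bar n i" for i j
      using that kn by (simp add: omega_bvec)
    have zK: "omega n (bvec i) (bvec j) = 0" if "i \<in> ?K" "j \<in> ?K" for i j
      using zo[OF that(1), of j] that kn by (auto simp: bar_def)
    have zT: "omega n (bvec i) (bvec j) = 0" if "i \<in> T" "j \<in> T" for i j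
    proof -
      have "i \<in> {1..2*n+1}" using that TD by blast
      moreover have "j \<noteq> bar n i" using T(2) that by auto
      ultimately show ?thesis by (simp add: omega_bvec)
    qed
    \<comment> \<open>A vector may be displaced towards its own partner, as the form is alternating.
      Distinct moving vectors are separated by \<open>cross\<close>, and fixed indices belong to the
      isotropic set \<open>T\<close>.\<close>
    have zs: "omega n (bvec i) (v j) = 0" if "i \<in> ?K" "j \<in> ?K" "i \<noteq> j" for i j
    proof (cases "j \<in> D")
      case True
      show ?thesis
      proof (cases "i \<in> D")
        case True
        then show ?thesis using zo[OF that(1), of "\<sigma> j"] cross[OF True \<open>j \<in> D\<close> that(3)] vi[OF \<open>j \<in> D\<close>] by simp
      next
        case False
        then have "i \<in> T" using that T(1) by blast
        then show ?thesis using zT[of i "\<sigma> j"] vi[OF \<open>j \<in> D\<close>] by simp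
      qed
    qed (simp add: v_def)
    have zs': "omega n (v j) (bvec i) = 0" if "i \<in> ?K" "j \<in> ?K" "i \<noteq> j" for i j
      using zs[OF that] by (subst omega_swap) simp
    have zv: "omega n (v i) (v j) = 0" for i j
    proof (cases "i \<in> D \<and> j \<in> D")
      case True
      then show ?thesis using zT[of "\<sigma> i" "\<sigma> j"] vi by auto
    qed (auto simp: v_def)
    show ?thesis unfolding e
    proof (rule IG_of_family[OF g, where f = f])
      show "inj_on f ?K"
      proof (rule inj_onI)
        fix i j assume ij: "i \<in> ?K" "j \<in> ?K" "f i = f j"
        then show "i = j" using vi[of i] vi[of j] inj_onD[OF s(1), of i j] by (auto simp: f_def split: if_splits)
      qed
      show "?u i \<in> odd_space n" if "i \<in> ?K" for i
        using that kn vi[of i] by (cases "i \<in> D") (auto simp: odd_space_iff bvec_apply v_def)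
      show "?u i (f i) \<noteq> 0" if "i \<in> ?K" for i
        using that vi[of i] by (cases "i \<in> D") (auto simp: f_def bvec_apply v_def)
      show "?u i l = 0" if "i \<in> ?K" "f i < l" for i l
        using that vi[of i] by (cases "i \<in> D"; cases "t = 0") (auto simp: f_def bvec_apply v_def)
      show "omega n (?u i) (?u j) = 0" if "i \<in> ?K" "j \<in> ?K" for i j
      proof (cases "i = j")
        case False
        then show ?thesis using zK[OF that] zs[OF that False] zs'[of j i] zv[of i j] that
          by (simp add: omega_add_left omega_add_right omega_scale_left omega_scale_right)
      qed simp
    qed auto
  qed
  have inf: "cvs.span ((\<lambda>b. if ?m b = 0 then p b else q b) ` {..<k}) = g ` coord_space T"
  proof -
    have "(\<lambda>b. if ?m b = 0 then p b else q b) ` {..<k} = (\<lambda>i. if m i = 0 then g (bvec i) else g (v i)) ` ?K"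
      using im[of "\<lambda>i. if m i = 0 then g (bvec i) else g (v i)"] by (simp add: p_def q_def)
    also have "\<dots> = (\<lambda>i. g (bvec (if i \<in> D then \<sigma> i else i))) ` ?K"
      by (rule image_cong) (use m in \<open>auto simp: v_def\<close>)
    also have "\<dots> = (\<lambda>i. g (bvec i)) ` T"
    proof -
      have "(\<lambda>i. if i \<in> D then \<sigma> i else i) ` ((?K - D) \<union> D) = (?K - D) \<union> \<sigma> ` D"
        unfolding image_Un by (intro arg_cong2[of _ _ _ _ "(\<union>)"]) auto
      moreover have "(?K - D) \<union> D = ?K" using D by blast
      ultimately have "T = (\<lambda>i. if i \<in> D then \<sigma> i else i) ` ?K" by (simp only: T(1))
      then show ?thesis by (simp only: image_image)
    qed
    finally show ?thesis using borel_image_coord(1)[OF g TD] by simp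
  qed
  define f where "f x = (case x of Some t \<Rightarrow> cvs.span ((\<lambda>b. p b + cscale (t ^ ?m b) (q b)) ` {..<k})
       | None \<Rightarrow> cvs.span ((\<lambda>b. if ?m b = 0 then p b else q b) ` {..<k}))" for x
  have "is_morphism n k (\<Sum>b<k. ?m b) f"
    unfolding f_def
  proof (rule morphism_of_frames)
    show "q b = 0" if "b < k" "?m b = 0" for b
      using m[of "b + 1"] that cvp.linear_0[OF lin] by (simp add: q_def v_def)
  qed (use family inf borel_image_IG[OF g admT] in simp_all)
  moreover have "(\<Sum>b<k. ?m b) = (\<Sum>i\<in>?K. m i)"
    using sum.reindex[of "\<lambda>b. b + 1" "{..<k}" m] by (simp add: image_Suc_lessThan)
  moreover have "f (Some 0) = coord_space ?K"
  proof -
    have z: "cscale (0 ^ ?m b) (q b) = 0" if "b < k" for b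
      using m[of "b + 1"] that cvp.linear_0[OF lin] by (cases "?m b") (auto simp: q_def v_def)
    have "(\<lambda>b. p b + cscale (0 ^ ?m b) (q b)) ` {..<k} = p ` {..<k}" by (rule image_cong) (use z in auto)
    also have "\<dots> = (\<lambda>i. g (bvec i)) ` ?K" using im[of "\<lambda>i. g (bvec i)"] by (simp add: p_def)
    finally show ?thesis
      using borel_image_coord(1)[OF g, of ?K] borel_flag[OF g, of k] kn by (simp add: f_def)
  qed
  ultimately show thesis using that[of f] inf by (simp add: f_def)
qed

section \<open>Stable maps through a given pair of points\<close>

lemma nbhd_one_component:
  assumes f: "is_morphism n k d f" and d: "1 \<le> d" and xy: "x \<noteq> y" and O: "f x \<in> \<Omega>"
  shows "f y \<in> curve_nbhd n k d \<Omega>"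
proof -
  define C where "C = \<lparr>comps = {0}, nodes = {}, branch = (\<lambda>_ _. x), mark_comp = (\<lambda>_. 0),
    mark_pt = (\<lambda>i. if i = 1 then x else y), comp_map = (\<lambda>_. f), comp_deg = (\<lambda>_. d)\<rparr>"
  have "C \<in> stable_maps n k d"
    using f d xy by (auto simp: C_def stable_maps_def is_pointed_curve_def is_tree_def node_pts_def inj_on_def)
  moreover have "ev 1 C = f x" "ev 2 C = f y" by (auto simp: C_def ev_def)
  ultimately show ?thesis using O unfolding curve_nbhd_def by (intro image_eqI[of _ _ C]) auto
qed

lemma constant_morphism:
  assumes "V \<in> IG n k"
  shows "is_morphism n k 0 (\<lambda>_. V)"
proof -
  obtain I g where I: "adm n k I" and g: "g \<in> borel n" "\<And>i. i \<in> {1..2*n+1} \<Longrightarrow> g (bvec i) i = 1"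
    and V: "V = g ` coord_space I"
    by (rule bruhat_decomposition[OF assms]) (rule that)
  then obtain vs where vs: "is_frame k V vs" using map_sorted_frame[OF g(1)] by (auto simp: adm_def)
  have "(\<lambda>I. form_eval 0 [:pluecker n k vs I:] x) \<in> pluecker_coords n k V" for x
    using vs by (cases x) (auto simp: form_eval_def pluecker_coords_def)
  then show ?thesis using assms by (auto simp: is_morphism_def intro!: exI[of _ "\<lambda>I. [:pluecker n k vs I:]"])
qed

text \<open>The marked points must be distinct but have the same image. They are put on a contracted
  component, which is stable thanks to its node as third special point; the other component carries
  the degree \<open>d\<close>.\<close>

lemma nbhd_contracted_component:
  assumes f: "is_morphism n k d f" and d: "1 \<le> d" and O: "f x \<in> \<Omega>"
  shows "f x \<in> curve_nbhd n k d \<Omega>"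
proof -
  define C where "C = \<lparr>comps = {0, 1}, nodes = {{0, 1}}, branch = (\<lambda>u _. if u = 0 then None else x),
    mark_comp = (\<lambda>_. 0), mark_pt = (\<lambda>i. if i = 1 then Some 0 else Some 1),
    comp_map = (\<lambda>u. if u = 0 then (\<lambda>_. f x) else f), comp_deg = (\<lambda>u. if u = 0 then 0 else d)\<rparr>"
  have IG: "f x \<in> IG n k" using f by (auto simp: is_morphism_def)
  have np: "node_pts C 0 = {None}" by (auto simp: C_def node_pts_def doubleton_eq_iff)
  have mp: "marked_pts C 0 = {Some 0, Some 1}" "marked_pts C 1 = {}"
  proof -
    have "marked_pts C u = mark_pt C ` {i \<in> {1, 2}. mark_comp C i = u}" for u
      by (auto simp: marked_pts_def)
    moreover have "{i \<in> {1, 2}. mark_comp C i = 0} = {1, 2}" "{i \<in> {1, 2}. mark_comp C i = 1} = {}"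
      by (auto simp: C_def)
    moreover have "mark_pt C 1 = Some 0" "mark_pt C 2 = Some 1" by (simp_all add: C_def)
    ultimately show "marked_pts C 0 = {Some 0, Some 1}" "marked_pts C 1 = {}"
      by (simp_all only: image_insert image_empty)
  qed
  have tree: "is_tree (comps C) (nodes C)"
    unfolding is_tree_def
  proof (intro conjI ballI)
    fix u v assume "u \<in> comps C" "v \<in> comps C"
    then show "(u, v) \<in> {(a, b). {a, b} \<in> nodes C}\<^sup>*"
      by (cases "u = v") (auto simp: C_def insert_commute intro!: r_into_rtrancl)
  qed (auto simp: C_def)
  have "is_pointed_curve C"
    unfolding is_pointed_curve_def using tree np mp
    by (auto simp: C_def inj_on_def doubleton_eq_iff)
  moreover have "3 \<le> card (node_pts C 0 \<union> marked_pts C 0)" by (simp add: np mp)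
  ultimately have "C \<in> stable_maps n k d"
    using f d constant_morphism[OF IG] by (auto simp: stable_maps_def C_def doubleton_eq_iff)
  moreover have "ev 1 C = f x" "ev 2 C = f x" by (auto simp: C_def ev_def)
  ultimately show ?thesis using O unfolding curve_nbhd_def by (intro image_eqI[of _ _ C]) auto
qed

text \<open>An index leaving \<open>{1..k}\<close> whose partner belongs to \<open>I\<close> is sent
  to this partner, and the rest is matched arbitrarily. Thus no vector is displaced towards the
  partner of a different moving one.\<close>

lemma replacement_exists:
  assumes I: "adm n k I" and kn: "1 \<le> k" "k \<le> n"
  obtains \<sigma> where "bij_betw \<sigma> ({1..k} - I) (I - {1..k})"
    "\<And>i. i \<in> {1..k} - I \<Longrightarrow> bar n i \<in> I \<Longrightarrow> \<sigma> i = bar n i"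
proof -
  have I': "I \<subseteq> {1..2*n+1}" "card I = k" "finite I" using I finite_subset by (auto simp: adm_def)
  let ?D = "{1..k} - I" and ?N = "I - {1..k}"
  define P where "P = {i \<in> ?D. bar n i \<in> I}"
  have P: "P \<subseteq> ?D" "bar n ` P \<subseteq> ?N" using kn by (auto simp: P_def bar_def)
  have injP: "inj_on (bar n) P" using kn by (auto simp: P_def inj_on_def bar_def)
  have "card ?D = card ?N"
    using card_Diff_subset_Int[of "{1..k}" I] card_Diff_subset_Int[of I "{1..k}"] I'(2,3)
    by (simp add: Int_commute)
  then have "card (?D - P) = card (?N - bar n ` P)"
    using P card_image[OF injP] I'(3) finite_subset[OF P(1)] finite_subset[OF P(2)]
    by (simp add: card_Diff_subset)
  then obtain h where h: "bij_betw h (?D - P) (?N - bar n ` P)"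
    using finite_same_card_bij[of "?D - P" "?N - bar n ` P"] I'(3) by auto
  define \<sigma> where "\<sigma> i = (if i \<in> P then bar n i else h i)" for i
  have "bij_betw \<sigma> (P \<union> (?D - P)) (bar n ` P \<union> (?N - bar n ` P))"
  proof (rule bij_betw_combine)
    show "bij_betw \<sigma> P (bar n ` P)" using injP by (auto simp: bij_betw_def \<sigma>_def inj_on_def)
    show "bij_betw \<sigma> (?D - P) (?N - bar n ` P)"
      by (rule bij_betw_cong[THEN iffD1, OF _ h]) (simp add: \<sigma>_def)
  qed auto
  moreover have "P \<union> (?D - P) = ?D" "bar n ` P \<union> (?N - bar n ` P) = ?N" using P by blast+
  ultimately have "bij_betw \<sigma> ?D ?N" by simp
  moreover have "\<sigma> i = bar n i" if "i \<in> ?D" "bar n i \<in> I" for i using that by (simp add: \<sigma>_def P_def)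
  ultimately show thesis using that by blast
qed

lemma rank_locus_in_nbhd:
  assumes kn: "1 \<le> k" "k \<le> n" and d: "1 \<le> d" and V: "V \<in> rank_locus n k k (k - d)"
  shows "V \<in> curve_nbhd n k d {coord_space {1..k}}"
proof -
  have "V \<in> IG n k" using V by (simp add: rank_locus_def)
  then obtain I g where I: "adm n k I" and g: "g \<in> borel n" "\<And>i. i \<in> {1..2*n+1} \<Longrightarrow> g (bvec i) i = 1"
    and Vg: "V = g ` coord_space I"
    by (rule bruhat_decomposition) (rule that)
  have I': "I \<subseteq> {1..2*n+1}" "card I = k" "finite I" "\<And>i. i \<in> I \<Longrightarrow> bar n i \<notin> I"
    using I finite_subset by (auto simp: adm_def)
  have c: "k - d \<le> card (I \<inter> {1..k})" using rank_locus_card[OF g(1) I g(2)] V Vg by simp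
  let ?D = "{1..k} - I"
  show ?thesis
  proof (cases "?D = {}")
    case True
    then have "{1..k} = I" using card_subset_eq[of I "{1..k}"] I' by auto
    then have VK: "V = coord_space {1..k}" using Vg borel_flag[OF g(1), of k] kn by simp
    \<comment> \<open>Any curve of degree \<open>d\<close> through the point serves; here the last
      basis vector moves as \<open>bvec k + t ^ d * bvec (k + 1)\<close>.\<close>
    obtain f where f: "is_morphism n k (\<Sum>i\<in>{1..k}. if i = k then d else 0) f"
      "f (Some 0) = coord_space {1..k}"
    proof (rule coordinate_curve[OF id_borel kn, where D = "{k}" and \<sigma> = "\<lambda>_. k + 1"
          and T = "({1..k} - {k}) \<union> {k + 1}" and m = "\<lambda>i. if i = k then d else 0"])
      show "bar n i \<notin> ({1..k} - {k}) \<union> {k + 1}" if "i \<in> ({1..k} - {k}) \<union> {k + 1}" for i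
        using that kn by (auto simp: bar_def)
    qed (use kn d in \<open>auto simp: inj_on_def\<close>)
    have "is_morphism n k d f" using f(1) kn by simp
    then show ?thesis using nbhd_contracted_component[of n k d f "Some 0"] d f(2) VK by simp
  next
    case False
    then obtain i0 where i0: "i0 \<in> ?D" by blast
    obtain \<sigma> where s: "bij_betw \<sigma> ?D (I - {1..k})" "\<And>i. i \<in> ?D \<Longrightarrow> bar n i \<in> I \<Longrightarrow> \<sigma> i = bar n i"
      by (rule replacement_exists[OF I kn]) (rule that)
    \<comment> \<open>The degree must be exactly \<open>d\<close>: all exponents are 1 except at
      \<open>i0\<close>, which absorbs the surplus \<open>d - card ?D\<close>.\<close>
    define m where "m i = (if i \<in> ?D then (if i = i0 then d + 1 - card ?D else 1) else 0)" for i
    have cD: "card ?D \<le> d" "1 \<le> card ?D"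
    proof -
      have "card ?D = k - card (I \<inter> {1..k})"
        using card_Diff_subset_Int[of "{1..k}" I] by (simp add: Int_commute)
      then show "card ?D \<le> d" using c by linarith
      have "0 < card ?D" unfolding card_gt_0_iff using False by simp
      then show "1 \<le> card ?D" by simp
    qed
    have sm: "(\<Sum>i\<in>{1..k}. m i) = d"
    proof -
      have "(\<Sum>i\<in>{1..k}. m i) = (\<Sum>i\<in>?D. if i = i0 then d + 1 - card ?D else 1)"
        by (rule sum.mono_neutral_cong_right) (auto simp: m_def)
      also have "\<dots> = (d + 1 - card ?D) + (\<Sum>i\<in>?D - {i0}. 1)"
        using i0 by (subst sum.remove[of _ i0]) auto
      also have "\<dots> = d" using i0 cD by (simp add: card_Diff_singleton)
      finally show ?thesis .
    qed
    have sN: "\<sigma> i \<in> I - {1..k}" if "i \<in> ?D" for i using s(1) that by (auto simp: bij_betw_def)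
    obtain f where f: "is_morphism n k (\<Sum>i\<in>{1..k}. m i) f" "f (Some 0) = coord_space {1..k}"
      "f None = g ` coord_space I"
    proof (rule coordinate_curve[OF g(1) kn, where D = ?D and \<sigma> = \<sigma> and T = I and m = m])
      show "inj_on \<sigma> ?D" using s(1) by (simp add: bij_betw_def)
      show "k < \<sigma> i \<and> \<sigma> i \<le> 2*n+1" if "i \<in> ?D" for i using sN[OF that] I'(1) by auto
      show "I = ({1..k} - ?D) \<union> \<sigma> ` ?D" using s(1) by (auto simp: bij_betw_def)
      show "\<sigma> j \<noteq> bar n i" if "i \<in> ?D" "j \<in> ?D" "i \<noteq> j" for i j
      proof
        assume a: "\<sigma> j = bar n i"
        then have "\<sigma> i = bar n i" using sN[OF that(2)] s(2)[OF that(1)] by auto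
        then show False using a that s(1) by (auto simp: bij_betw_def inj_on_def)
      qed
      show "m i = 0 \<longleftrightarrow> i \<notin> ?D" if "i \<in> {1..k}" for i using cD by (auto simp: m_def)
    qed (use I'(4) in auto)
    then show ?thesis
      using nbhd_one_component[of n k d f "Some 0" None "{coord_space {1..k}}"] sm d Vg by simp
  qed
qed

lemma near_rank_locus:
  assumes kn: "k \<le> n" and V: "V \<in> IG n k" and near: "near k d (coord_space {1..k}) V"
  shows "V \<in> rank_locus n k k (k - d)"
proof -
  obtain I g where I: "adm n k I" and g: "g \<in> borel n" "\<And>i. i \<in> {1..2*n+1} \<Longrightarrow> g (bvec i) i = 1"
    and Vg: "V = g ` coord_space I"
    by (rule bruhat_decomposition[OF V]) (rule that)
  have I': "I \<subseteq> {1..2*n+1}" "finite I" using I finite_subset by (auto simp: adm_def)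
  obtain B where B: "finite B" "cvs.independent B" "B \<subseteq> coord_space {1..k} \<inter> V" "k \<le> card B + d"
    using near by (auto simp: near_def)
  have fl: "coord_space {1..k} = g ` coord_space {1..k}" using borel_flag[OF g(1), of k] kn by simp
  have K: "{1..k} \<subseteq> {1..2*n+1}" using kn by auto
  \<comment> \<open>The Borel element preserves the flag, so the intersection is the image of an
    intersection of coordinate subspaces.\<close>
  have "coord_space {1..k} \<inter> V \<subseteq> g ` (coord_space {1..k} \<inter> coord_space I)"
    unfolding Vg using fl inj_on_image_Int[OF borelD(2)[OF g(1)] coord_space_odd[OF K] coord_space_odd[OF I'(1)]]
    by simp
  also have "coord_space {1..k} \<inter> coord_space I = coord_space (I \<inter> {1..k})"
    using I'(2) by (auto simp: span_bvec)
  also have "g ` coord_space (I \<inter> {1..k}) = cvs.span ((\<lambda>i. g (bvec i)) ` (I \<inter> {1..k}))"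
    using I'(1) by (intro borel_image_coord(1)[OF g(1)]) auto
  finally have "B \<subseteq> cvs.span ((\<lambda>i. g (bvec i)) ` (I \<inter> {1..k}))" using B(3) by blast
  then have "card B \<le> card ((\<lambda>i. g (bvec i)) ` (I \<inter> {1..k}))"
    using cvs.independent_span_bound[OF _ B(2)] by simp
  also have "\<dots> \<le> card (I \<inter> {1..k})" by (rule card_image_le) simp
  finally have "k - d \<le> card (I \<inter> {1..k})" using B(4) by linarith
  then show ?thesis unfolding Vg by (rule borel_image_rank_locus[OF g(1) I])
qed

lemma curve_nbhd_point:
  assumes kn: "1 \<le> k" "k \<le> n" and d: "1 \<le> d"
  shows "curve_nbhd n k d {coord_space {1..k}} = rank_locus n k k (k - d)"
proof (intro subset_antisym subsetI)
  fix V assume "V \<in> curve_nbhd n k d {coord_space {1..k}}"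
  then obtain C where C: "C \<in> stable_maps n k d" "ev 1 C = coord_space {1..k}" "V = ev 2 C"
    by (auto simp: curve_nbhd_def)
  have "mark_comp C 2 \<in> comps C" "\<forall>u\<in>comps C. is_morphism n k (comp_deg C u) (comp_map C u)"
    using C(1) by (auto simp: stable_maps_def is_pointed_curve_def)
  then have "V \<in> IG n k" unfolding C(3) ev_def is_morphism_def by blast
  then show "V \<in> rank_locus n k k (k - d)"
    using near_rank_locus[OF kn(2)] stable_map_near[OF C(1)] C(2,3) by simp
qed (rule rank_locus_in_nbhd[OF kn d])

section \<open>The Hecke product\<close>

abbreviation iv :: "(nat \<Rightarrow> nat) \<Rightarrow> nat \<Rightarrow> nat" where "iv w \<equiv> inv_into UNIV w"

text \<open>For the last letter \<open>i + 1\<close> is \<open>n + 2\<close>, the partner of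
  \<open>n + 1\<close>; the same comparison thus covers all simple reflections.\<close>

abbreviation asc :: "(nat \<Rightarrow> nat) \<Rightarrow> nat \<Rightarrow> bool" where
  "asc w i \<equiv> w i < w (i + 1)"

lemma bar_Suc_less: "1 \<le> i \<Longrightarrow> i \<le> n + 1 \<Longrightarrow> bar n (i + 1) < bar n i"
  by (auto simp: bar_def)

lemma weylD:
  assumes "w \<in> weyl n"
  shows "w permutes {1..2*n+2}" "i \<in> {1..2*n+2} \<Longrightarrow> w (bar n i) = bar n (w i)"
    "i \<in> {1..2*n+2} \<Longrightarrow> w i \<in> {1..2*n+2}" "inj w"
  using assms permutes_in_image[of w "{1..2*n+2}" i] permutes_inj[of w] by (auto simp: weyl_def)

lemma weyl_id: "id \<in> weyl n"
  by (auto simp: weyl_def permutes_id)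

lemma weyl_comp:
  assumes v: "v \<in> weyl n" and w: "w \<in> weyl n"
  shows "v \<circ> w \<in> weyl n"
  using permutes_compose[OF weylD(1)[OF w] weylD(1)[OF v]] weylD(2,3)[OF v] weylD(2,3)[OF w]
  by (auto simp: weyl_def)

lemma weyl_inv:
  assumes w: "w \<in> weyl n"
  shows "iv w \<in> weyl n"
proof -
  note p = weylD(1)[OF w]
  have "iv w (bar n i) = bar n (iv w i)" if i: "i \<in> {1..2*n+2}" for i
  proof -
    have j: "iv w i \<in> {1..2*n+2}" using permutes_in_image[OF permutes_inv[OF p]] i by blast
    have "w (bar n (iv w i)) = bar n i" using weylD(2)[OF w j] permutes_inverses(1)[OF p] by simp
    then show ?thesis using permutes_inverses(2)[OF p] by metis
  qed
  then show ?thesis using permutes_inv[OF p] by (auto simp: weyl_def)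
qed

lemma srefl_apply:
  assumes "i \<in> {1..n}"
  obtains b where "i + 1 < b" "bar n i = b + 1" "bar n (i + 1) = b"
    "\<And>x. srefl n i x = (if x = i then i + 1 else if x = i + 1 then i else if x = b + 1 then b
       else if x = b then b + 1 else x)"
proof -
  define b where "b = bar n (i + 1)"
  have b: "i + 1 < b" "bar n i = b + 1" using assms by (auto simp: b_def bar_def)
  have "srefl n i = Transposition.transpose i (i + 1) \<circ> Transposition.transpose (b + 1) b"
    using assms b(2) by (simp add: srefl_def b_def)
  then have "srefl n i x = (if x = i then i + 1 else if x = i + 1 then i else if x = b + 1 then b
       else if x = b then b + 1 else x)" for x
    using b(1) by (simp add: Transposition.transpose_def)
  then show thesis using that b b_def by blast
qed

lemma srefl_last: "srefl n (n + 1) x = (if x = n + 1 then n + 2 else if x = n + 2 then n + 1 else x)"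
  by (simp add: srefl_def Transposition.transpose_def bar_def)

lemma srefl_invol:
  assumes "i \<in> {1..n+1}"
  shows "srefl n i \<circ> srefl n i = id"
proof (cases "i = n + 1")
  case True
  then show ?thesis by (auto simp: fun_eq_iff srefl_last[simplified])
next
  case False
  then have "i \<in> {1..n}" using assms by auto
  then obtain b where "i + 1 < b" "bar n i = b + 1" "bar n (i + 1) = b"
    "\<And>x. srefl n i x = (if x = i then i + 1 else if x = i + 1 then i else if x = b + 1 then b
      else if x = b then b + 1 else x)"
    by (rule srefl_apply) (rule that)
  then show ?thesis by (auto simp: fun_eq_iff)
qed

lemma srefl_at: "i \<in> {1..n+1} \<Longrightarrow> srefl n i i = i + 1" "i \<in> {1..n+1} \<Longrightarrow> srefl n i (i + 1) = i"
  by (auto simp: srefl_def Transposition.transpose_def bar_def)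

lemma srefl_comp_cancel:
  assumes "i \<in> {1..n+1}"
  shows "w \<circ> srefl n i \<circ> srefl n i = w" "srefl n i \<circ> (srefl n i \<circ> w) = w"
  using srefl_invol[OF assms] by (metis comp_assoc comp_id id_comp)+

lemma srefl_inv: "i \<in> {1..n+1} \<Longrightarrow> iv (srefl n i) = srefl n i"
  by (rule inv_unique_comp) (simp_all add: srefl_invol)

text \<open>A simple reflection moves every value by at most one, so it can reverse only the
  adjacent pair \<open>i\<close>, \<open>i + 1\<close> and its mirror image under
  \<open>bar n\<close>.\<close>

lemma srefl_mono_or_pair:
  assumes "i \<in> {1..n+1}" "a < b'" "\<not> srefl n i a < srefl n i b'"
  shows "a = i \<and> b' = i + 1 \<or> a = bar n (i + 1) \<and> b' = bar n i"
proof (cases "i = n + 1")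
  case True
  then show ?thesis using assms by (auto simp: srefl_last[simplified] bar_def split: if_splits)
next
  case False
  then have "i \<in> {1..n}" using assms by auto
  then obtain b where "i + 1 < b" "bar n i = b + 1" "bar n (i + 1) = b"
    "\<And>x. srefl n i x = (if x = i then i + 1 else if x = i + 1 then i else if x = b + 1 then b
      else if x = b then b + 1 else x)"
    by (rule srefl_apply) (rule that)
  note b = this
  have up: "x = i \<or> x = b" if "srefl n i x = x + 1" for x
  proof (rule ccontr)
    assume "\<not> (x = i \<or> x = b)"
    then have "srefl n i x \<le> x" unfolding b(4) by simp
    then show False using that by simp
  qed
  have near: "srefl n i x \<le> x + 1" "x \<le> srefl n i x + 1" for x
    unfolding b(4) by auto
  have ne: "srefl n i a \<noteq> srefl n i b'" if "a \<noteq> b'" for a b'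
    using that srefl_invol[OF assms(1)] by (metis comp_apply id_apply)
  have lt: "srefl n i b' < srefl n i a" using assms(2,3) ne[of a b'] by linarith
  have "srefl n i a = a + 1 \<and> b' = a + 1"
    using near[of a] near[of b'] lt assms(2) by linarith
  then show ?thesis using up[of a] b(2,3) by auto
qed

lemma comp_transpose: "inj w \<Longrightarrow> w \<circ> Transposition.transpose a b = Transposition.transpose (w a) (w b) \<circ> w"
  by (auto simp: fun_eq_iff Transposition.transpose_def inj_eq)

text \<open>Conjugating \<open>srefl n j\<close> by \<open>w\<close> exchanges the images of
  \<open>j\<close> and \<open>j + 1\<close> as well as those of their partners, since
  \<open>w\<close> commutes with \<open>bar n\<close>.\<close>

lemma srefl_conj:
  assumes w: "w \<in> weyl n" and i: "i \<in> {1..n+1}" and j: "j \<in> {1..n+1}"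
    and p: "w j = i \<and> w (j + 1) = i + 1 \<or> w j = bar n (i + 1) \<and> w (j + 1) = bar n i"
  shows "w \<circ> srefl n j = srefl n i \<circ> w"
proof -
  note inj = weylD(4)[OF w]
  have wb: "w (bar n l) = bar n (w l)" if "l \<in> {1..2*n+2}" for l using weylD(2)[OF w that] .
  show ?thesis
  proof (cases "j = n + 1")
    case True
    have "w (n + 2) = bar n (w (n + 1))" using wb[of "n+1"] by (simp add: bar_def)
    then have "i = n + 1" using p i True by (auto simp: bar_def)
    moreover have "w (bar n (n+1)) = bar n (w (n+1))" using wb[of "n+1"] by simp
    ultimately show ?thesis using p True inj
      by (auto simp: srefl_def comp_transpose bar_def Transposition.transpose_commute)
  next
    case False
    then have j': "j \<le> n" "j \<in> {1..2*n+2}" "j + 1 \<in> {1..2*n+2}" using j by auto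
    \<comment> \<open>The reflection \<open>n + 1\<close> swaps two partners, and \<open>j\<close>,
      \<open>j + 1\<close> are not partners for \<open>j \<le> n\<close>.\<close>
    have "i \<noteq> n + 1"
    proof
      assume "i = n + 1"
      then have "w (j + 1) = bar n (w j)" using p by (auto simp: bar_def)
      then have "w (j + 1) = w (bar n j)" using wb j' by simp
      then have "j + 1 = bar n j" using inj by (simp add: inj_eq)
      then show False using j' by (simp add: bar_def)
    qed
    then have i': "i \<le> n" using i by auto
    have bb: "bar n (bar n i) = i" "bar n (bar n (i+1)) = i + 1" using i i' by (auto simp: bar_def)
    have comm: "Transposition.transpose i (i+1) \<circ> Transposition.transpose (bar n i) (bar n (i+1)) =
        Transposition.transpose (bar n i) (bar n (i+1)) \<circ> Transposition.transpose i (i+1)"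
    proof -
      have "i + 1 < bar n (i + 1)" "i + 1 < bar n i" "i \<noteq> bar n (i + 1)" using i i' by (auto simp: bar_def)
      then show ?thesis by (auto simp: fun_eq_iff Transposition.transpose_def)
    qed
    have "w \<circ> srefl n j = (w \<circ> Transposition.transpose j (j+1)) \<circ>
        Transposition.transpose (bar n j) (bar n (j+1))"
      using False by (simp add: srefl_def comp_assoc)
    also have "\<dots> = Transposition.transpose (w j) (w (j+1)) \<circ>
        (w \<circ> Transposition.transpose (bar n j) (bar n (j+1)))"
      by (simp only: comp_transpose[OF inj] comp_assoc)
    also have "\<dots> = Transposition.transpose (w j) (w (j+1)) \<circ>
        (Transposition.transpose (bar n (w j)) (bar n (w (j+1))) \<circ> w)"
      by (simp only: comp_transpose[OF inj] wb[OF j'(2)] wb[OF j'(3)])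
    also have "\<dots> = srefl n i \<circ> w"
      using p
    proof (elim disjE)
      assume "w j = bar n (i + 1) \<and> w (j + 1) = bar n i"
      then show ?thesis using \<open>i \<noteq> n + 1\<close> bb comm
        by (simp add: srefl_def Transposition.transpose_commute comp_assoc[symmetric])
    qed (use \<open>i \<noteq> n + 1\<close> in \<open>simp add: srefl_def comp_assoc\<close>)
    finally show ?thesis .
  qed
qed

section \<open>Words, the exchange property and lengths\<close>

lemma word_prod_Cons [simp]: "word_prod n (i # is) = srefl n i \<circ> word_prod n is"
  by (simp add: word_prod_def)

lemma word_prod_Nil [simp]: "word_prod n [] = id"
  by (simp add: word_prod_def)

lemma word_prod_append: "word_prod n (xs @ ys) = word_prod n xs \<circ> word_prod n ys"
  by (induction xs) (auto simp: comp_assoc)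

lemma word_prod_weyl: "set is \<subseteq> {1..n+1} \<Longrightarrow> word_prod n is \<in> weyl n"
  by (induction "is") (auto simp: weyl_id intro!: weyl_comp srefl_in_weyl)

text \<open>\<open>srefl n i\<close> reverses only two pairs of values. If the pair in the positions
  \<open>j\<close>, \<open>j + 1\<close> is one of them, multiplication by \<open>srefl n i\<close>
  from the left and by \<open>srefl n j\<close> from the right coincide.\<close>

lemma desc_conj:
  assumes w: "w \<in> weyl n" and i: "i \<in> {1..n+1}" and j: "j \<in> {1..n+1}"
    and "asc w j" "\<not> asc (srefl n i \<circ> w) j"
  shows "w j = i \<and> w (j + 1) = i + 1 \<or> w j = bar n (i + 1) \<and> w (j + 1) = bar n i"
    "w \<circ> srefl n j = srefl n i \<circ> w"
proof -
  show "w j = i \<and> w (j + 1) = i + 1 \<or> w j = bar n (i + 1) \<and> w (j + 1) = bar n i"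
    using srefl_mono_or_pair[OF i, of "w j" "w (j+1)"] assms(4,5) by auto
  then show "w \<circ> srefl n j = srefl n i \<circ> w" by (rule srefl_conj[OF w i j])
qed

text \<open>The identity has an ascent at \<open>j\<close>, so while the word is built up from its
  right end some letter destroys this ascent. Deleting that letter has the effect of multiplying by
  \<open>srefl n j\<close> on the right.\<close>

lemma exchange:
  assumes "set is \<subseteq> {1..n+1}" "j \<in> {1..n+1}" "\<not> asc (word_prod n is) j"
  shows "\<exists>is'. set is' \<subseteq> {1..n+1} \<and> length is' < length is \<and> word_prod n is' = word_prod n is \<circ> srefl n j"
  using assms
proof (induction "is")
  case (Cons i "is")
  define u where "u = word_prod n is"
  have u: "u \<in> weyl n" "i \<in> {1..n+1}" using Cons.prems word_prod_weyl by (auto simp: u_def)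
  show ?case
  proof (cases "asc u j")
    case True
    then have "u \<circ> srefl n j = srefl n i \<circ> u"
      using desc_conj(2)[OF u Cons.prems(2)] Cons.prems(3) by (simp add: u_def)
    then have "srefl n i \<circ> u \<circ> srefl n j = u"
      using srefl_comp_cancel(1)[OF Cons.prems(2), of u] by simp
    then show ?thesis using Cons.prems(1) unfolding u_def
      by (intro exI[of _ "is"]) (simp del: comp_apply)
  next
    case False
    then obtain is' where "set is' \<subseteq> {1..n+1}" "length is' < length is" "word_prod n is' = u \<circ> srefl n j"
      using Cons unfolding u_def by (auto simp del: comp_apply)
    then show ?thesis using u(2) unfolding u_def
      by (intro exI[of _ "i # is'"]) (auto simp: comp_assoc simp del: comp_apply)
  qed
qed simp

lemma reduced_word_exists:
  assumes "set is \<subseteq> {1..n+1}"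
  shows "\<exists>js. reduced_word n (word_prod n is) js"
proof -
  have "\<exists>js. set js \<subseteq> {1..n+1} \<and> length js = len n (word_prod n is) \<and> word_prod n js = word_prod n is"
    unfolding len_def by (rule LeastI_ex) (use assms in blast)
  then show ?thesis by (auto simp: reduced_word_def)
qed

lemma len_le: "set is \<subseteq> {1..n+1} \<Longrightarrow> len n (word_prod n is) \<le> length is"
  unfolding len_def by (rule Least_le) auto

lemma len_desc:
  assumes w: "w = word_prod n is" and "is": "set is \<subseteq> {1..n+1}" and j: "j \<in> {1..n+1}" and "\<not> asc w j"
  shows "len n (w \<circ> srefl n j) < len n w"
proof -
  obtain js where js: "set js \<subseteq> {1..n+1}" "word_prod n js = w" "length js = len n w"
    using reduced_word_exists[OF "is"] w by (auto simp: reduced_word_def)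
  then obtain ks where "set ks \<subseteq> {1..n+1}" "length ks < length js" "word_prod n ks = w \<circ> srefl n j"
    using exchange[OF js(1) j] assms(4) by auto
  then show ?thesis using len_le[of ks n] js(3) by simp
qed

text \<open>Replaces the comparison of lengths in the Hecke products by a comparison of two values,
  which can be read off a window.\<close>

lemma len_asc_iff:
  assumes w: "w = word_prod n is" and "is": "set is \<subseteq> {1..n+1}" and j: "j \<in> {1..n+1}"
  shows "len n w < len n (w \<circ> srefl n j) \<longleftrightarrow> asc w j"
proof
  assume "asc w j"
  then have "\<not> asc (w \<circ> srefl n j) j" using srefl_at[OF j] by simp
  moreover have "w \<circ> srefl n j = word_prod n (is @ [j])" using w by (simp add: word_prod_append)
  ultimately have "len n (w \<circ> srefl n j \<circ> srefl n j) < len n (w \<circ> srefl n j)"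
    using "is" j by (intro len_desc[of _ n "is @ [j]"]) auto
  then show "len n w < len n (w \<circ> srefl n j)" using srefl_comp_cancel[OF j] by simp
qed (use len_desc[OF assms] in fastforce)

text \<open>The right 0-Hecke operators with a set \<open>K\<close> of positions where the multiplication is forced:
  the Hecke product is the case \<open>K = {}\<close>, the modified one \<open>K = {k}\<close>,
  the group multiplication \<open>K = UNIV\<close>.\<close>

definition hstep :: "nat \<Rightarrow> nat set \<Rightarrow> (nat \<Rightarrow> nat) \<Rightarrow> nat \<Rightarrow> nat \<Rightarrow> nat" where
  "hstep n K w i = (if asc w i \<or> i \<in> K then w \<circ> srefl n i else w)"

definition lstep :: "nat \<Rightarrow> nat \<Rightarrow> (nat \<Rightarrow> nat) \<Rightarrow> nat \<Rightarrow> nat" where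
  "lstep n i w = (if asc (iv w) i then srefl n i \<circ> w else w)"

lemma hstep_word:
  assumes "set is \<subseteq> {1..n+1}" "set js \<subseteq> {1..n+1}"
  shows "\<exists>ks. set ks \<subseteq> {1..n+1} \<and> foldl (hstep n K) (word_prod n js) is = word_prod n ks"
  using assms
proof (induction "is" arbitrary: js)
  case (Cons i "is")
  have "hstep n K (word_prod n js) i = word_prod n (if asc (word_prod n js) i \<or> i \<in> K then js @ [i] else js)"
    by (simp add: hstep_def word_prod_append)
  then show ?case using Cons by auto
qed auto

lemma hstep_weyl: "w \<in> weyl n \<Longrightarrow> i \<in> {1..n+1} \<Longrightarrow> hstep n K w i \<in> weyl n"
  by (auto simp: hstep_def intro!: weyl_comp srefl_in_weyl)

lemma lstep_weyl: "w \<in> weyl n \<Longrightarrow> i \<in> {1..n+1} \<Longrightarrow> lstep n i w \<in> weyl n"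
  by (auto simp: lstep_def intro!: weyl_comp srefl_in_weyl)

lemma foldl_hstep_eq:
  assumes "set is \<subseteq> {1..n+1}" "set js \<subseteq> {1..n+1}"
    and step: "\<And>w i. f w i = (if len n w < len n (w \<circ> srefl n i) \<or> i \<in> K then w \<circ> srefl n i else w)"
  shows "foldl f (word_prod n js) is = foldl (hstep n K) (word_prod n js) is"
  using assms(1,2)
proof (induction "is" arbitrary: js)
  case (Cons i "is")
  have "f (word_prod n js) i = hstep n K (word_prod n js) i"
    using len_asc_iff[OF refl Cons.prems(2), of i] Cons.prems(1) by (simp add: step hstep_def)
  moreover have "hstep n K (word_prod n js) i =
      word_prod n (if asc (word_prod n js) i \<or> i \<in> K then js @ [i] else js)"
    by (simp add: hstep_def word_prod_append)
  ultimately show ?case using Cons by auto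
qed simp

lemma foldl_hecke_refl:
  assumes "set is \<subseteq> {1..n+1}" "set js \<subseteq> {1..n+1}"
  shows "foldl (hecke_refl n) (word_prod n js) is = foldl (hstep n {}) (word_prod n js) is"
    "foldl (mod_hecke_refl n k) (word_prod n js) is = foldl (hstep n {k}) (word_prod n js) is"
  by (rule foldl_hstep_eq[OF assms]; simp add: hecke_refl_def mod_hecke_refl_def)+

lemma foldl_hstep_UNIV: "foldl (hstep n UNIV) w is = w \<circ> word_prod n is"
  by (induction "is" arbitrary: w) (auto simp: hstep_def comp_assoc)

text \<open>Prefixes of a reduced word are reduced, so every letter is applied at an ascent.\<close>

lemma foldl_hstep_reduced:
  assumes "set is \<subseteq> {1..n+1}" "len n (word_prod n is) = length is"
  shows "foldl (hstep n {}) id is = word_prod n is"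
  using assms
proof (induction "is" rule: rev_induct)
  case (snoc j "is")
  define u where "u = word_prod n is"
  have S: "set is \<subseteq> {1..n+1}" and j: "j \<in> {1..n+1}" using snoc.prems by auto
  have l: "len n (u \<circ> srefl n j) = length is + 1"
    using snoc.prems by (simp add: u_def word_prod_append del: comp_apply id_apply)
  have lu: "len n u \<le> length is" using len_le[OF S] by (simp add: u_def)
  have a: "asc u j" using len_desc[OF u_def S j] l lu by linarith
  obtain js where js: "set js \<subseteq> {1..n+1}" "word_prod n js = u" "length js = len n u"
    using reduced_word_exists[OF S] by (auto simp: reduced_word_def u_def)
  have "len n (word_prod n (js @ [j])) \<le> length (js @ [j])" using js j by (intro len_le) auto
  then have "length is \<le> len n u" using js l by (simp add: word_prod_append)
  then have "foldl (hstep n {}) id is = u" using snoc.IH[OF S] lu by (simp add: u_def del: id_apply)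
  then have "foldl (hstep n {}) id (is @ [j]) = u \<circ> srefl n j"
    using a by (simp add: hstep_def[of _ _ u] del: id_apply)
  then show ?case by (simp add: word_prod_append u_def del: id_apply)
qed simp

section \<open>Left and right 0-Hecke operators\<close>

lemma asc_srefl_comp:
  assumes w: "w \<in> weyl n" and i: "i \<in> {1..n+1}" and j: "j \<in> {1..n+1}"
    and ne: "w \<circ> srefl n j \<noteq> srefl n i \<circ> w"
  shows "asc (srefl n i \<circ> w) j \<longleftrightarrow> asc w j"
proof
  assume a: "asc (srefl n i \<circ> w) j"
  show "asc w j"
  proof (rule ccontr)
    assume "\<not> asc w j"
    then have "\<not> asc (srefl n i \<circ> (srefl n i \<circ> w)) j" using srefl_comp_cancel(2)[OF i] by simp
    then have "srefl n i \<circ> w \<circ> srefl n j = srefl n i \<circ> (srefl n i \<circ> w)"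
      using desc_conj(2)[OF weyl_comp[OF srefl_in_weyl[OF i] w] i j a] by blast
    then have "srefl n i \<circ> (srefl n i \<circ> (w \<circ> srefl n j)) = srefl n i \<circ> (srefl n i \<circ> (srefl n i \<circ> w))"
      by (simp add: comp_assoc)
    then show False using ne srefl_comp_cancel(2)[OF i] by metis
  qed
next
  show "asc w j \<Longrightarrow> asc (srefl n i \<circ> w) j" using desc_conj(2)[OF w i j] ne by blast
qed

lemma weyl_inv_inv: "w \<in> weyl n \<Longrightarrow> iv (iv w) = w"
  using weylD(1) permutes_inv_inv by blast

lemma weyl_inv_comp: "v \<in> weyl n \<Longrightarrow> w \<in> weyl n \<Longrightarrow> iv (v \<circ> w) = iv w \<circ> iv v"
  using weylD(1) permutes_bij o_inv_distrib by metis

lemma inv_conj_iff: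
  assumes w: "w \<in> weyl n" and i: "i \<in> {1..n+1}" and j: "j \<in> {1..n+1}"
  shows "iv w \<circ> srefl n i = srefl n j \<circ> iv w \<longleftrightarrow> w \<circ> srefl n j = srefl n i \<circ> w"
proof -
  have "iv (srefl n i \<circ> w) = iv w \<circ> srefl n i" "iv (w \<circ> srefl n j) = srefl n j \<circ> iv w"
    using weyl_inv_comp[OF srefl_in_weyl[OF i] w] weyl_inv_comp[OF w srefl_in_weyl[OF j]]
      srefl_inv[OF i] srefl_inv[OF j] by simp_all
  moreover have "iv (srefl n i \<circ> w) = iv (w \<circ> srefl n j) \<longleftrightarrow> srefl n i \<circ> w = w \<circ> srefl n j"
    using weyl_inv_inv weyl_comp w srefl_in_weyl i j by metis
  ultimately show ?thesis by auto
qed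

lemma asc_inv_conj:
  assumes w: "w \<in> weyl n" and i: "i \<in> {1..n+1}" and j: "j \<in> {1..n+1}"
    and e: "w \<circ> srefl n j = srefl n i \<circ> w" and a: "asc w j"
  shows "asc (iv w) i"
proof -
  have "\<not> asc (srefl n i \<circ> w) j" using a srefl_at[OF j] unfolding e[symmetric] by simp
  then have p: "w j = i \<and> w (j + 1) = i + 1 \<or> w j = bar n (i + 1) \<and> w (j + 1) = bar n i"
    using desc_conj(1)[OF w i j a] by blast
  have inv: "iv w (w x) = x" for x using permutes_inverses(2)[OF weylD(1)[OF w]] .
  show ?thesis
    using p
  proof
    assume q: "w j = bar n (i + 1) \<and> w (j + 1) = bar n i"
    have "j \<in> {1..2*n+2}" "j + 1 \<in> {1..2*n+2}" using j by auto
    then have "w (bar n j) = i + 1" "w (bar n (j + 1)) = i"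
      using weylD(2)[OF w, of j] weylD(2)[OF w, of "j + 1"] q i by (auto simp: bar_def)
    then have "iv w (i + 1) = bar n j" "iv w i = bar n (j + 1)" using inv by metis+
    then show ?thesis using bar_Suc_less j by simp
  next
    assume q: "w j = i \<and> w (j + 1) = i + 1"
    then have "iv w i = j" "iv w (i + 1) = j + 1" using inv by metis+
    then show ?thesis by simp
  qed
qed

text \<open>Left and right operators commute; this makes the Hecke product independent of the reduced
  word of its second factor.\<close>

lemma lstep_hstep:
  assumes w: "w \<in> weyl n" and i: "i \<in> {1..n+1}" and j: "j \<in> {1..n+1}"
  shows "lstep n i (hstep n {} w j) = hstep n {} (lstep n i w) j"
proof (cases "w \<circ> srefl n j = srefl n i \<circ> w")
  \<comment> \<open>Here left and right multiplication coincide and have equivalent ascent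
    conditions, so both operators act in the same way. In the other case neither multiplication
    changes the ascent condition of the other operator.\<close>
  case True
  have 1: "asc w j \<longleftrightarrow> asc (iv w) i"
    using asc_inv_conj[OF w i j True] asc_inv_conj[OF weyl_inv[OF w] j i]
      inv_conj_iff[OF w i j] True weyl_inv_inv[OF w] by auto
  have 2: "asc (w \<circ> srefl n j) j \<longleftrightarrow> asc (iv (w \<circ> srefl n j)) i"
  proof -
    let ?w = "w \<circ> srefl n j"
    have w': "?w \<in> weyl n" using w j by (intro weyl_comp srefl_in_weyl)
    have e: "?w \<circ> srefl n j = srefl n i \<circ> ?w"
      using srefl_comp_cancel(1)[OF j, of w] srefl_comp_cancel(2)[OF i, of w] True by simp
    show ?thesis
      using asc_inv_conj[OF w' i j e] asc_inv_conj[OF weyl_inv[OF w'] j i]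
        inv_conj_iff[OF w' i j] e weyl_inv_inv[OF w'] by auto
  qed
  have 3: "asc w j \<Longrightarrow> \<not> asc (w \<circ> srefl n j) j" using srefl_at[OF j] by simp
  show ?thesis
  proof (cases "asc w j")
    case True': True
    have "hstep n {} w j = w \<circ> srefl n j" "lstep n i w = w \<circ> srefl n j"
      using True True' 1 by (simp_all add: hstep_def lstep_def)
    moreover have "lstep n i (w \<circ> srefl n j) = w \<circ> srefl n j" "hstep n {} (w \<circ> srefl n j) j = w \<circ> srefl n j"
      using 2 3[OF True'] unfolding lstep_def hstep_def by auto
    ultimately show ?thesis by simp
  next
    case False
    then have "hstep n {} w j = w" "lstep n i w = w" using 1 by (auto simp: hstep_def lstep_def)
    then show ?thesis by simp
  qed
next
  case False
  have 1: "asc (srefl n i \<circ> w) j \<longleftrightarrow> asc w j" by (rule asc_srefl_comp[OF w i j False])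
  have "asc (srefl n j \<circ> iv w) i \<longleftrightarrow> asc (iv w) i"
    using inv_conj_iff[OF w i j] False by (intro asc_srefl_comp[OF weyl_inv[OF w] j i]) simp
  moreover have "iv (w \<circ> srefl n j) = srefl n j \<circ> iv w"
    using weyl_inv_comp[OF w srefl_in_weyl[OF j]] srefl_inv[OF j] by simp
  ultimately have 2: "asc (iv (w \<circ> srefl n j)) i \<longleftrightarrow> asc (iv w) i" by simp
  show ?thesis using 1 2 unfolding hstep_def lstep_def by (simp add: comp_assoc del: comp_apply)
qed

lemma foldl_hstep_lstep:
  assumes "set is \<subseteq> {1..n+1}" "w \<in> weyl n" "i \<in> {1..n+1}"
  shows "foldl (hstep n {}) (lstep n i w) is = lstep n i (foldl (hstep n {}) w is)"
  using assms by (induction "is" arbitrary: w) (auto simp: lstep_hstep[symmetric] hstep_weyl)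

lemma foldr_lstep_weyl: "set js \<subseteq> {1..n+1} \<Longrightarrow> w \<in> weyl n \<Longrightarrow> foldr (lstep n) js w \<in> weyl n"
  by (induction js) (auto intro: lstep_weyl)

lemma foldl_hstep_foldr_lstep:
  assumes "set is \<subseteq> {1..n+1}" "set js \<subseteq> {1..n+1}"
  shows "foldl (hstep n {}) (foldr (lstep n) js id) is = foldr (lstep n) js (foldl (hstep n {}) id is)"
  using assms(2)
  by (induction js) (use assms(1) in \<open>auto simp: foldl_hstep_lstep foldr_lstep_weyl weyl_id\<close>)

text \<open>At the identity the two kinds of operators agree; commutation then moves each letter to
  the other side.\<close>

lemma foldl_hstep_id:
  assumes "set js \<subseteq> {1..n+1}"
  shows "foldl (hstep n {}) id js = foldr (lstep n) js id"
  using assms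
proof (induction js rule: rev_induct)
  case (snoc j js)
  have "hstep n {} id j = lstep n j id" by (simp add: hstep_def lstep_def)
  moreover have "foldl (hstep n {}) id js = foldr (lstep n) js id" using snoc by (simp del: id_apply)
  ultimately show ?case
    using snoc.prems foldl_hstep_foldr_lstep[of "[j]" n js] by (simp del: id_apply)
qed simp

text \<open>\<open>w\<close> is written as left operators applied to the identity. A right fold from
  \<open>w\<close> then depends on its word only through the fold from the identity, so the reduced
  word chosen in \<open>hecke\<close> may be replaced by any word with Hecke product
  \<open>v\<close>.\<close>

lemma hecke_fold:
  assumes "set is \<subseteq> {1..n+1}" "set js \<subseteq> {1..n+1}"
    and w: "w = foldl (hstep n {}) id js" and v: "v = foldl (hstep n {}) id is"
  shows "hecke n w v = foldl (hstep n {}) w is"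
proof -
  obtain ks where ks: "set ks \<subseteq> {1..n+1}" "v = word_prod n ks"
    using hstep_word[OF assms(1), of "[]" "{}"] v by auto
  obtain ls where ls: "set ls \<subseteq> {1..n+1}" "w = word_prod n ls"
    using hstep_word[OF assms(2), of "[]" "{}"] w by auto
  define rs where "rs = (SOME is. reduced_word n v is)"
  have "reduced_word n v rs"
    unfolding rs_def using reduced_word_exists[OF ks(1)] ks(2) by (auto intro: someI_ex)
  then have rs: "set rs \<subseteq> {1..n+1}" "foldl (hstep n {}) id rs = v"
    using foldl_hstep_reduced by (auto simp: reduced_word_def)
  have "hecke n w v = foldl (hstep n {}) w rs"
    using foldl_hecke_refl(1)[OF rs(1) ls(1)] ls(2) by (simp add: hecke_def rs_def)
  also have "\<dots> = foldr (lstep n) js (foldl (hstep n {}) id rs)"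
    using foldl_hstep_foldr_lstep[OF rs(1) assms(2)] foldl_hstep_id[OF assms(2)] w by simp
  also have "\<dots> = foldl (hstep n {}) w is"
    using foldl_hstep_foldr_lstep[OF assms(1,2)] foldl_hstep_id[OF assms(2)] w v rs(2) by simp
  finally show ?thesis .
qed

section \<open>Computation of the Hecke products\<close>

definition window :: "nat \<Rightarrow> (nat \<Rightarrow> nat) \<Rightarrow> nat list" where
  "window n w = map w [1..<n+2]"

text \<open>List positions start at 0, so letter \<open>i\<close> compares the positions
  \<open>i - 1\<close> and \<open>i\<close>. The last letter bars the last entry, an ascent exactly
  when this entry is unbarred, that is, at most \<open>n + 1\<close>.\<close>

definition wstep :: "nat \<Rightarrow> nat set \<Rightarrow> nat list \<Rightarrow> nat \<Rightarrow> nat list" where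
  "wstep n K xs i =
     (if i \<le> n then (if xs ! (i - 1) < xs ! i \<or> i \<in> K then xs[i - 1 := xs ! i, i := xs ! (i - 1)] else xs)
      else (if xs ! n \<le> n + 1 \<or> i \<in> K then xs[n := bar n (xs ! n)] else xs))"

lemma window_nth: "j \<le> n \<Longrightarrow> window n w ! j = w (j + 1)"
  by (simp add: window_def del: upt_Suc)

lemma length_window [simp]: "length (window n w) = n + 1"
  by (simp add: window_def)

lemma window_eqI:
  assumes v: "v \<in> weyl n" and w: "w \<in> weyl n" and e: "window n v = window n w"
  shows "v = w"
proof
  fix i
  have low: "v i = w i" if i: "i \<in> {1..n+1}" for i
  proof -
    obtain j where "i = j + 1" "j \<le> n" using i by (cases i) auto
    then show ?thesis using window_nth[of j n v] window_nth[of j n w] e by simp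
  qed
  consider "i \<in> {1..n+1}" | "i \<in> {n+2..2*n+2}" | "i \<notin> {1..2*n+2}" by fastforce
  then show "v i = w i"
  proof cases
    case 2
    then have b: "bar n i \<in> {1..n+1}" "bar n (bar n i) = i" "bar n i \<in> {1..2*n+2}" by (auto simp: bar_def)
    have "v i = bar n (v (bar n i))" "w i = bar n (w (bar n i))"
      using weylD(2)[OF v b(3)] weylD(2)[OF w b(3)] b(2) by simp_all
    then show ?thesis using low[OF b(1)] by simp
  next
    case 3
    then show ?thesis using permutes_not_in[OF weylD(1)[OF v]] permutes_not_in[OF weylD(1)[OF w]] by simp
  qed (rule low)
qed

lemma window_hstep:
  assumes w: "w \<in> weyl n" and i: "i \<in> {1..n+1}"
  shows "window n (hstep n K w i) = wstep n K (window n w) i"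
proof (cases "i = n + 1")
  case True
  have wl: "w (n + 2) = bar n (w (n + 1))" using weylD(2)[OF w, of "n + 1"] by (simp add: bar_def)
  have "w (n + 1) \<in> {1..2*n+2}" using weylD(3)[OF w] by auto
  then have a: "asc w i \<longleftrightarrow> w (n + 1) \<le> n + 1" using wl True by (auto simp: bar_def)
  have "window n (w \<circ> srefl n i) = (window n w)[n := bar n (window n w ! n)]"
  proof (rule nth_equalityI)
    fix j assume "j < length (window n (w \<circ> srefl n i))"
    then have "j \<le> n" by simp
    then show "window n (w \<circ> srefl n i) ! j = (window n w)[n := bar n (window n w ! n)] ! j"
      using True wl by (auto simp: window_nth nth_list_update srefl_last[simplified])
  qed simp
  then show ?thesis using a True by (simp add: hstep_def wstep_def window_nth)
next
  case False
  then have i': "i \<in> {1..n}" using i by auto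
  obtain b where b: "i + 1 < b" "bar n i = b + 1" "bar n (i + 1) = b"
    "\<And>x. srefl n i x = (if x = i then i + 1 else if x = i + 1 then i else if x = b + 1 then b
      else if x = b then b + 1 else x)"
    by (rule srefl_apply[OF i']) (rule that)
  have bn: "n + 1 < b" using b(3) i' by (auto simp: bar_def)
  have nth: "window n w ! (i - 1) = w i" "window n w ! i = w (i + 1)"
    using window_nth[of "i - 1" n w] window_nth[of i n w] i' by auto
  have "window n (w \<circ> srefl n i) = (window n w)[i - 1 := w (i + 1), i := w i]"
  proof (rule nth_equalityI)
    fix j assume "j < length (window n (w \<circ> srefl n i))"
    then have j: "j \<le> n" by simp
    have "srefl n i (j + 1) = (if j = i - 1 then i + 1 else if j = i then i else j + 1)"
      using b(4)[of "j + 1"] bn j i' by auto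
    then show "window n (w \<circ> srefl n i) ! j = (window n w)[i - 1 := w (i + 1), i := w i] ! j"
      using j i' by (auto simp: window_nth nth_list_update)
  qed simp
  then show ?thesis using nth i' by (simp add: hstep_def wstep_def)
qed

lemma window_foldl_hstep:
  assumes "w \<in> weyl n" "set is \<subseteq> {1..n+1}"
  shows "window n (foldl (hstep n K) w is) = foldl (wstep n K) (window n w) is"
  using assms by (induction "is" arbitrary: w) (auto simp: window_hstep hstep_weyl)

section \<open>Moves of entries within a window\<close>

lemma wstep_swap:
  assumes "Suc (length A) \<le> n" "x < y \<or> Suc (length A) \<in> K"
  shows "wstep n K (A @ x # y # B) (Suc (length A)) = A @ y # x # B"
  using assms by (simp add: wstep_def nth_append list_update_append)

lemma wstep_stay:
  assumes "sorted_wrt (>) D" "length A < i" "i < length A + length D" "i \<le> n" "i \<notin> K"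
  shows "wstep n K (A @ D @ B) i = A @ D @ B"
proof -
  have "D ! (i - length A) < D ! (i - 1 - length A)"
    using assms by (intro sorted_wrt_nth_less[OF assms(1)]) auto
  moreover have "(A @ D @ B) ! i = D ! (i - length A)" "(A @ D @ B) ! (i - 1) = D ! (i - 1 - length A)"
    using assms by (auto simp: nth_append)
  ultimately show ?thesis using assms by (simp add: wstep_def)
qed

text \<open>All swaps are ascents, so the result is the same for every \<open>K\<close>: group,
  Hecke and modified products agree as long as only such moves occur.\<close>

lemma move_right:
  assumes "p = Suc (length A)" "q = p + length D" "q \<le> n + 1" "\<And>d. d \<in> set D \<Longrightarrow> x < d"
  shows "foldl (wstep n K) (A @ x # D @ B) [p..<q] = A @ D @ x # B"
  using assms
proof (induction D arbitrary: A p)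
  case (Cons d D)
  have "p < q" using Cons.prems by simp
  then have "[p..<q] = p # [Suc p..<q]" by (rule upt_conv_Cons)
  moreover have "wstep n K (A @ x # d # D @ B) p = (A @ [d]) @ x # D @ B"
    using Cons.prems wstep_swap[of A n x d K] by simp
  moreover have "foldl (wstep n K) ((A @ [d]) @ x # D @ B) [Suc p..<q] = (A @ [d]) @ D @ x # B"
    using Cons.prems by (intro Cons.IH) auto
  ultimately show ?case by simp
qed simp

lemma move_left:
  assumes "p = Suc (length A)" "q = p + length D" "q \<le> n + 1" "\<And>d. d \<in> set D \<Longrightarrow> d < x"
  shows "foldl (wstep n K) (A @ D @ x # B) (rev [p..<q]) = A @ x # D @ B"
  using assms
proof (induction D arbitrary: B q rule: rev_induct)
  case (snoc d D)
  define r where "r = p + length D"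
  have q: "q = Suc r" using snoc.prems by (simp add: r_def)
  have "rev [p..<q] = r # rev [p..<r]" by (simp add: q r_def)
  moreover have "wstep n K (A @ (D @ [d]) @ x # B) r = A @ D @ x # (d # B)"
    using snoc.prems wstep_swap[of "A @ D" n d x K B] by (simp add: r_def)
  moreover have "foldl (wstep n K) (A @ D @ x # (d # B)) (rev [p..<r]) = A @ x # D @ (d # B)"
    using snoc.prems q by (intro snoc.IH) (auto simp: r_def)
  ultimately show ?case by simp
qed simp

text \<open>Inside a decreasing block every letter meets a descent, and none of these letters is
  forced.\<close>

lemma stay:
  assumes "sorted_wrt (>) D" "set is \<subseteq> {length A<..<length A + length D}" "set is \<subseteq> {..n} - K"
  shows "foldl (wstep n K) (A @ D @ B) is = A @ D @ B"
  using assms(2,3)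
proof (induction "is")
  case (Cons i "is")
  then have "wstep n K (A @ D @ B) i = A @ D @ B" by (intro wstep_stay assms(1)) auto
  then show ?case using Cons by simp
qed simp

lemma flip:
  assumes "length A = n" "x \<le> n + 1"
  shows "wstep n K (A @ [x]) (n + 1) = A @ [bar n x]"
  using assms by (simp add: wstep_def nth_append list_update_append)

lemma no_flip:
  assumes "length xs = n + 1" "n + 1 < last xs" "n + 1 \<notin> K"
  shows "wstep n K xs (n + 1) = xs"
proof -
  have "last xs = xs ! n" using assms(1) by (subst last_conv_nth) auto
  then show ?thesis using assms by (simp add: wstep_def)
qed

abbreviation bars :: "nat \<Rightarrow> nat \<Rightarrow> nat \<Rightarrow> nat list" where
  "bars n a b \<equiv> map (bar n) [a..<b]"

lemma bars_sorted: "b \<le> 2*n+4 \<Longrightarrow> sorted_wrt (>) (bars n a b)"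
  by (auto simp: sorted_wrt_map bar_def intro!: sorted_wrt_mono_rel[OF _ sorted_wrt_upt])

lemma bars_last: "a \<le> b \<Longrightarrow> bars n a (Suc b) = bars n a b @ [bar n b]"
  by simp

lemma bars_first: "a < b \<Longrightarrow> bars n a b = bar n a # bars n (Suc a) b"
  by (simp add: upt_conv_Cons)

lemma sorted_snoc: "sorted_wrt (>) (xs @ [x]) \<longleftrightarrow> sorted_wrt (>) xs \<and> (\<forall>y\<in>set xs. x < (y::nat))"
  by (simp add: sorted_wrt_append)

lemma upt_split: "a \<le> b \<Longrightarrow> b \<le> c \<Longrightarrow> [a..<c] = [a..<b] @ [b..<c]"
  using upt_add_eq_append[of a b "c - b"] by simp

text \<open>The window of \<open>O_Z n d\<close> for \<open>m = min d n\<close>; it saturates when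
  all entries but the first are barred.\<close>

definition Z_window :: "nat \<Rightarrow> nat \<Rightarrow> nat list" where
  "Z_window n m = 1 # bars n 2 (m + 2) @ [m + 2..<n + 2]"

definition Y_window :: "nat \<Rightarrow> nat \<Rightarrow> nat \<Rightarrow> nat list" where
  "Y_window n k d =
     (if d < k then bars n 2 (d + 1) @ bar n (k + 1) # [d + 1..<k + 1] @ 1 # [k + 2..<n + 2]
      else bars n 2 (k + 2) @ 1 # bars n (k + 2) (min d n + 2) @ [min d n + 2..<n + 2])"

lemma Z_window_0: "window n id = Z_window n 0"
  by (simp add: window_def Z_window_def upt_conv_Cons numeral_2_eq_2 del: upt_Suc)

text \<open>The segment right of position \<open>k\<close> is \<open>bars n (k + 1) (e + 2) @ [e + 2..<n + 2]\<close>; its first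
  unbarred entry is moved to the end, barred, and moved back.\<close>

lemma tail_pass:
  assumes A: "length A = k" and e: "k \<le> e + 1" "e \<le> n" and k: "1 \<le> k" "k \<le> n"
    and K: "K \<inter> {k + 1..n + 1} = {} \<or> e + 1 = k"
  shows "foldl (wstep n K) (A @ bars n (k + 1) (e + 2) @ [e + 2..<n + 2])
      ([k + 1..<n + 1] @ [n + 1] @ rev [k + 1..<n + 1]) =
    A @ bars n (k + 1) (min (e + 1) n + 2) @ [min (e + 1) n + 2..<n + 2]"
proof (cases "e < n")
  case True
  let ?l1 = "[k + 1..<e + 2]" and ?l2 = "[e + 2..<n + 1]"
  let ?b = "bars n (k + 1) (e + 2)" and ?r = "[e + 3..<n + 2]"
  have word: "[k + 1..<n + 1] @ [n + 1] @ rev [k + 1..<n + 1] = ?l1 @ ?l2 @ [n + 1] @ rev ?l2 @ rev ?l1"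
    using upt_split[of "k + 1" "e + 2" "n + 1"] True e by simp
  have Z: "A @ bars n (k + 1) (e + 2) @ [e + 2..<n + 2] = A @ (?b @ [e + 2]) @ ?r"
    using True upt_conv_Cons[of "e + 2" "n + 2"] by (simp add: numeral_3_eq_3)
  have s1: "sorted_wrt (>) (?b @ [e + 2])"
    unfolding sorted_snoc using bars_sorted[of "e + 2" n "k + 1"] True by (auto simp: bar_def)
  have s2: "sorted_wrt (>) (?b @ [bar n (e + 2)])"
    using bars_sorted[of "e + 3" n "k + 1"] True e bars_last[of "k + 1" "e + 2" n] by (simp add: numeral_3_eq_3)
  have 1: "foldl (wstep n K) (A @ (?b @ [e + 2]) @ ?r) ?l1 = A @ (?b @ [e + 2]) @ ?r"
    by (rule stay[OF s1]) (use K True A e in auto)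
  have 2: "foldl (wstep n K) ((A @ ?b) @ (e + 2) # ?r @ []) ?l2 = (A @ ?b) @ ?r @ (e + 2) # []"
    by (rule move_right) (use True A e in auto)
  have 3: "wstep n K ((A @ ?b @ ?r) @ [e + 2]) (n + 1) = (A @ ?b @ ?r) @ [bar n (e + 2)]"
    by (rule flip) (use True A e in auto)
  have 4: "foldl (wstep n K) ((A @ ?b) @ ?r @ bar n (e + 2) # []) (rev ?l2) = (A @ ?b) @ bar n (e + 2) # ?r @ []"
    by (rule move_left) (use True A e in \<open>auto simp: bar_def\<close>)
  have 5: "foldl (wstep n K) (A @ (?b @ [bar n (e + 2)]) @ ?r) (rev ?l1) = A @ (?b @ [bar n (e + 2)]) @ ?r"
    by (rule stay[OF s2]) (use K True A e in auto)
  have "foldl (wstep n K) (A @ bars n (k + 1) (e + 2) @ [e + 2..<n + 2])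
      ([k + 1..<n + 1] @ [n + 1] @ rev [k + 1..<n + 1]) = A @ (?b @ [bar n (e + 2)]) @ ?r"
    unfolding word Z using 1 2 3 4 5 by (simp del: upt_Suc)
  also have "\<dots> = A @ bars n (k + 1) (min (e + 1) n + 2) @ [min (e + 1) n + 2..<n + 2]"
    using True e bars_last[of "k + 1" "e + 2" n] by (simp add: numeral_3_eq_3 min_def del: upt_Suc)
  finally show ?thesis .
next
  \<comment> \<open>All entries from the \<open>(k+1)\<close>-st on are already barred, so the pass
    meets only descents: this is the saturation at \<open>n\<close>.\<close>
  case False
  then have en: "e = n" using e by simp
  then have K: "K \<inter> {k + 1..n + 1} = {}" using K k by simp
  let ?X = "A @ bars n (k + 1) (n + 2) @ []"
  have s: "sorted_wrt (>) (bars n (k + 1) (n + 2))" by (rule bars_sorted) simp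
  have 1: "foldl (wstep n K) ?X is = ?X" if "set is \<subseteq> {k + 1..<n + 1}" for "is"
  proof (rule stay[OF s])
    show "set is \<subseteq> {length A<..<length A + length (bars n (k + 1) (n + 2))}"
      using that A e by (force simp del: upt_Suc)
    have "{k + 1..<n + 1} \<subseteq> {..n} - K" using K by auto
    then show "set is \<subseteq> {..n} - K" using that by blast
  qed
  have 2: "wstep n K ?X (n + 1) = ?X"
    by (rule no_flip) (use A e K k in \<open>auto simp: bar_def\<close>)
  show ?thesis
    unfolding en using 1[of "[k + 1..<n + 1]"] 1[of "rev [k + 1..<n + 1]"] 2 by (simp del: upt_Suc)
qed

text \<open>For \<open>m = 0\<close> the word acts on the identity window by ascents only, so
  \<open>K\<close> is arbitrary. Comparing \<open>UNIV\<close> with \<open>{}\<close> identifies the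
  group product of the word with its Hecke product.\<close>

lemma Z_window_step:
  assumes K: "K = {} \<or> m = 0" and m: "m \<le> n" "1 \<le> n"
  shows "foldl (wstep n K) (Z_window n m) (O_Z_word n) = Z_window n (min (m + 1) n)"
  using tail_pass[of "[1]" 1 m n K] assms by (auto simp: Z_window_def O_Z_word_def numeral_2_eq_2 simp del: upt_Suc)

lemma Y_word:
  assumes "1 \<le> k" "k \<le> n"
  shows "O_Y_word n k = [1..<k] @ [k + 1..<n + 1] @ [n + 1] @ rev [k + 1..<n + 1] @ [k] @ rev [1..<k]"
proof -
  have s: "[1..<n + 1] = [1..<k] @ [k] @ [k + 1..<n + 1]"
    using upt_split[of 1 k "n + 1"] upt_conv_Cons[of k "n + 1"] assms by simp
  have "filter (\<lambda>i. i \<noteq> k) [1..<n + 1] = [1..<k] @ [k + 1..<n + 1]"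
    unfolding s by (simp add: filter_id_conv del: upt_Suc)
  then show ?thesis unfolding O_Y_word_def s by simp
qed

lemma open_word:
  assumes "1 \<le> k" "k \<le> n"
  shows "O_open_word n = [1..<k] @ [k] @ [k + 1..<n + 1] @ [n + 1] @ rev [k + 1..<n + 1] @ [k] @ rev [1..<k]"
proof -
  have s: "[1..<n + 1] = [1..<k] @ [k] @ [k + 1..<n + 1]"
    using upt_split[of 1 k "n + 1"] upt_conv_Cons[of k "n + 1"] assms by simp
  show ?thesis unfolding O_open_word_def s by simp
qed

text \<open>The entry 1 is the \<open>k\<close>-th one. The letters beyond \<open>k\<close> treat
  the tail, letter \<open>k\<close> exchanges 1 with \<open>bar n (k + 1)\<close>, and the remaining
  letters meet a decreasing block.\<close>

lemma upper_finish:
  assumes k: "1 \<le> k" "k \<le> n" and e: "k \<le> e" "e \<le> n" and K: "K \<inter> {1..n + 1} \<subseteq> {k}"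
  shows "foldl (wstep n K) (bars n 2 (k + 1) @ 1 # bars n (k + 1) (e + 2) @ [e + 2..<n + 2])
      ([k + 1..<n + 1] @ [n + 1] @ rev [k + 1..<n + 1] @ [k] @ rev [1..<k]) =
    bars n 2 (k + 2) @ 1 # bars n (k + 2) (min (e + 1) n + 2) @ [min (e + 1) n + 2..<n + 2]"
proof -
  define e' where "e' = min (e + 1) n"
  have e': "k \<le> e'" "e' \<le> n" using e by (auto simp: e'_def)
  let ?t = "bars n (k + 2) (e' + 2) @ [e' + 2..<n + 2]"
  have 1: "foldl (wstep n K) ((bars n 2 (k + 1) @ [1]) @ bars n (k + 1) (e + 2) @ [e + 2..<n + 2])
      ([k + 1..<n + 1] @ [n + 1] @ rev [k + 1..<n + 1]) =
    (bars n 2 (k + 1) @ [1]) @ bars n (k + 1) (e' + 2) @ [e' + 2..<n + 2]"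
    unfolding e'_def by (rule tail_pass) (use k e K in auto)
  have b: "bars n (k + 1) (e' + 2) = bar n (k + 1) # bars n (k + 2) (e' + 2)"
    using bars_first[of "k + 1" "e' + 2" n] e' by simp
  have 2: "wstep n K (bars n 2 (k + 1) @ 1 # bar n (k + 1) # ?t) k = bars n 2 (k + 1) @ bar n (k + 1) # 1 # ?t"
  proof -
    have "1 < bar n (k + 1)" using k by (simp add: bar_def)
    then show ?thesis using wstep_swap[of "bars n 2 (k + 1)" n 1 "bar n (k + 1)" K ?t] k
      by (simp del: upt_Suc)
  qed
  have b2: "bars n 2 (k + 2) = bars n 2 (k + 1) @ [bar n (k + 1)]"
    using bars_last[of 2 "k + 1" n] k by simp
  have 3: "foldl (wstep n K) ([] @ bars n 2 (k + 2) @ 1 # ?t) (rev [1..<k]) = [] @ bars n 2 (k + 2) @ 1 # ?t"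
    by (rule stay[OF bars_sorted]) (use k K in auto)
  show ?thesis using 1 2 3 unfolding e'_def[symmetric] b b2 by (simp del: upt_Suc)
qed

lemma Y_window_k:
  assumes "1 \<le> k" "k \<le> n"
  shows "Y_window n k k = bars n 2 (k + 1) @ bar n (k + 1) # 1 # [k + 2..<n + 2]"
  using assms bars_last[of 2 "k + 1" n] by (simp add: Y_window_def del: upt_Suc)

lemma Y_window_low:
  assumes "1 \<le> k" "k \<le> n" "d \<le> k"
  shows "Y_window n k d = bars n 2 (d + 1) @ bar n (k + 1) # [d + 1..<k + 1] @ 1 # [k + 2..<n + 2]"
proof (cases "d = k")
  case True
  then show ?thesis using Y_window_k[OF assms(1,2)] by simp
qed (use assms in \<open>simp add: Y_window_def\<close>)

lemma Y_window_from_Z: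
  assumes K: "K = {} \<or> m = 0" and m: "m \<le> n" and k: "1 \<le> k" "k \<le> n"
  shows "foldl (wstep n K) (Z_window n m) (O_Y_word n k) = Y_window n k (m + 1)"
proof (cases "m < k")
  case True
  let ?b = "bars n 2 (m + 2)" and ?c = "[m + 2..<k + 1]" and ?r = "[k + 2..<n + 2]"
  \<comment> \<open>The entry 1 travels to the \<open>k\<close>-th place and stops there, because
    the ascending part of the word lacks \<open>k\<close>. The entry \<open>k + 1\<close> is carried
    to the end, barred, and brought back to the place \<open>m + 1\<close>.\<close>
  have Z: "Z_window n m = [] @ 1 # (?b @ ?c) @ (k + 1) # ?r"
    using upt_split[of "m + 2" "k + 1" "n + 2"] upt_conv_Cons[of "k + 1" "n + 2"] True k
    by (simp add: Z_window_def)
  have "rev ([1..<k] @ [k] @ [k + 1..<n + 1]) = rev ([1..<m + 1] @ [m + 1..<n + 1])"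
    using upt_split[of 1 k "n + 1"] upt_conv_Cons[of k "n + 1"] upt_split[of 1 "m + 1" "n + 1"] True k by simp
  then have word: "O_Y_word n k = [1..<k] @ [k + 1..<n + 1] @ [n + 1] @ rev [m + 1..<n + 1] @ rev [1..<m + 1]"
    unfolding Y_word[OF k] by simp
  have 1: "foldl (wstep n K) ([] @ 1 # (?b @ ?c) @ (k + 1) # ?r) [1..<k] = [] @ (?b @ ?c) @ 1 # (k + 1) # ?r"
    by (rule move_right) (use True k in \<open>auto simp: bar_def\<close>)
  have 2: "foldl (wstep n K) ((?b @ ?c @ [1]) @ (k + 1) # ?r @ []) [k + 1..<n + 1] = (?b @ ?c @ [1]) @ ?r @ (k + 1) # []"
    by (rule move_right) (use True k in auto)
  have 3: "wstep n K ((?b @ ?c @ 1 # ?r) @ [k + 1]) (n + 1) = (?b @ ?c @ 1 # ?r) @ [bar n (k + 1)]"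
    by (rule flip) (use True k in auto)
  have 4: "foldl (wstep n K) (?b @ (?c @ 1 # ?r) @ bar n (k + 1) # []) (rev [m + 1..<n + 1]) =
      ?b @ bar n (k + 1) # (?c @ 1 # ?r) @ []"
    by (rule move_left) (use True k in \<open>auto simp: bar_def\<close>)
  have s: "sorted_wrt (>) (?b @ [bar n (k + 1)])"
    unfolding sorted_snoc using bars_sorted[of "m + 2" n 2] True k by (auto simp: bar_def)
  have 5: "foldl (wstep n K) ([] @ (?b @ [bar n (k + 1)]) @ ?c @ 1 # ?r) (rev [1..<m + 1]) =
      [] @ (?b @ [bar n (k + 1)]) @ ?c @ 1 # ?r"
    by (rule stay[OF s]) (use K True k in auto)
  have "foldl (wstep n K) (Z_window n m) (O_Y_word n k) = ?b @ bar n (k + 1) # ?c @ 1 # ?r"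
    unfolding word Z using 1 2 3 4 5 by (simp del: upt_Suc)
  then show ?thesis using Y_window_low[OF k, of "m + 1"] True by simp
next
  case False
  then have K0: "K = {}" using K k by auto
  let ?t = "bars n (k + 1) (m + 2) @ [m + 2..<n + 2]"
  have Z: "Z_window n m = [] @ 1 # bars n 2 (k + 1) @ ?t"
    using upt_split[of 2 "k + 1" "m + 2"] False k by (simp add: Z_window_def)
  have 1: "foldl (wstep n K) ([] @ 1 # bars n 2 (k + 1) @ ?t) [1..<k] = [] @ bars n 2 (k + 1) @ 1 # ?t"
    by (rule move_right) (use False k in \<open>auto simp: bar_def\<close>)
  have "foldl (wstep n K) (Z_window n m) [1..<k] = bars n 2 (k + 1) @ 1 # ?t"
    using 1 unfolding Z by (simp only: append_Nil)
  then show ?thesis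
    using upper_finish[of k n m K] False k m K0
    by (simp add: Y_word[OF k] Y_window_def del: upt_Suc)
qed

lemma Y_window_step:
  assumes k: "1 \<le> k" "k \<le> n" and d: "1 \<le> d"
  shows "foldl (wstep n {k}) (Y_window n k d) (O_open_word n) = Y_window n k (d + 1)"
proof (cases "d < k")
  case True
  let ?b = "bars n 2 (d + 1)" and ?c = "[d + 2..<k + 1]" and ?r = "[k + 2..<n + 2]" and ?x = "bar n (k + 1)"
  have Y: "Y_window n k d = [] @ (?b @ [?x] @ [d + 1]) @ ?c @ 1 # ?r"
    using upt_conv_Cons[of "d + 1" "k + 1"] True by (simp add: Y_window_def)
  have "rev ([1..<k] @ [k] @ [k + 1..<n + 1]) = rev ([1..<d] @ [d..<n + 1])"
    using upt_split[of 1 k "n + 1"] upt_conv_Cons[of k "n + 1"] upt_split[of 1 d "n + 1"] True k d by simp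
  then have word: "O_open_word n = [1..<d + 1] @ [d + 1..<k] @ [k] @ [k + 1..<n + 1] @ [n + 1] @
      rev [d..<n + 1] @ rev [1..<d]"
    unfolding open_word[OF k] using upt_split[of 1 "d + 1" k] True by simp
  have s: "sorted_wrt (>) (?b @ [?x] @ [d + 1])"
    unfolding append_assoc[symmetric] sorted_snoc
    using bars_sorted[of "d + 1" n 2] True k by (auto simp: bar_def)
  have 1: "foldl (wstep n {k}) ([] @ (?b @ [?x] @ [d + 1]) @ ?c @ 1 # ?r) [1..<d + 1] = [] @ (?b @ [?x] @ [d + 1]) @ ?c @ 1 # ?r"
    by (rule stay[OF s]) (use True k d in auto)
  have 2: "foldl (wstep n {k}) ((?b @ [?x]) @ (d + 1) # ?c @ 1 # ?r) [d + 1..<k] = (?b @ [?x]) @ ?c @ (d + 1) # 1 # ?r"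
    by (rule move_right) (use True k d in auto)
  \<comment> \<open>A descent, performed only because the letter \<open>k\<close> is forced:
    \<open>d + 1\<close> passes the entry 1 and can go on to the end.\<close>
  have 3: "wstep n {k} ((?b @ [?x] @ ?c) @ (d + 1) # 1 # ?r) k = (?b @ [?x] @ ?c) @ 1 # (d + 1) # ?r"
    using wstep_swap[of "?b @ [?x] @ ?c" n "d + 1" 1 "{k}" ?r] True k d by (simp del: upt_Suc)
  have 4: "foldl (wstep n {k}) ((?b @ [?x] @ ?c @ [1]) @ (d + 1) # ?r @ []) [k + 1..<n + 1] =
      (?b @ [?x] @ ?c @ [1]) @ ?r @ (d + 1) # []"
    by (rule move_right) (use True k d in auto)
  have 5: "wstep n {k} ((?b @ [?x] @ ?c @ 1 # ?r) @ [d + 1]) (n + 1) = (?b @ [?x] @ ?c @ 1 # ?r) @ [bar n (d + 1)]"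
    by (rule flip) (use True k d in auto)
  have 6: "foldl (wstep n {k}) (?b @ (?x # ?c @ 1 # ?r) @ bar n (d + 1) # []) (rev [d..<n + 1]) =
      ?b @ bar n (d + 1) # (?x # ?c @ 1 # ?r) @ []"
    by (rule move_left) (use True k d in \<open>auto simp: bar_def\<close>)
  have b: "?b @ [bar n (d + 1)] = bars n 2 (d + 2)" using bars_last[of 2 "d + 1" n] d by simp
  have 7: "foldl (wstep n {k}) ([] @ bars n 2 (d + 2) @ ?x # ?c @ 1 # ?r) (rev [1..<d]) =
      [] @ bars n 2 (d + 2) @ ?x # ?c @ 1 # ?r"
    by (rule stay[OF bars_sorted]) (use True k d in auto)
  have "foldl (wstep n {k}) (Y_window n k d) (O_open_word n) = bars n 2 (d + 2) @ ?x # ?c @ 1 # ?r"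
    unfolding word Y using 1 2 3 4 5 6 7 unfolding b[symmetric] by (simp del: upt_Suc)
  then show ?thesis using Y_window_low[OF k, of "d + 1"] True by simp
next
  case False
  define e where "e = min d n"
  have e: "k \<le> e" "e \<le> n" using False k by (auto simp: e_def)
  let ?t = "bars n (k + 2) (e + 2) @ [e + 2..<n + 2]"
  have Y: "Y_window n k d = [] @ bars n 2 (k + 2) @ 1 # ?t" using False by (simp add: Y_window_def e_def)
  have 1: "foldl (wstep n {k}) ([] @ bars n 2 (k + 2) @ 1 # ?t) [1..<k] = [] @ bars n 2 (k + 2) @ 1 # ?t"
    by (rule stay[OF bars_sorted]) (use k in auto)
  have b: "bars n (k + 1) (e + 2) = bar n (k + 1) # bars n (k + 2) (e + 2)"
    using bars_first[of "k + 1" "e + 2" n] e by simp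
  have b2: "bars n 2 (k + 2) = bars n 2 (k + 1) @ [bar n (k + 1)]"
    using bars_last[of 2 "k + 1" n] k by simp
  \<comment> \<open>Again a forced descent; it puts 1 into the \<open>k\<close>-th place, where the
    second occurrence of \<open>k\<close> moves it back after the tail has been treated.\<close>
  have 2: "wstep n {k} (bars n 2 (k + 1) @ bar n (k + 1) # 1 # ?t) k = bars n 2 (k + 1) @ 1 # bar n (k + 1) # ?t"
    using wstep_swap[of "bars n 2 (k + 1)" n "bar n (k + 1)" 1 "{k}" ?t] k by (simp del: upt_Suc)
  have "foldl (wstep n {k}) (Y_window n k d) ([1..<k] @ [k]) =
      bars n 2 (k + 1) @ 1 # bars n (k + 1) (e + 2) @ [e + 2..<n + 2]"
    unfolding Y using 1 2 b b2 by (simp del: upt_Suc)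
  then have "foldl (wstep n {k}) (Y_window n k d) (O_open_word n) =
      bars n 2 (k + 2) @ 1 # bars n (k + 2) (min (e + 1) n + 2) @ [min (e + 1) n + 2..<n + 2]"
    unfolding open_word[OF k] using upper_finish[of k n e "{k}"] k e by (simp del: upt_Suc)
  moreover have "min (e + 1) n = min (d + 1) n" by (auto simp: e_def)
  ultimately show ?thesis using False by (simp add: Y_window_def del: upt_Suc)
qed

section \<open>From windows back to Weyl group elements\<close>

lemma words_in:
  "set (O_Z_word n) \<subseteq> {1..n+1}" "set (O_Y_word n k) \<subseteq> {1..n+1}" "set (O_open_word n) \<subseteq> {1..n+1}"
  by (auto simp: O_Z_word_def O_Y_word_def O_open_word_def)

text \<open>Forcing every letter is plain multiplication, and a Weyl group element is determined by
  its window.\<close>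

lemma word_prod_eq_hecke:
  assumes "set is \<subseteq> {1..n+1}" "foldl (wstep n UNIV) (window n id) is = foldl (wstep n {}) (window n id) is"
  shows "word_prod n is = foldl (hstep n {}) id is"
proof (rule window_eqI)
  show "word_prod n is \<in> weyl n" by (rule word_prod_weyl[OF assms(1)])
  show "foldl (hstep n {}) id is \<in> weyl n"
    using hstep_word[OF assms(1), of "[]" "{}"] word_prod_weyl by auto
  have "window n (word_prod n is) = window n (foldl (hstep n UNIV) id is)" by (simp add: foldl_hstep_UNIV)
  then show "window n (word_prod n is) = window n (foldl (hstep n {}) id is)"
    using window_foldl_hstep[OF weyl_id assms(1)] assms(2) by simp
qed

lemma O_Z_word_hecke: "1 \<le> n \<Longrightarrow> word_prod n (O_Z_word n) = foldl (hstep n {}) id (O_Z_word n)"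
  by (rule word_prod_eq_hecke[OF words_in(1)]) (simp add: Z_window_0 Z_window_step)

lemma O_Y_word_hecke: "1 \<le> k \<Longrightarrow> k \<le> n \<Longrightarrow> word_prod n (O_Y_word n k) = foldl (hstep n {}) id (O_Y_word n k)"
  by (rule word_prod_eq_hecke[OF words_in(2)]) (simp add: Z_window_0 Y_window_from_Z)

lemma O_Z_fold:
  assumes n: "1 \<le> n"
  shows "\<exists>is. set is \<subseteq> {1..n+1} \<and> O_Z n d = foldl (hstep n {}) id is \<and> window n (O_Z n d) = Z_window n (min d n)"
proof (induction d)
  case 0
  show ?case by (rule exI[of _ "[]"]) (simp add: Z_window_0 del: id_apply)
next
  case (Suc d)
  then obtain js where js: "set js \<subseteq> {1..n+1}" "O_Z n d = foldl (hstep n {}) id js"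
    "window n (O_Z n d) = Z_window n (min d n)" by blast
  have f: "O_Z n (Suc d) = foldl (hstep n {}) (O_Z n d) (O_Z_word n)"
  proof (cases d)
    case 0
    then show ?thesis using O_Z_word_hecke[OF n] by simp
  next
    case (Suc d')
    then show ?thesis using hecke_fold[OF words_in(1) js(1,2) O_Z_word_hecke[OF n]] by simp
  qed
  have "O_Z n d \<in> weyl n"
    using hstep_word[OF js(1), of "[]" "{}"] js(2) word_prod_weyl by auto
  then have "window n (O_Z n (Suc d)) = Z_window n (min (min d n + 1) n)"
    unfolding f using window_foldl_hstep[OF _ words_in(1)] js(3) Z_window_step[of "{}" "min d n" n] n by simp
  then have "window n (O_Z n (Suc d)) = Z_window n (min (Suc d) n)" by (simp add: min_def split: if_splits)
  then show ?case using f js words_in(1)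
    by (intro exI[of _ "js @ O_Z_word n"]) (auto simp del: id_apply)
qed

text \<open>\<open>O_Z n d1\<close> contributes \<open>d1\<close>, the word of \<open>O_Y\<close>
  one, and each modified factor one; the window therefore depends on the splitting only through the
  sum.\<close>

lemma O_Y_window:
  assumes k: "1 \<le> k" "k \<le> n"
  shows "window n (O_Y n k d1 d2) = Y_window n k (d1 + d2 + 1)"
proof -
  define w where "w = (if d1 = 0 then word_prod n (O_Y_word n k) else hecke n (O_Z n d1) (word_prod n (O_Y_word n k)))"
  obtain js where js: "set js \<subseteq> {1..n+1}" "O_Z n d1 = foldl (hstep n {}) id js"
    "window n (O_Z n d1) = Z_window n (min d1 n)" using O_Z_fold[of n d1] k by auto
  have "w = foldl (hstep n {}) (O_Z n d1) (O_Y_word n k)"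
    unfolding w_def using O_Y_word_hecke[OF k] hecke_fold[OF words_in(2) js(1,2) O_Y_word_hecke[OF k]] by auto
  moreover have "O_Z n d1 \<in> weyl n"
    using hstep_word[OF js(1), of "[]" "{}"] js(2) word_prod_weyl by auto
  ultimately have "window n w = Y_window n k (min d1 n + 1)"
    using window_foldl_hstep[OF _ words_in(2)] js(3) Y_window_from_Z[of "{}" "min d1 n" n k] k by simp
  \<comment> \<open>Cutting \<open>d1\<close> at \<open>n\<close> is harmless, as
    \<open>Y_window\<close> is itself constant in \<open>d\<close> from \<open>n\<close> on.\<close>
  then have win: "window n w = Y_window n k (d1 + 1)"
    using k by (auto simp: Y_window_def min_def split: if_splits)
  have "\<exists>ls. set ls \<subseteq> {1..n+1} \<and> w = word_prod n ls"
    using hstep_word[of "js @ O_Y_word n k" n "[]" "{}"] js words_in(2)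
      \<open>w = foldl (hstep n {}) (O_Z n d1) (O_Y_word n k)\<close> by auto
  then have "\<exists>ls. set ls \<subseteq> {1..n+1} \<and> mod_hecke_O_open n k w d2 = word_prod n ls \<and>
      window n (mod_hecke_O_open n k w d2) = Y_window n k (d1 + d2 + 1)"
  proof (induction d2)
    case 0
    then show ?case using win by (simp add: mod_hecke_O_open_def)
  next
    case (Suc d2)
    then obtain ls where ls: "set ls \<subseteq> {1..n+1}" "mod_hecke_O_open n k w d2 = word_prod n ls"
      "window n (mod_hecke_O_open n k w d2) = Y_window n k (d1 + d2 + 1)" by blast
    have f: "mod_hecke_O_open n k w (Suc d2) = foldl (hstep n {k}) (word_prod n ls) (O_open_word n)"
      using foldl_hecke_refl(2)[OF words_in(3) ls(1)] ls(2) by (simp add: mod_hecke_O_open_def)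
    have "window n (mod_hecke_O_open n k w (Suc d2)) = Y_window n k (d1 + Suc d2 + 1)"
      unfolding f using window_foldl_hstep[OF word_prod_weyl[OF ls(1)] words_in(3)] ls(2,3)
        Y_window_step[OF k, of "d1 + d2 + 1"] by simp
    then show ?case using hstep_word[OF words_in(3) ls(1), of "{k}"] f by auto
  qed
  then show ?thesis unfolding O_Y_def w_def by blast
qed

lemma image_window: "k \<le> n \<Longrightarrow> w ` {1..k} = set (take k (window n w))"
proof -
  assume "k \<le> n"
  then have "take k (window n w) = map w [1..<k + 1]"
    by (simp add: window_def take_map take_upt del: upt_Suc)
  then show ?thesis by (simp add: atLeastLessThanSuc_atLeastAtMost del: upt_Suc)
qed

lemma take_prefix: "xs = ys @ zs \<Longrightarrow> length ys = k \<Longrightarrow> take k xs = ys"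
  by simp

text \<open>The entry 1 occupies one of the first \<open>k\<close> places, so at most
  \<open>k - 1\<close> of them can be barred.\<close>

lemma O_Z_image:
  assumes k: "1 \<le> k" "k \<le> n" and r: "r = min d (k - 1)"
  shows "O_Z n d ` {1..k} = insert 1 {r + 2..k} \<union> bar n ` {2..r + 1}"
proof -
  define m where "m = min d n"
  have w: "window n (O_Z n d) = Z_window n m" using O_Z_fold[of n d] k by (auto simp: m_def)
  show ?thesis
  proof (cases "m < k")
    case True
    then have m: "r = m" "m = d" using r k by (auto simp: m_def)
    have "Z_window n m = (1 # bars n 2 (m + 2) @ [m + 2..<k + 1]) @ [k + 1..<n + 2]"
      using upt_split[of "m + 2" "k + 1" "n + 2"] True k by (simp add: Z_window_def)
    then have "take k (Z_window n m) = 1 # bars n 2 (m + 2) @ [m + 2..<k + 1]"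
      by (rule take_prefix) (use True k in auto)
    then show ?thesis unfolding image_window[OF k(2)] w m(1) by (auto simp del: upt_Suc)
  next
    case False
    then have m: "r + 1 = k" using r k by (auto simp: m_def)
    have "Z_window n m = (1 # bars n 2 (k + 1)) @ bars n (k + 1) (m + 2) @ [m + 2..<n + 2]"
      using upt_split[of 2 "k + 1" "m + 2"] False k by (simp add: Z_window_def)
    then have "take k (Z_window n m) = 1 # bars n 2 (k + 1)" by (rule take_prefix) (use k in auto)
    then show ?thesis unfolding image_window[OF k(2)] w using m by (auto simp del: upt_Suc)
  qed
qed

lemma O_Y_image:
  assumes k: "1 \<le> k" "k \<le> n" and r: "r = min (d1 + d2 + 1) k"
  shows "O_Y n k d1 d2 ` {1..k} = {r + 1..k} \<union> bar n ` insert (k + 1) {2..r}"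
proof -
  define d where "d = d1 + d2 + 1"
  have d: "1 \<le> d" by (simp add: d_def)
  have "take k (Y_window n k d) = (if d < k then bars n 2 (d + 1) @ bar n (k + 1) # [d + 1..<k + 1] else bars n 2 (k + 2))"
  proof (cases "d < k")
    case True
    then have "Y_window n k d = (bars n 2 (d + 1) @ bar n (k + 1) # [d + 1..<k + 1]) @ 1 # [k + 2..<n + 2]"
      by (simp add: Y_window_def del: upt_Suc)
    then have "take k (Y_window n k d) = bars n 2 (d + 1) @ bar n (k + 1) # [d + 1..<k + 1]"
      by (rule take_prefix) (use True d in auto)
    then show ?thesis using True by (simp del: upt_Suc)
  qed (simp add: Y_window_def del: upt_Suc)
  moreover have "set (bars n 2 (k + 2)) = bar n ` insert (k + 1) {2..k}"
    using bars_last[of 2 "k + 1" n] k by (auto simp: atLeastLessThanSuc_atLeastAtMost simp del: upt_Suc)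
  ultimately show ?thesis
    unfolding image_window[OF k(2)] O_Y_window[OF k] d_def[symmetric]
    using r k by (auto simp: d_def min_def simp del: upt_Suc)
qed

section \<open>Schubert varieties\<close>

lemma schubert_hull:
  "schubert n k w = zariski_closed n k hull {g ` coord_space (w ` {1..k}) | g. g \<in> borel n}"
  by (simp add: schubert_def zariski_closure_def image_image)

lemma schubert_subset:
  assumes "zariski_closed n k A" "cell_in n A (w ` {1..k})"
  shows "schubert n k w \<subseteq> A"
  unfolding schubert_hull using assms by (intro hull_minimal) (auto simp: cell_in_def)

lemma in_schubertI:
  assumes "\<And>A. zariski_closed n k A \<Longrightarrow> cell_in n A (w ` {1..k}) \<Longrightarrow> V \<in> A"
  shows "V \<in> schubert n k w"
  unfolding schubert_hull hull_def using assms by (auto simp: cell_in_def subset_iff)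

lemma cell_subset_schubert: "g \<in> borel n \<Longrightarrow> g ` coord_space (w ` {1..k}) \<in> schubert n k w"
  by (rule in_schubertI) (simp add: cell_in_def)

lemma schubert_id:
  assumes "1 \<le> k" "k \<le> n"
  shows "schubert n k id = {coord_space {1..k}}"
proof
  have adm: "adm n k {1..k}" using assms by (auto simp: adm_def bar_def)
  have rank: "rank_locus n k k k \<subseteq> {coord_space {1..k}}"
  proof
    fix V assume V: "V \<in> rank_locus n k k k"
    then have "V \<in> IG n k" by (simp add: rank_locus_def)
    then obtain I g where I: "adm n k I" and g: "g \<in> borel n" "\<And>i. i \<in> {1..2*n+1} \<Longrightarrow> g (bvec i) i = 1"
      and Vg: "V = g ` coord_space I"
      by (rule bruhat_decomposition) (rule that)
    have I': "card I = k" "finite I" using I finite_subset by (auto simp: adm_def)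
    have "k \<le> card (I \<inter> {1..k})" using rank_locus_card[OF g(1) I g(2)] V Vg by simp
    then have "card (I \<inter> {1..k}) = card I" "card (I \<inter> {1..k}) = card {1..k}"
      using card_mono[OF I'(2), of "I \<inter> {1..k}"] I'(1) by auto
    then have "I \<inter> {1..k} = I" "I \<inter> {1..k} = {1..k}"
      using card_subset_eq[OF I'(2), of "I \<inter> {1..k}"] card_subset_eq[of "{1..k}" "I \<inter> {1..k}"] by auto
    then have "I = {1..k}" by simp
    then show "V \<in> {coord_space {1..k}}" using Vg borel_flag[OF g(1), of k] assms by simp
  qed
  have "cell_in n (rank_locus n k k k) (id ` {1..k})"
    using borel_image_rank_locus[OF _ adm, of _ k k] by (auto simp: cell_in_def)
  then show "schubert n k id \<subseteq> {coord_space {1..k}}"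
    using schubert_subset[OF zariski_closed_rank_locus] rank by blast
  show "{coord_space {1..k}} \<subseteq> schubert n k id"
    using cell_subset_schubert[OF id_borel, of id k n] by simp
qed

text \<open>Joint verification for the two target sets: \<open>C\<close> consists of the indices
  kept in \<open>{1..k}\<close>, and \<open>U\<close> of those whose partners are used
  instead.\<close>

lemma target_set:
  assumes kn: "1 \<le> k" "k \<le> n" and C: "C \<subseteq> {1..k}" and U: "U \<subseteq> {2..k+1}" "C \<inter> U = {}"
    and card: "card C + card U = k"
  shows "adm n k (C \<union> bar n ` U)" "card (C \<union> bar n ` U) = k"
    "(C \<union> bar n ` U) \<inter> {1..k} = C" "1 \<in> C \<union> bar n ` U \<longleftrightarrow> 1 \<in> C"
proof -
  have U': "n + 2 \<le> bar n u" "bar n u \<le> 2*n+1" "bar n (bar n u) = u" if "u \<in> U" for u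
  proof -
    have "u \<in> {2..k+1}" using that U(1) by blast
    then show "n + 2 \<le> bar n u" "bar n u \<le> 2*n+1" "bar n (bar n u) = u" using kn by (auto simp: bar_def)
  qed
  have C': "1 \<le> c" "c \<le> k" if "c \<in> C" for c using that C by auto
  have fin: "finite C" "finite U" using C U(1) finite_subset by blast+
  have inj: "inj_on (bar n) U" by (rule inj_on_inverseI[of _ "bar n"]) (rule U'(3))
  have disj: "C \<inter> bar n ` U = {}" using U'(1) C'(2) kn by fastforce
  show c: "card (C \<union> bar n ` U) = k"
    using card_Un_disjoint[OF fin(1) _ disj] fin(2) card_image[OF inj] card by simp
  have sub: "C \<union> bar n ` U \<subseteq> {1..2*n+1}"
  proof
    fix x assume x: "x \<in> C \<union> bar n ` U"
    show "x \<in> {1..2*n+1}"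
    proof (cases "x \<in> C")
      case True
      then show ?thesis using C'[OF True] kn by auto
    next
      case False
      then obtain u where "u \<in> U" "x = bar n u" using x by blast
      then show ?thesis using U'(1,2)[of u] by auto
    qed
  qed
  have "bar n x \<notin> C \<union> bar n ` U" if "x \<in> C \<union> bar n ` U" for x
    using that
  proof (elim UnE imageE)
    assume x: "x \<in> C"
    then have "bar n x > n + 2" using C'[OF x] kn by (simp add: bar_def)
    then have "bar n x \<notin> C" using C'(2)[of "bar n x"] kn by auto
    moreover have "bar n x \<noteq> bar n u" if "u \<in> U" for u
    proof
      assume "bar n x = bar n u"
      moreover have "u \<in> {2..k+1}" using that U(1) by blast
      ultimately have "x = u" using C'[OF x] kn bar_eq_iff[of x n u] by simp
      then show False using x that U(2) by blast
    qed
    ultimately show ?thesis by auto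
  next
    fix u assume u: "x = bar n u" "u \<in> U"
    then have "bar n x = u" "u \<le> n + 1" using U'(3) U(1) kn by auto
    then show ?thesis using u(2) U(2) U'(1) by fastforce
  qed
  then show "adm n k (C \<union> bar n ` U)" using sub c by (simp add: adm_def)
  show "(C \<union> bar n ` U) \<inter> {1..k} = C" using C U'(1) kn by fastforce
  show "1 \<in> C \<union> bar n ` U \<longleftrightarrow> 1 \<in> C" using U'(1) by force
qed

theorem proposition4p11:
  fixes n k d d1 d2 :: nat
  assumes "1 \<le> k" and "k \<le> n" and "1 \<le> d"
    and "d1 + d2 + 1 = d"
  shows "curve_nbhd n k d (schubert n k id) =
           schubert n k (O_Y n k d1 d2) \<union> schubert n k (O_Z n d)
         \<and> schubert n k (O_Z n d) \<subseteq> closed_orbit n k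
         \<and> schubert n k (O_Y n k d1 d2) \<inter> open_orbit n k \<noteq> {}"
proof -
  note kn = assms(1,2)
  \<comment> \<open>Index \<open>1\<close> is never replaced in the closed orbit, so at most
    \<open>k - 1\<close> others can be.\<close>
  define rz where "rz = min d (k - 1)"
  define ry where "ry = min d k"
  define CZ where "CZ = insert 1 {rz + 2..k}"
  define CY where "CY = {ry + 1..k}"
  define UZ where "UZ = {2..rz + 1}"
  define UY where "UY = insert (k + 1) {2..ry}"
  have rz: "rz \<le> k - 1" "rz \<le> d" and ry: "1 \<le> ry" "ry \<le> k" "ry \<le> d"
    using assms by (auto simp: rz_def ry_def)
  have TZ: "O_Z n d ` {1..k} = CZ \<union> bar n ` UZ"
    unfolding CZ_def UZ_def by (rule O_Z_image[OF kn rz_def])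
  have TY: "O_Y n k d1 d2 ` {1..k} = CY \<union> bar n ` UY"
    unfolding CY_def UY_def by (rule O_Y_image[OF kn]) (simp only: ry_def assms(4))
  have Z: "CZ \<subseteq> {1..k}" "UZ \<subseteq> {2..k + 1}" "CZ \<inter> UZ = {}" "card CZ = k - rz" "card UZ = rz" "{2..k} \<subseteq> CZ \<union> UZ"
    using rz kn by (auto simp: CZ_def UZ_def)
  have Y: "CY \<subseteq> {1..k}" "UY \<subseteq> {2..k + 1}" "CY \<inter> UY = {}" "card CY = k - ry" "card UY = ry" "{2..k} \<subseteq> CY \<union> UY"
    using ry kn by (auto simp: CY_def UY_def)
  note targetZ = target_set[OF kn Z(1-3)] and targetY = target_set[OF kn Y(1-3)]
  have cZ: "card CZ + card UZ = k" and cY: "card CY + card UY = k" using Z Y rz ry kn by auto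
  have one: "1 \<in> CZ" "1 \<notin> CY" using ry by (auto simp: CZ_def CY_def)
  let ?G = "rank_locus n k k (k - d)"
  have inZ: "schubert n k (O_Z n d) \<subseteq> ?G"
  proof (rule schubert_subset[OF zariski_closed_rank_locus])
    have "k - d \<le> card ((CZ \<union> bar n ` UZ) \<inter> {1..k})" using targetZ(3)[OF cZ] Z(4) rz by simp
    then show "cell_in n ?G (O_Z n d ` {1..k})"
      unfolding TZ cell_in_def using borel_image_rank_locus[OF _ targetZ(1)[OF cZ]] by blast
  qed
  have inY: "schubert n k (O_Y n k d1 d2) \<subseteq> ?G"
  proof (rule schubert_subset[OF zariski_closed_rank_locus])
    have "k - d \<le> card ((CY \<union> bar n ` UY) \<inter> {1..k})" using targetY(3)[OF cY] Y(4) ry by simp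
    then show "cell_in n ?G (O_Y n k d1 d2 ` {1..k})"
      unfolding TY cell_in_def using borel_image_rank_locus[OF _ targetY(1)[OF cY]] by blast
  qed
  have cover: "?G \<subseteq> schubert n k (O_Y n k d1 d2) \<union> schubert n k (O_Z n d)"
  proof
    fix V assume V: "V \<in> ?G"
    then have "V \<in> IG n k" by (simp add: rank_locus_def)
    then obtain I g where I: "adm n k I" and g: "g \<in> borel n" "\<And>i. i \<in> {1..2*n+1} \<Longrightarrow> g (bvec i) i = 1"
      and Vg: "V = g ` coord_space I"
      by (rule bruhat_decomposition) (rule that)
    have finI: "finite I" using I finite_subset by (auto simp: adm_def)
    have c: "k - d \<le> card (I \<inter> {1..k})" using rank_locus_card[OF g(1) I g(2)] V Vg by simp
    show "V \<in> schubert n k (O_Y n k d1 d2) \<union> schubert n k (O_Z n d)"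
    proof (cases "1 \<in> I")
      case True
      have "V \<in> schubert n k (O_Z n d)"
      proof (rule in_schubertI)
        fix A assume A: "zariski_closed n k A" "cell_in n A (O_Z n d ` {1..k})"
        \<comment> \<open>If \<open>d \<ge> k\<close> the rank condition is void, but index 1 alone
          provides the required bound \<open>k - rz = 1\<close>.\<close>
        have "1 \<in> I \<inter> {1..k}" using True kn by simp
        then have "0 < card (I \<inter> {1..k})" using finI by (auto simp: card_gt_0_iff)
        then have "k - rz \<le> card (I \<inter> {1..k})" using c by (auto simp: rz_def min_def)
        moreover have "CZ = {i. i = 1 \<and> True} \<union> {k + 1 - (if True then k - rz - 1 else k - rz)..k}"
          using rz kn by (auto simp: CZ_def)
        ultimately have "cell_in n A I"
          using cells_in_closed[OF A(1) kn, where one = True and c = "k - rz" and I = I, OF _ _ refl targetZ(2)[OF cZ] Z(2,6,3)]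
            A(2)[unfolded TZ] I True rz kn by simp
        then show "V \<in> A" using g(1) by (simp add: cell_in_def Vg)
      qed
      then show ?thesis by simp
    next
      case False
      have "V \<in> schubert n k (O_Y n k d1 d2)"
      proof (rule in_schubertI)
        fix A assume A: "zariski_closed n k A" "cell_in n A (O_Y n k d1 d2 ` {1..k})"
        have "k - ry \<le> card (I \<inter> {1..k})" using c by (auto simp: ry_def min_def)
        moreover have "CY = {i. i = 1 \<and> False} \<union> {k + 1 - (if False then k - ry - 1 else k - ry)..k}"
          using ry kn by (auto simp: CY_def)
        ultimately have "cell_in n A I"
          using cells_in_closed[OF A(1) kn, where one = False and c = "k - ry" and I = I, OF _ _ refl targetY(2)[OF cY] Y(2,6,3)]
            A(2)[unfolded TY] I False by simp
        then show "V \<in> A" using g(1) by (simp add: cell_in_def Vg)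
      qed
      then show ?thesis by simp
    qed
  qed
  have closed: "schubert n k (O_Z n d) \<subseteq> closed_orbit n k"
  proof -
    \<comment> \<open>Containing the first basis vector is itself a rank condition, so it passes
      from the cell of \<open>O_Z\<close> to its closure.\<close>
    have "card ((CZ \<union> bar n ` UZ) \<inter> {1..1}) = 1" using one(1) by simp
    then have "cell_in n (rank_locus n k 1 1) (O_Z n d ` {1..k})"
      unfolding TZ cell_in_def using borel_image_rank_locus[OF _ targetZ(1)[OF cZ], of _ 1 1] by simp
    then have "schubert n k (O_Z n d) \<subseteq> rank_locus n k 1 1"
      by (rule schubert_subset[OF zariski_closed_rank_locus])
    moreover have "rank_locus n k 1 1 \<subseteq> closed_orbit n k"
    proof
      fix V assume V: "V \<in> rank_locus n k 1 1"
      then have IG: "V \<in> IG n k" by (simp add: rank_locus_def)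
      obtain I g where I: "adm n k I" and g: "g \<in> borel n" "\<And>i. i \<in> {1..2*n+1} \<Longrightarrow> g (bvec i) i = 1"
        and Vg: "V = g ` coord_space I"
        by (rule bruhat_decomposition[OF IG]) (rule that)
      have "1 \<le> card (I \<inter> {1..1})" using rank_locus_card[OF g(1) I g(2)] V unfolding Vg by blast
      then have "1 \<in> I" by (cases "1 \<in> I") auto
      then have "g ` coord_space {1..1} \<subseteq> V" unfolding Vg by (intro image_mono cvs.span_mono) auto
      moreover have "g ` coord_space {1..1} = coord_space {1..1}" by (rule borel_flag[OF g(1)]) simp
      ultimately have "coord_space {1..1} \<subseteq> V" by simp
      moreover have "bvec 1 \<in> coord_space {1..1}" by (rule cvs.span_base) simp
      ultimately show "V \<in> closed_orbit n k" using IG by (auto simp: closed_orbit_def)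
    qed
    ultimately show ?thesis by blast
  qed
  have "coord_space (CY \<union> bar n ` UY) \<in> schubert n k (O_Y n k d1 d2) \<inter> open_orbit n k"
  proof
    show "coord_space (CY \<union> bar n ` UY) \<in> schubert n k (O_Y n k d1 d2)"
      using cell_subset_schubert[OF id_borel, of "O_Y n k d1 d2" k] TY by simp
    have "finite (CY \<union> bar n ` UY)" by (auto simp: CY_def UY_def)
    moreover have "1 \<notin> CY \<union> bar n ` UY" using targetY(4)[OF cY] one(2) by blast
    ultimately have "bvec 1 \<notin> coord_space (CY \<union> bar n ` UY)" by (auto simp: span_bvec bvec_apply)
    then show "coord_space (CY \<union> bar n ` UY) \<in> open_orbit n k"
      using borel_image_IG[OF id_borel targetY(1)[OF cY]] by (simp add: open_orbit_def)
  qed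
  moreover have "curve_nbhd n k d (schubert n k id) = ?G"
    using curve_nbhd_point[OF kn assms(3)] schubert_id[OF kn] by simp
  ultimately show ?thesis using inZ inY cover closed by blast
qed

end
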